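(* Let $N\ge1$ and let $f$ be a non-constant generalized modular function of weight $0$ on $\Gamma_0(N)$ with $\mathrm{div}(f)=0$ and $q$-exponents $c(n)$ ($n\in\mathbb{N}$). Suppose that $g=\frac{1}{2\pi i}f'/f$ is a normalized Hecke eigenform. Let $K_f$ be the number field generated over $\mathbb{Q}$ by the $c(n)$ and $\mathcal{O}_{K_f}$ its ring of integers. Then there are only finitely many primes $p$ such that $c(p)\neq 0$ and $c(p)\in\mathcal{O}_{K_f}$.
   Context: A GMF of integral weight $k$ on $\Gamma_0(N)$ is a holomorphic $f$ on $\mathbb{H}$ with $f\left(\frac{az+b}{cz+d}\right)=\chi(\gamma)(cz+d)^kf(z)$ for all $\gamma\in\Gamma_0(N)$, for some (not necessarily unitary) character $\chi:\Gamma_0(N)\to\mathbb{C}^*$ with $\chi(\gamma)=1$ for parabolic $\gamma$ of trace $2$. $\mathrm{div}(f)=0$: no zeros or poles in $\mathbb{H}$ or at cusps. A nonzero weight-$0$ GMF expands as $c\,q^h\prod_{n\ge1}(1-q^n)^{c(n)}$ near $q=0$ ($q=e^{2\pi iz}$, $c\ne0$), the $c(n)$ being its uniquely determined $q$-exponents. Then $g=\frac{1}{2\pi i}f'/f=\sum b(n)q^n$ is a weight-$2$ cusp form on $\Gamma_0(N)$ with trivial character, $b(n)=-\sum_{d\mid n}dc(d)$ and $nc(n)=-\sum_{d\mid n}\mu(d)b(n/d)$; normalized means $b(1)=1$. (For a normalized eigenform the $b(n)$, hence the $c(n)$, generate a number field.) *)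

theory Defs
  imports "HOL-Complex_Analysis.Complex_Analysis" "HOL-Computational_Algebra.Computational_Algebra"
begin

type_synonym mat2 = "int \<times> int \<times> int \<times> int"

definition uhp :: "complex set" where
  "uhp = {z. Im z > 0}"

definition SL2Z :: "mat2 set" where
  "SL2Z = {(a,b,c,d). a*d - b*c = 1}"

definition Gamma0 :: "nat \<Rightarrow> mat2 set" where
  "Gamma0 N = {(a,b,c,d). a*d - b*c = 1 \<and> int N dvd c}"

fun mmul :: "mat2 \<Rightarrow> mat2 \<Rightarrow> mat2" where
  "mmul (a,b,c,d) (a',b',c',d') = (a*a' + b*c', a*b' + b*d', c*a' + d*c', c*b' + d*d')"

fun mtrace :: "mat2 \<Rightarrow> int" where
  "mtrace (a,b,c,d) = a + d"

fun mob :: "mat2 \<Rightarrow> complex \<Rightarrow> complex" where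
  "mob (a,b,c,d) z = (of_int a * z + of_int b) / (of_int c * z + of_int d)"

fun jfac :: "mat2 \<Rightarrow> complex \<Rightarrow> complex" where
  "jfac (a,b,c,d) z = of_int c * z + of_int d"

definition at_i_infty :: "complex filter" where
  "at_i_infty = filtercomap Im at_top"

definition gmf :: "nat \<Rightarrow> int \<Rightarrow> (complex \<Rightarrow> complex) \<Rightarrow> bool" where
  "gmf N k f \<longleftrightarrow> f holomorphic_on uhp \<and>
     (\<exists>chi :: mat2 \<Rightarrow> complex.
        (\<forall>gm\<in>Gamma0 N. chi gm \<noteq> 0) \<and>
        (\<forall>gm1\<in>Gamma0 N. \<forall>gm2\<in>Gamma0 N. chi (mmul gm1 gm2) = chi gm1 * chi gm2) \<and>
        (\<forall>gm\<in>Gamma0 N. mtrace gm = 2 \<longrightarrow> chi gm = 1) \<and>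
        (\<forall>gm\<in>Gamma0 N. \<forall>z\<in>uhp. f (mob gm z) = chi gm * (jfac gm z) powi k * f z))"

text \<open>div(f) = 0 for a weight-0 function: no zeros in H, and at every cusp
  sigma(i*infinity) (sigma in SL2(Z)) the function has order 0, i.e. a finite nonzero limit.\<close>
definition div_zero0 :: "(complex \<Rightarrow> complex) \<Rightarrow> bool" where
  "div_zero0 f \<longleftrightarrow> (\<forall>z\<in>uhp. f z \<noteq> 0) \<and>
     (\<forall>sg\<in>SL2Z. \<exists>L. L \<noteq> 0 \<and> ((\<lambda>z. f (mob sg z)) \<longlongrightarrow> L) at_i_infty)"

definition qvar :: "complex \<Rightarrow> complex" where
  "qvar z = exp (2 * of_real pi * \<i> * z)"

definition q_exponents :: "(complex \<Rightarrow> complex) \<Rightarrow> (nat \<Rightarrow> complex) \<Rightarrow> bool" where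
  "q_exponents f c \<longleftrightarrow> (\<exists>C (h::int) (T::real). C \<noteq> 0 \<and>
     (\<forall>z. Im z > T \<longrightarrow> (\<exists>P. (\<lambda>n. (1 - qvar z ^ (n+1)) powr c (n+1)) has_prod P \<and>
                              f z = C * qvar z powi h * P)))"

definition cusp_form2 :: "nat \<Rightarrow> (complex \<Rightarrow> complex) \<Rightarrow> bool" where
  "cusp_form2 N g \<longleftrightarrow> g holomorphic_on uhp \<and>
     (\<forall>gm\<in>Gamma0 N. \<forall>z\<in>uhp. g (mob gm z) = (jfac gm z)^2 * g z) \<and>
     (\<forall>sg\<in>SL2Z. ((\<lambda>z. g (mob sg z) / (jfac sg z)^2) \<longlongrightarrow> 0) at_i_infty)"

definition fourier_coeffs :: "(complex \<Rightarrow> complex) \<Rightarrow> (nat \<Rightarrow> complex) \<Rightarrow> bool" where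
  "fourier_coeffs g b \<longleftrightarrow> (\<forall>z\<in>uhp. (\<lambda>n. b n * qvar z ^ n) sums g z)"

text \<open>Eigenvector of every Hecke operator T_p (= U_p for p | N), weight 2, trivial character,
  expressed through the action of T_p on q-expansions.\<close>
definition hecke_eigen_coeffs :: "nat \<Rightarrow> (nat \<Rightarrow> complex) \<Rightarrow> bool" where
  "hecke_eigen_coeffs N b \<longleftrightarrow> (\<forall>p::nat. prime p \<longrightarrow> (\<exists>ev. \<forall>n\<ge>1.
      b (p * n) + (if \<not> p dvd N \<and> p dvd n then of_nat p * b (n div p) else 0) = ev * b n))"

definition normalized_hecke_eigenform :: "nat \<Rightarrow> (complex \<Rightarrow> complex) \<Rightarrow> bool" where
  "normalized_hecke_eigenform N g \<longleftrightarrow> cusp_form2 N g \<and>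
     (\<exists>b. fourier_coeffs g b \<and> b 1 = 1 \<and> hecke_eigen_coeffs N b)"

definition is_subfield :: "complex set \<Rightarrow> bool" where
  "is_subfield F \<longleftrightarrow> 0 \<in> F \<and> 1 \<in> F \<and> (\<forall>x\<in>F. \<forall>y\<in>F. x + y \<in> F \<and> x * y \<in> F) \<and>
     (\<forall>x\<in>F. - x \<in> F \<and> (x \<noteq> 0 \<longrightarrow> inverse x \<in> F))"

definition gen_field :: "complex set \<Rightarrow> complex set" where
  "gen_field S = \<Inter>{F. is_subfield F \<and> S \<subseteq> F}"

definition ring_of_integers :: "complex set \<Rightarrow> complex set" where
  "ring_of_integers K = {x \<in> K. algebraic_int x}"

end

theory Submission
  imports Defs "Jordan_Normal_Form.Char_Poly" "HOL-Number_Theory.Cong"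
begin

text \<open>Comparing expansions gives \<open>p * c p = 1 - b p\<close>. Let \<open>F = log f\<close>. If \<open>p\<close> does not divide \<open>N\<close>,
  then \<open>F (p z) + (\<Sum>j<p. F ((z + j) / p)) = b p * F z + const\<close>. By hypothesis \<open>F\<close> has limits at the
  cusps, whose differences are modular symbols; up to \<open>Gamma0 N\<close> there are only \<open>M\<close> symbols
  \<open>{\<sigma> 0, \<sigma> \<infinity>}\<close>, and not all vanish as \<open>f\<close> is not constant. By continued fractions
  \<open>(b p) ^ k\<close> is an eigenvalue of an integer \<open>M\<close> by \<open>M\<close> matrix whose rows have sums
  of size \<open>O ((p + 1) ^ k * (1 + k * log p))\<close>; letting \<open>k\<close> grow, every conjugate of \<open>b p\<close> has modulus at
  most \<open>p + 1\<close>. This replaces Deligne's bound. The maximum of \<open>y * norm (F' z)\<close> together with the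
  fact that a positive proportion of the Hecke points is close to the cusps yields
  \<open>norm (b p) \<le> (1 - \<delta>) * p + 1\<close> with \<open>\<delta> > 0\<close> independent of \<open>p\<close>. Hence for large \<open>p\<close> the norm of
  \<open>c p = (1 - b p) / p\<close> is less than \<open>1\<close> in modulus, so that \<open>c p\<close> cannot be a nonzero algebraic integer.\<close>

text \<open>The bound \<open>p + 1\<close> for the conjugates of \<open>b p\<close> only puts the
  conjugates of \<open>c p\<close> below \<open>1 + 2 / p\<close>, which leaves a norm of modulus
  \<open>1\<close> or more possible. One factor must be bounded away from \<open>1\<close>. This is
  done for \<open>c p\<close> itself, because the maximum argument concerns the given
  \<open>F\<close> and says nothing about conjugate forms. There are fewer than \<open>M\<close>
  other factors, and \<open>M\<close> depends on \<open>N\<close> only; hence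
  \<open>(1 + 2 / p) ^ M\<close> tends to \<open>1\<close> and cannot undo the saving
  \<open>\<delta>\<close>. A single Hecke step would not give \<open>p + 1\<close>: each symbol
  \<open>{x, \<infinity>}\<close> costs about the logarithm of the denominator of \<open>x\<close>,
  leaving a factor \<open>log p\<close>. Expressing symbols in the generators only after
  \<open>k\<close> steps makes this cost linear in \<open>k\<close>, so that a \<open>k\<close>-th
  root removes it. The comparison of expansions is delicate because the product converges only
  pointwise, with no growth condition on \<open>c\<close> and an unknown leading exponent
  \<open>h\<close>. A growth bound for \<open>c\<close> has to be extracted first, and
  \<open>h = 0\<close> comes from a scaling argument.\<close>

lemma exp_constant_imp_constant:
  fixes Z :: "'a::topological_space \<Rightarrow> complex"
  assumes "connected S" "continuous_on S Z" "\<And>x. x \<in> S \<Longrightarrow> exp (Z x) = w" "x \<in> S" "y \<in> S"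
  shows "Z x = Z y"
proof -
  have "Z constant_on S"
  proof (rule continuous_discrete_range_constant[OF assms(1,2)])
    fix x assume x: "x \<in> S"
    \<comment> \<open>Distinct logarithms of the same number are at least \<open>2 * pi\<close>
      apart, so the gap \<open>1\<close> is safe.\<close>
    show "\<exists>e>0. \<forall>y. y \<in> S \<and> Z y \<noteq> Z x \<longrightarrow> e \<le> norm (Z y - Z x)"
    proof (intro exI[of _ "1::real"] conjI allI impI)
      fix y assume y: "y \<in> S \<and> Z y \<noteq> Z x"
      have "exp (Z y) = exp (Z x)" using assms(3) x y by simp
      then obtain n :: int where n: "Z y = Z x + of_int (2 * n) * of_real pi * \<i>"
        by (auto simp: exp_eq)
      hence "n \<noteq> 0" using y by auto
      hence "1 \<le> \<bar>real_of_int n\<bar>" by linarith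
      have "norm (Z y - Z x) = 2 * \<bar>real_of_int n\<bar> * pi" using n by (simp add: norm_mult)
      also have "\<dots> \<ge> 2 * 1 * 1" using \<open>1 \<le> \<bar>real_of_int n\<bar>\<close> pi_gt3 by (intro mult_mono) auto
      finally show "1 \<le> norm (Z y - Z x)" by simp
    qed auto
  qed
  thus ?thesis using assms(4,5) by (auto simp: constant_on_def)
qed

lemma convex_uhp: "convex uhp" and open_uhp: "open uhp"
  unfolding uhp_def using convex_halfspace_Im_gt[of 0] open_halfspace_Im_gt[of 0] by auto

section \<open>Algebraic integers and eigenvalues of integer matrices\<close>

abbreviation ipoly_at :: "int poly \<Rightarrow> complex \<Rightarrow> complex" where
  "ipoly_at Q z \<equiv> poly (map_poly of_int Q) z"

text \<open>Gauss's lemma makes an integer polynomial of least degree monic up to sign. The third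
  conclusion replaces field automorphisms: every integral relation satisfied by \<open>c\<close>
  passes to all roots of \<open>\<mu>\<close>, that is, to the conjugates of
  \<open>c\<close>.\<close>

lemma algebraic_int_min_poly:
  fixes c :: complex
  assumes "algebraic_int c"
  obtains \<mu> :: "int poly" where "lead_coeff \<mu> = 1" "ipoly_at \<mu> c = 0"
    "\<And>Q z. ipoly_at Q c = 0 \<Longrightarrow> ipoly_at \<mu> z = 0 \<Longrightarrow> ipoly_at Q z = 0"
    "\<And>Q. ipoly_at Q c = 0 \<Longrightarrow> Q \<noteq> 0 \<Longrightarrow> degree \<mu> \<le> degree Q"
proof -
  obtain P where P: "ipoly_at P c = 0" "lead_coeff P = 1"
    using assms unfolding algebraic_int_altdef_ipoly by blast
  define S where "S = (\<lambda>n. \<exists>Q. Q \<noteq> 0 \<and> ipoly_at Q c = 0 \<and> degree Q = n)"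
  have "S (degree P)" unfolding S_def using P
    by (intro exI[of _ P]) (metis leading_coeff_0_iff zero_neq_one)
  hence "S (LEAST n. S n)" by (rule LeastI)
  then obtain Q0 where Q0: "Q0 \<noteq> 0" "ipoly_at Q0 c = 0" "degree Q0 = (LEAST n. S n)"
    unfolding S_def by blast
  have min: "degree Q0 \<le> degree Q" if "Q \<noteq> 0" "ipoly_at Q c = 0" for Q
    unfolding Q0(3) by (rule Least_le) (use that S_def in blast)
  define m where "m = primitive_part Q0"
  have Q0m: "Q0 = Polynomial.smult (content Q0) m" by (simp add: m_def)
  have m0: "m \<noteq> 0" using Q0(1) by (simp add: m_def)
  have hom_smult: "ipoly_at (Polynomial.smult a Q) z = of_int a * ipoly_at Q z" for a Q z
    by (simp add: of_int_hom.map_poly_hom_smult)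
  have hom_mult: "ipoly_at (P * Q) z = ipoly_at P z * ipoly_at Q z" for P Q z
    by (simp add: of_int_poly_hom.hom_mult)
  have hom_add: "ipoly_at (P + Q) z = ipoly_at P z + ipoly_at Q z" for P Q z
    by (simp add: of_int_poly_hom.hom_add)
  have mc: "ipoly_at m c = 0"
  proof -
    have "of_int (content Q0) * ipoly_at m c = 0"
      using Q0(2) Q0m hom_smult by metis
    thus ?thesis using Q0(1) by simp
  qed
  have dm: "degree m = degree Q0" by (simp add: m_def)
  have cm: "content m = 1" using Q0(1) by (simp add: m_def content_primitive_part)
  have div: "\<exists>a q. a \<noteq> 0 \<and> Polynomial.smult a Q = m * q" if "ipoly_at Q c = 0" for Q
  proof -
    \<comment> \<open>Division over the integers is possible only after scaling by \<open>a\<close>;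
      the remainder vanishes at \<open>c\<close> and has smaller degree, so it is zero.\<close>
    obtain a q where aq: "a \<noteq> 0" "Polynomial.smult a Q = m * q + pseudo_mod Q m"
      using pseudo_mod(1)[OF m0, of Q] by blast
    have "ipoly_at (Polynomial.smult a Q) c = 0" using that by (simp add: hom_smult)
    hence "ipoly_at (pseudo_mod Q m) c = 0"
      unfolding aq(2) by (simp add: hom_mult hom_add mc)
    hence "pseudo_mod Q m = 0"
      using pseudo_mod(2)[OF m0, of Q] min[of "pseudo_mod Q m"] dm by force
    thus ?thesis using aq by auto
  qed
  have lead: "lead_coeff m dvd 1"
  proof -
    obtain a q where aq: "a \<noteq> 0" "Polynomial.smult a P = m * q" using div[OF P(1)] by blast
    have "content P = 1"
    proof -
      have "content P dvd lead_coeff P" by (rule content_dvd_coeff)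
      thus ?thesis using P(2) by (metis is_unit_content_iff)
    qed
    \<comment> \<open>Contents are multiplicative and both \<open>P\<close> and \<open>m\<close>
      have content \<open>1\<close>. So \<open>a\<close> divides the content of \<open>q\<close> and
      cancels, which makes \<open>m\<close> a divisor of the monic \<open>P\<close> over the
      integers.\<close>
    hence "normalize a = content q" using arg_cong[OF aq(2), of content]
      by (simp only: content_smult content_mult cm mult_1_left mult_1_right)
    hence "a dvd content q" by (metis dvd_normalize_iff dvd_refl)
    then obtain e where e: "content q = a * e" by blast
    have "Polynomial.smult a P = Polynomial.smult a (m * Polynomial.smult e (primitive_part q))"
      using aq(2) e by (metis content_times_primitive_part mult_smult_right smult_smult)
    hence "P = m * Polynomial.smult e (primitive_part q)" using aq(1) smult_cancel by blast
    hence "lead_coeff P = lead_coeff m * lead_coeff (Polynomial.smult e (primitive_part q))"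
      by (simp only: lead_coeff_mult)
    thus ?thesis using P(2) by (metis dvd_triv_left)
  qed
  define u where "u = lead_coeff m"
  have uu: "u * u = 1" using lead unfolding u_def by (auto simp: zdvd1_eq abs_if split: if_splits)
  show ?thesis
  proof (rule that[of "Polynomial.smult u m"])
    show "lead_coeff (Polynomial.smult u m) = 1" using uu m0 by (simp add: u_def)
    show "ipoly_at (Polynomial.smult u m) c = 0" by (simp add: hom_smult mc)
    fix Q z assume Q: "ipoly_at Q c = 0" and z: "ipoly_at (Polynomial.smult u m) z = 0"
    have mz: "ipoly_at m z = 0" using z uu by (auto simp: hom_smult)
    obtain a q where aq: "a \<noteq> 0" "Polynomial.smult a Q = m * q" using div[OF Q] by blast
    have "of_int a * ipoly_at Q z = ipoly_at m z * ipoly_at q z"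
      using aq(2) by (metis hom_smult hom_mult)
    thus "ipoly_at Q z = 0" using mz aq(1) by simp
  next
    fix Q assume "ipoly_at Q c = 0" "Q \<noteq> 0"
    thus "degree (Polynomial.smult u m) \<le> degree Q" using min[of Q] dm uu by auto
  qed
qed

text \<open>The characteristic polynomial serves as \<open>\<psi>\<close>. Its roots are
  eigenvalues, and the row of an eigenvector entry of largest modulus bounds them by the row sum.
  The \<open>v j\<close> may be linearly dependent; only a nonzero eigenvector is required.\<close>

lemma integer_matrix_eigenvalue_poly:
  fixes a :: "nat \<Rightarrow> nat \<Rightarrow> int" and v :: "nat \<Rightarrow> complex" and B :: real
  assumes eig: "\<And>j. j < M \<Longrightarrow> e * v j = (\<Sum>i<M. of_int (a j i) * v i)"
    and nz: "j0 < M" "v j0 \<noteq> 0"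
    and row: "\<And>j. j < M \<Longrightarrow> (\<Sum>i<M. \<bar>of_int (a j i)\<bar>) \<le> B"
  obtains \<psi> :: "int poly" where "lead_coeff \<psi> = 1" "degree \<psi> = M" "ipoly_at \<psi> e = 0"
    "\<And>z. ipoly_at \<psi> z = 0 \<Longrightarrow> norm z \<le> B"
proof -
  define A where "A = mat M M (\<lambda>(j,i). a j i)"
  define C where "C = (map_mat of_int A :: complex mat)"
  have A: "A \<in> carrier_mat M M" and C: "C \<in> carrier_mat M M" by (auto simp: A_def C_def)
  have Cpoly: "char_poly C = map_poly of_int (char_poly A)"
    unfolding C_def by (rule of_int_hom.char_poly_hom[OF A])
  define w where "w = vec M v"
  have w: "w \<in> carrier_vec M" by (simp add: w_def)
  have "C *\<^sub>v w = e \<cdot>\<^sub>v w"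
    by (rule eq_vecI) (auto simp: C_def A_def w_def scalar_prod_def eig lessThan_atLeast0)
  moreover have "w \<noteq> 0\<^sub>v M" using nz by (metis index_vec index_zero_vec(1) w_def)
  ultimately have "eigenvalue C e"
    unfolding eigenvalue_def eigenvector_def using w C by auto
  hence r: "ipoly_at (char_poly A) e = 0"
    using eigenvalue_root_char_poly[OF C] Cpoly by simp
  have bd: "norm z \<le> B" if "ipoly_at (char_poly A) z = 0" for z
  proof -
    have "eigenvalue C z" using eigenvalue_root_char_poly[OF C] Cpoly that by simp
    then obtain x where x: "x \<in> carrier_vec M" "x \<noteq> 0\<^sub>v M" "C *\<^sub>v x = z \<cdot>\<^sub>v x"
      unfolding eigenvalue_def eigenvector_def using C by auto
    define y where "y = vec_index x"
    define m where "m = Max ((\<lambda>i. norm (y i)) ` {..<M})"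
    have fin: "finite ((\<lambda>i. norm (y i)) ` {..<M})" and ne: "((\<lambda>i. norm (y i)) ` {..<M}) \<noteq> {}"
      using nz by auto
    have le: "norm (y i) \<le> m" if "i < M" for i
      unfolding m_def by (rule Max_ge[OF fin]) (use that in auto)
    obtain j where j: "j < M" "norm (y j) = m"
      using Max_in[OF fin ne] unfolding m_def by force
    have "m > 0"
    proof (rule ccontr)
      assume "\<not> m > 0"
      hence "y i = 0" if "i < M" for i using le[OF that] norm_ge_zero[of "y i"]
        by (metis norm_le_zero_iff order_trans not_less)
      hence "x = 0\<^sub>v M" using x(1) by (intro eq_vecI) (auto simp: y_def)
      thus False using x(2) by simp
    qed
    have Cx: "vec_index (C *\<^sub>v x) j = (\<Sum>i<M. of_int (a j i) * y i)"
      using j x(1) by (simp add: C_def A_def y_def scalar_prod_def lessThan_atLeast0)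
    have "z * y j = vec_index (z \<cdot>\<^sub>v x) j" using j x(1) by (simp add: y_def)
    also have "\<dots> = (\<Sum>i<M. of_int (a j i) * y i)" using Cx by (simp only: x(3))
    finally have "norm z * m = norm (\<Sum>i<M. of_int (a j i) * y i)"
      using j by (metis norm_mult)
    also have "\<dots> \<le> (\<Sum>i<M. \<bar>of_int (a j i)\<bar> * m)"
      by (rule sum_norm_le) (auto simp: norm_mult le intro!: mult_left_mono)
    also have "\<dots> \<le> B * m" using row[OF j(1)] \<open>m > 0\<close>
      by (simp add: sum_distrib_right[symmetric])
    finally show ?thesis using \<open>m > 0\<close> by simp
  qed
  show ?thesis
    by (rule that[of "char_poly A"]) (use degree_monic_char_poly[OF A] r bd in auto)
qed

lemma le_one_of_power_le_linear:
  fixes x \<alpha> \<beta> :: real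
  assumes "\<And>k::nat. x ^ k \<le> \<alpha> + \<beta> * real k" "x \<ge> 0"
  shows "x \<le> 1"
proof (rule ccontr)
  assume "\<not> x \<le> 1" hence x: "x > 1" by simp
  have "(\<lambda>k. (\<alpha> + \<beta> * real k) / x ^ k) \<longlonglongrightarrow> 0"
  proof -
    have "(\<lambda>k. \<alpha> * inverse x ^ k + \<beta> * (real k * inverse x ^ k)) \<longlonglongrightarrow> \<alpha> * 0 + \<beta> * 0"
      using x by (intro tendsto_intros LIMSEQ_power_zero powser_times_n_limit_0)
        (auto simp: inverse_less_1_iff)
    thus ?thesis by (simp add: add_divide_distrib divide_inverse power_inverse algebra_simps)
  qed
  hence "eventually (\<lambda>k. (\<alpha> + \<beta> * real k) / x ^ k < 1) sequentially"
    by (rule order_tendstoD) simp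
  then obtain k where "(\<alpha> + \<beta> * real k) / x ^ k < 1" by (auto simp: eventually_sequentially)
  thus False using assms(1)[of k] x by (simp add: divide_simps)
qed

text \<open>If \<open>c'\<close> is a conjugate of \<open>c\<close>, then \<open>(1 - p * c') ^ k\<close> is an eigenvalue of the
  integer matrix \<open>a k\<close> for every \<open>k\<close>; the linear factor in the bound for its rows
  disappears on taking \<open>k\<close>-th roots, so that \<open>1 - p * c'\<close> has modulus at most \<open>p + 1\<close>.\<close>

lemma algebraic_int_norm_bound:
  fixes c :: complex and a :: "nat \<Rightarrow> nat \<Rightarrow> nat \<Rightarrow> int" and v :: "nat \<Rightarrow> complex" and p :: nat
  assumes c: "algebraic_int c" "c \<noteq> 0" and p: "p > 0"
    and eig: "\<And>k j. j < M \<Longrightarrow> (1 - of_nat p * c) ^ k * v j = (\<Sum>i<M. of_int (a k j i) * v i)"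
    and nz: "j0 < M" "v j0 \<noteq> 0"
    and row: "\<And>k j. j < M \<Longrightarrow> (\<Sum>i<M. \<bar>of_int (a k j i)\<bar>) \<le> (real p + 1) ^ k * (\<alpha> + \<beta> * real k)"
  shows "1 \<le> norm c * ((real p + 2) / real p) ^ M"
proof -
  obtain \<mu> where \<mu>: "lead_coeff \<mu> = 1" "ipoly_at \<mu> c = 0"
    "\<And>Q z. ipoly_at Q c = 0 \<Longrightarrow> ipoly_at \<mu> z = 0 \<Longrightarrow> ipoly_at Q z = 0"
    "\<And>Q. ipoly_at Q c = 0 \<Longrightarrow> Q \<noteq> 0 \<Longrightarrow> degree \<mu> \<le> degree Q"
    using algebraic_int_min_poly[OF c(1)] by metis
  have comp: "ipoly_at (pcompose \<psi> ([:1, - int p:] ^ k)) z = ipoly_at \<psi> ((1 - of_nat p * z) ^ k)"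
    for \<psi> k z
    by (simp add: of_int_hom.map_poly_pcompose poly_pcompose of_int_poly_hom.hom_power poly_power
       map_poly_pCons of_int_hom.map_poly_pCons_hom algebra_simps)
  have key: "\<exists>\<psi>::int poly. degree \<psi> = M \<and> lead_coeff \<psi> = 1 \<and> ipoly_at \<psi> ((1 - of_nat p * c) ^ k) = 0 \<and>
      (\<forall>z. ipoly_at \<psi> z = 0 \<longrightarrow> norm z \<le> (real p + 1) ^ k * (\<alpha> + \<beta> * real k))" for k
    using integer_matrix_eigenvalue_poly[where a = "a k" and v = v and M = M
         and B = "(real p + 1) ^ k * (\<alpha> + \<beta> * real k)", OF eig nz row] by metis
  have conj: "norm c' \<le> (real p + 2) / real p" if c': "ipoly_at \<mu> c' = 0" for c'
  proof -
    have "(norm (1 - of_nat p * c') / (real p + 1)) ^ k \<le> \<alpha> + \<beta> * real k" for k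
    proof -
      obtain \<psi> where \<psi>: "ipoly_at \<psi> ((1 - of_nat p * c) ^ k) = 0"
        "\<And>z. ipoly_at \<psi> z = 0 \<Longrightarrow> norm z \<le> (real p + 1) ^ k * (\<alpha> + \<beta> * real k)"
        using key[of k] by blast
      \<comment> \<open>\<open>\<psi>((1 - p X)^k)\<close> has integer coefficients and vanishes at
        \<open>c\<close>, hence also at \<open>c'\<close>.\<close>
      have "ipoly_at (pcompose \<psi> ([:1, - int p:] ^ k)) c' = 0"
        by (rule \<mu>(3)[OF _ c']) (simp only: comp \<psi>(1))
      hence "norm ((1 - of_nat p * c') ^ k) \<le> (real p + 1) ^ k * (\<alpha> + \<beta> * real k)"
        by (intro \<psi>(2)) (simp only: comp)
      thus ?thesis by (simp add: norm_power power_divide divide_simps mult_ac)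
    qed
    hence "norm (1 - of_nat p * c') / (real p + 1) \<le> 1"
      by (rule le_one_of_power_le_linear) simp
    hence 1: "norm (1 - of_nat p * c') \<le> real p + 1" by simp
    have "real p * norm c' = norm (1 - (1 - of_nat p * c'))" by (simp add: norm_mult)
    also have "\<dots> \<le> norm (1::complex) + norm (1 - of_nat p * c')" by (rule norm_triangle_ineq4)
    finally show ?thesis using 1 p by (simp add: divide_simps mult_ac)
  qed
  have deg: "degree \<mu> \<le> M"
  proof -
    obtain \<psi> where \<psi>: "degree \<psi> = M" "lead_coeff \<psi> = 1" "ipoly_at \<psi> ((1 - of_nat p * c) ^ 1) = 0"
      using key[of 1] by blast
    \<comment> \<open>Already \<open>k = 1\<close> bounds the degree of \<open>c\<close>:
      \<open>\<psi>(1 - p X)\<close> has degree \<open>M\<close>.\<close>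
    define Q where "Q = pcompose \<psi> ([:1, - int p:] ^ 1)"
    have "degree Q = M" unfolding Q_def degree_pcompose using \<psi> p by simp
    moreover have "Q \<noteq> 0"
    proof
      assume "Q = 0"
      hence "ipoly_at \<psi> ((1 - of_nat p * z) ^ 1) = 0" for z
        using comp[of \<psi> 1 z] by (simp add: Q_def)
      from this[of "(1 - w) / of_nat p" for w] have "poly (map_poly of_int \<psi>) w = 0" for w :: complex
        using p by simp
      hence "map_poly of_int \<psi> = (0 :: complex poly)" using poly_all_0_iff_0 by blast
      thus False using \<psi>(2) by simp
    qed
    ultimately show ?thesis using \<mu>(4)[of Q] comp[of \<psi> 1 c] \<psi>(3) by (simp add: Q_def)
  qed
  define m where "m = (map_poly of_int \<mu> :: complex poly)"
  have dm: "degree m = degree \<mu>" and lm: "lead_coeff m = 1" using \<mu>(1) by (simp_all add: m_def)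
  obtain root where root: "Polynomial.smult (lead_coeff m) (\<Prod>i<degree m. [:-root i, 1:]) = m"
    using complex_poly_decompose' by blast
  have pm: "poly m z = (\<Prod>i<degree m. z - root i)" for z
    by (subst root[symmetric]) (simp add: lm poly_prod algebra_simps)
  have rz: "poly m (root i) = 0" if "i < degree m" for i
    unfolding pm using that by (auto intro!: prod_zero)
  obtain i0 where i0: "i0 < degree m" "root i0 = c"
  proof -
    have "(\<Prod>i<degree m. c - root i) = 0" using \<mu>(2) pm[of c] by (simp add: m_def)
    thus ?thesis using that by (auto simp: prod_zero_iff)
  qed
  have "coeff \<mu> 0 \<noteq> 0"
  proof
    \<comment> \<open>Otherwise division by \<open>X\<close> would give a nonzero polynomial of
      smaller degree that vanishes at \<open>c \<noteq> 0\<close>.\<close>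
    assume 0: "coeff \<mu> 0 = 0"
    then obtain q where q: "\<mu> = pCons 0 q" by (metis coeff_pCons_0 pCons_cases)
    hence "q \<noteq> 0" using \<mu>(1) by auto
    moreover have "ipoly_at q c = 0" using \<mu>(2) c(2) q by (simp add: of_int_hom.map_poly_pCons_hom)
    ultimately have "degree \<mu> \<le> degree q" using \<mu>(4) by blast
    thus False using q \<open>q \<noteq> 0\<close> by simp
  qed
  hence "1 \<le> \<bar>coeff \<mu> 0\<bar>" by simp
  hence "1 \<le> \<bar>real_of_int (coeff \<mu> 0)\<bar>" by linarith
  also have "\<dots> = norm (poly m 0)" by (simp add: m_def poly_0_coeff_0)
  also have "\<dots> = (\<Prod>i<degree m. norm (root i))" unfolding pm by (simp add: prod_norm[symmetric])
  \<comment> \<open>The factor of \<open>c\<close> itself is kept exact, so that a sharper bound for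
    it can be inserted later.\<close>
  also have "\<dots> = norm c * (\<Prod>i\<in>{..<degree m} - {i0}. norm (root i))"
    using i0 by (subst prod.remove[of _ i0]) auto
  also have "\<dots> \<le> norm c * (\<Prod>i\<in>{..<degree m} - {i0}. (real p + 2) / real p)"
    by (intro mult_left_mono prod_mono) (use rz conj in \<open>auto simp: m_def\<close>)
  also have "\<dots> = norm c * ((real p + 2) / real p) ^ (degree m - 1)"
    using i0 by simp
  also have "\<dots> \<le> norm c * ((real p + 2) / real p) ^ M"
    using p deg dm by (intro mult_left_mono power_increasing) auto
  finally show ?thesis .
qed

section \<open>Exponents of the product expansion\<close>

text \<open>Convergence is only pointwise. By Baire there is an interval on which almost all factors are
  uniformly close to \<open>1\<close>; there the argument of \<open>exp\<close> varies by at most \<open>1\<close>, which bounds \<open>c n\<close>.\<close>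

lemma infinite_product_exponents_growth:
  fixes c :: "nat \<Rightarrow> complex" and T :: real
  assumes T: "T \<ge> 0"
    and lim: "\<And>y. y > T \<Longrightarrow> (\<lambda>n. exp (c n * of_real (ln (1 - exp (- (real n * y)))))) \<longlonglongrightarrow> 1"
  obtains K R where "R \<ge> 1" "K > 0" "\<And>n. norm (c n) \<le> K * R ^ n"
proof -
  define s where "s n y = ln (1 - exp (- (real n * y)))" for n y
  define X where "X n y = exp (c n * of_real (s n y))" for n y
  define I where "I = {T+1..T+2}"
  \<comment> \<open>\<open>Suc m\<close> excludes \<open>n = 0\<close>, where
    \<open>1 - exp 0 = 0\<close> has no logarithm.\<close>
  define E where "E m = {y\<in>I. \<forall>n\<ge>Suc m. norm (X n y - 1) \<le> 1/4}" for m
  have cs: "continuous_on I (s n)" if "n \<ge> Suc m" for n m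
    unfolding s_def using that T by (intro continuous_intros) (auto simp: I_def)
  have cX: "continuous_on I (X n)" if "n \<ge> Suc m" for n m
    unfolding X_def by (intro continuous_intros cs[OF that])
  have clE: "closed (E m)" for m
  proof -
    have "E m = (\<Inter>n\<in>{Suc m..}. {y\<in>I. norm (X n y - 1) \<le> 1/4})"
      unfolding E_def by auto
    moreover have "closed {y\<in>I. norm (X n y - 1) \<le> 1/4}" if "n \<in> {Suc m..}" for n
      using that cX[of m n]
      by (intro continuous_on_closed_Collect_le continuous_intros) (auto simp: I_def)
    ultimately show ?thesis by auto
  qed
  have UE: "\<exists>m. y \<in> E m" if "y \<in> I" for y
  proof -
    have "(\<lambda>n. X n y) \<longlonglongrightarrow> 1" unfolding X_def s_def using lim[of y] that T by (simp add: I_def)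
    hence "eventually (\<lambda>n. dist (X n y) 1 < 1/4) sequentially" by (rule tendstoD) simp
    then obtain m where "\<And>n. n \<ge> m \<Longrightarrow> dist (X n y) 1 < 1/4" by (auto simp: eventually_sequentially)
    hence "y \<in> E m" using that by (auto simp: E_def dist_norm intro!: less_imp_le)
    thus ?thesis ..
  qed
  \<comment> \<open>If all the open sets \<open>I - E m\<close> were dense in \<open>I\<close>, so
    would be their intersection, which is empty.\<close>
  have "\<exists>m. \<not> I \<subseteq> closure (I - E m)"
  proof (rule ccontr)
    assume *: "\<not> ?thesis"
    have "I \<subseteq> closure (\<Inter>(range (\<lambda>m. I - E m)))"
    proof (rule Baire)
      fix U assume "U \<in> range (\<lambda>m. I - E m)"
      then obtain m where "U = I - E m" by auto
      thus "openin (top_of_set I) U \<and> I \<subseteq> closure U"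
        using * clE[of m] by (metis Diff_eq open_Compl openin_open)
    qed (auto simp: I_def)
    moreover have "(\<Inter>(range (\<lambda>m. I - E m))) = {}" using UE by auto
    ultimately have "I \<subseteq> {}" by (metis closure_empty)
    thus False by (simp add: I_def)
  qed
  then obtain m y0 where m: "y0 \<in> I" "y0 \<notin> closure (I - E m)" by auto
  then obtain e where e: "e > 0" "\<And>y. y \<in> I \<Longrightarrow> dist y y0 < e \<Longrightarrow> y \<in> E m"
    by (auto simp: closure_approachable)
  \<comment> \<open>\<open>y0\<close> may be the right end of \<open>I\<close>; the interval then
    extends to the left.\<close>
  obtain y1 y2 where y12: "y1 < y2" "{y1..y2} \<subseteq> E m" "y1 > 0"
  proof (cases "y0 < T + 2")
    case True
    show ?thesis
      by (rule that[of y0 "min (y0 + e/2) (T+2)"]) (use True e m T in \<open>auto simp: I_def dist_real_def\<close>)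
  next
    case False
    show ?thesis
      by (rule that[of "max (y0 - e/2) (T+1)" y0]) (use False e m T in \<open>auto simp: I_def dist_real_def\<close>)
  qed
  define \<delta> where "\<delta> = 1 - exp (- (y2 - y1))"
  have \<delta>: "\<delta> > 0" using y12 by (simp add: \<delta>_def)
  have bd: "norm (c n) \<le> exp y1 ^ n / \<delta>" if n: "n \<ge> Suc m" for n
  proof -
    have E12: "y \<in> I" "norm (X n y - 1) \<le> 1/4" if "y \<in> {y1..y2}" for y
      using y12(2) that n unfolding E_def by auto
    have slit: "X n y \<notin> \<real>\<^sub>\<le>\<^sub>0" if "y \<in> {y1..y2}" for y
    proof
      assume "X n y \<in> \<real>\<^sub>\<le>\<^sub>0"
      hence "Re (X n y) \<le> 0" by (auto simp: complex_nonpos_Reals_iff)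
      moreover have "\<bar>Re (X n y - 1)\<bar> \<le> 1/4" using E12(2)[OF that] abs_Re_le_cmod order_trans by blast
      ultimately show False by simp
    qed
    have LnX: "norm (Ln (X n y)) \<le> 1/2" if "y \<in> {y1..y2}" for y
      using norm_Ln_le[of "X n y - 1"] E12(2)[OF that] by simp
    \<comment> \<open>\<open>c n * s n y\<close> and the principal logarithm of \<open>X n y\<close>
      differ by a continuously varying multiple of \<open>2 * pi * \<i>\<close>, hence by a
      constant. So the former inherits the small variation of the latter, however large
      \<open>c n\<close> is.\<close>
    define Z where "Z y = c n * of_real (s n y) - Ln (X n y)" for y
    have nz: "X n y \<noteq> 0" for y by (simp add: X_def)
    have "Z y2 = Z y1"
    proof (rule exp_constant_imp_constant[where S = "{y1..y2}" and w = 1])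
      show "continuous_on {y1..y2} Z" unfolding Z_def
        by (intro continuous_intros continuous_on_subset[OF cs[OF n]] continuous_on_subset[OF cX[OF n]])
          (use E12(1) slit in auto)
      show "exp (Z y) = 1" if "y \<in> {y1..y2}" for y
        using nz by (simp add: Z_def exp_diff exp_Ln X_def)
    qed (use y12 in auto)
    hence "c n * of_real (s n y2 - s n y1) = Ln (X n y2) - Ln (X n y1)"
      by (simp add: Z_def algebra_simps)
    hence "norm (c n) * \<bar>s n y2 - s n y1\<bar> = norm (Ln (X n y2) - Ln (X n y1))"
      by (metis norm_mult norm_of_real)
    also have "\<dots> \<le> 1/2 + 1/2"
      by (rule order_trans[OF norm_triangle_ineq4 add_mono]) (use LnX y12 in auto)
    finally have 1: "norm (c n) * \<bar>s n y2 - s n y1\<bar> \<le> 1" by simp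
    have n0: "n > 0" using n by simp
    define A where "A = 1 - exp (- (real n * y2))"
    define B where "B = 1 - exp (- (real n * y1))"
    have B: "B > 0" using n0 y12 by (simp add: B_def)
    have A: "A > 0" "A \<le> 1" using n0 y12 by (simp_all add: A_def)
    have AB: "A - B = exp (- (real n * y1)) * (1 - exp (- (real n * (y2 - y1))))"
      by (simp add: A_def B_def algebra_simps exp_add[symmetric])
    have "1 * (y2 - y1) \<le> real n * (y2 - y1)" using n0 y12 by (intro mult_right_mono) auto
    hence "\<delta> \<le> 1 - exp (- (real n * (y2 - y1)))"
      by (simp add: \<delta>_def)
    hence AB': "exp (- (real n * y1)) * \<delta> \<le> A - B" unfolding AB by simp
    hence AB0: "A - B > 0" using \<delta> by (smt (verit) exp_gt_zero mult_pos_pos)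
    \<comment> \<open>From \<open>y1\<close> to \<open>y2\<close> the real factor \<open>s n\<close>
      grows by at least \<open>exp (- (n * y1)) * \<delta>\<close>, which turns the bounded
      variation into a bound for \<open>c n\<close>.\<close>
    have "ln (B / A) \<le> B / A - 1" using A B by (intro ln_le_minus_one) auto
    hence "ln A - ln B \<ge> (A - B) / A" using A B by (simp add: ln_div field_simps)
    also have "(A - B) / A \<ge> A - B"
      using A AB0 by (simp add: le_divide_eq mult_le_cancel_left1 mult_le_cancel_left2)
    finally have "exp (- (real n * y1)) * \<delta> \<le> s n y2 - s n y1"
      using AB' by (simp add: s_def A_def B_def)
    hence "norm (c n) * (exp (- (real n * y1)) * \<delta>) \<le> 1"
      using 1 by (smt (verit) mult_left_mono norm_ge_zero)
    thus ?thesis using \<delta> by (simp add: exp_of_nat_mult[symmetric] exp_minus divide_simps mult_ac)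
  qed
  define K where "K = 1 / \<delta> + (\<Sum>n\<le>m. norm (c n)) + 1"
  have S0: "(\<Sum>n\<le>m. norm (c n)) \<ge> 0" by (intro sum_nonneg) auto
  have K0: "K > 0" using S0 \<delta> by (simp add: K_def add_nonneg_pos add_pos_nonneg)
  show ?thesis
  proof (rule that[of "exp y1" K])
    show "K > 0" by (rule K0)
    fix n
    have R1: "1 \<le> exp y1 ^ n" using y12 by (intro one_le_power) simp
    show "norm (c n) \<le> K * exp y1 ^ n"
    proof (cases "n \<le> m")
      case True
      hence "norm (c n) \<le> (\<Sum>n\<le>m. norm (c n))" by (intro member_le_sum) auto
      also have "\<dots> \<le> K" using \<delta> by (simp add: K_def)
      also have "\<dots> \<le> K * exp y1 ^ n" using mult_left_mono[OF R1, of K] K0 by simp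
      finally show ?thesis .
    next
      case False
      hence "norm (c n) \<le> (1 / \<delta>) * exp y1 ^ n" using bd[of n] by simp
      also have "\<dots> \<le> K * exp y1 ^ n" using S0 by (intro mult_right_mono) (auto simp: K_def)
      finally show ?thesis .
    qed
  qed (use y12 in simp)
qed

section \<open>The logarithm of the infinite product as a power series\<close>

lemma has_sum_atLeast_1_imp_sums:
  assumes "(g has_sum S) {1..}"
  shows "(\<lambda>n. g (Suc n)) sums S"
proof -
  have "bij_betw Suc UNIV {1..}"
    by (rule bij_betwI[where g = "\<lambda>n. n - 1"]) auto
  from has_sum_reindex_bij_betw[OF this, of g S] show ?thesis
    using assms has_sum_imp_sums by blast
qed

text \<open>The coefficient of \<open>q ^ k\<close> in the sum of
  \<open>c n * Ln (1 - q ^ n)\<close> over \<open>n \<ge> 1\<close>, obtained by expanding each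
  logarithm.\<close>

definition log_coeff :: "(nat \<Rightarrow> complex) \<Rightarrow> nat \<Rightarrow> complex" where
  "log_coeff c k = - (\<Sum>n | n dvd k. of_nat n * c n) / of_nat k"

text \<open>The double series with terms \<open>- c n * q ^ (n * m) / m\<close> is dominated by
  \<open>2 * K * (1/2) ^ n * (1/2) ^ m\<close>. It may therefore be summed over \<open>m\<close>
  first, which gives the logarithms, or along \<open>n * m = k\<close>, which gives the power
  series.\<close>

lemma sum_Ln_power_series:
  fixes c :: "nat \<Rightarrow> complex"
  assumes R: "R \<ge> 1" and K: "K > 0" and c: "\<And>n. norm (c n) \<le> K * R ^ n"
    and q: "norm q * R \<le> 1/2"
  obtains S where "(\<lambda>n. c (Suc n) * Ln (1 - q ^ Suc n)) sums S"
    "(\<lambda>k. log_coeff c (Suc k) * q ^ Suc k) sums S"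
proof -
  have q1: "norm q \<le> 1/2" using q R mult_left_mono[of 1 R "norm q"] by simp
  define u where "u = (\<lambda>(n,m). - (c n * q ^ (n * m) / of_nat m))"
  define A where "A = {1::nat..} \<times> {1::nat..}"
  have bound: "norm (u (n,m)) \<le> 2 * K * (1/2) ^ n * (1/2) ^ m" if nm: "n \<ge> 1" "m \<ge> 1" for n m
  proof -
    obtain m' where m': "m = Suc m'" using nm(2) by (cases m) auto
    have "norm (u (n,m)) = norm (c n) * norm q ^ (n * m) / real m"
      by (simp add: u_def norm_mult norm_divide norm_power)
    also have "\<dots> \<le> norm (c n) * norm q ^ (n * m) / 1"
      using nm by (intro divide_left_mono) auto
    also have "\<dots> = norm (c n) * norm q ^ (n * m)" by simp
    also have "\<dots> \<le> (K * R ^ n) * norm q ^ (n * m)" by (intro mult_right_mono c) simp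
    also have "\<dots> = K * (norm q * R) ^ n * (norm q ^ n) ^ m'"
      by (simp add: m' power_add power_mult_distrib power_mult[symmetric])
    also have "\<dots> \<le> K * (1/2) ^ n * (1/2) ^ m'"
    proof (intro mult_mono power_mono)
      have "norm q ^ n \<le> norm q ^ 1" using that q1 by (intro power_decreasing) auto
      thus "norm q ^ n \<le> 1/2" using q1 by simp
    qed (use K q R in auto)
    also have "\<dots> = 2 * K * (1/2) ^ n * (1/2) ^ m" by (simp add: m')
    finally show ?thesis .
  qed
  have geo: "((\<lambda>n. (1/2::real) ^ n) has_sum 1) {1..}"
  proof -
    have "((\<lambda>n. (1/2::real) ^ Suc n) has_sum 1) UNIV"
      by (rule norm_summable_imp_has_sum)
        (use power_half_series in \<open>auto simp: power_divide intro!: sums_summable\<close>)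
    moreover have "bij_betw Suc UNIV {1..}"
      by (rule bij_betwI[where g = "\<lambda>n. n - 1"]) auto
    ultimately show ?thesis using has_sum_reindex_bij_betw[of Suc UNIV "{1..}" "\<lambda>n. (1/2::real) ^ n"] by simp
  qed
  have "(\<lambda>(n,m). 2 * K * (1/2) ^ n * (1/2) ^ m) summable_on A"
    unfolding A_def
  proof (rule summable_on_SigmaI)
    show "((\<lambda>m. case (n, m) of (n, m) \<Rightarrow> 2 * K * (1/2) ^ n * (1/2) ^ m) has_sum 2 * K * (1/2) ^ n * 1) {1..}"
      for n :: nat using has_sum_cmult_right[OF geo, of "2 * K * (1/2) ^ n"] by simp
    show "(\<lambda>n. 2 * K * (1/2) ^ n * 1) summable_on {1::nat..}"
      using has_sum_cmult_right[OF geo, of "2 * K"] by (auto simp: summable_on_def)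
  qed (use K in auto)
  hence "(\<lambda>x. norm (u x)) summable_on A"
    by (rule Infinite_Sum.abs_summable_on_comparison_test') (use bound in \<open>auto simp: A_def\<close>)
  then obtain S where S: "(u has_sum S) A"
    using Infinite_Sum.abs_summable_summable unfolding summable_on_def by blast
  have 1: "((\<lambda>n. c n * Ln (1 - q ^ n)) has_sum S) {1..}"
  proof (rule has_sum_SigmaD[OF S[unfolded A_def]])
    fix n :: nat assume n: "n \<in> {1..}"
    have "norm q ^ n \<le> norm q ^ 1" using n q1 by (intro power_decreasing) auto
    hence w: "norm (q ^ n) \<le> 1/2" using q1 by (simp add: norm_power)
    have "(\<lambda>m. - ((q ^ n) ^ m) / of_nat m) sums Ln (1 - q ^ n)"
      using Ln_series'[of "- (q ^ n)"] w by simp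
    hence *: "(\<lambda>m. c n * (- ((q ^ n) ^ m) / of_nat m)) sums (c n * Ln (1 - q ^ n))"
      by (rule sums_mult)
    have "summable (\<lambda>m. norm (c n * (- ((q ^ n) ^ m) / of_nat m)))"
    proof (rule summable_comparison_test')
      show "summable (\<lambda>m. norm (c n) * (1/2) ^ m)" by (intro summable_mult summable_geometric) simp
      fix m :: nat assume "m \<ge> 1"
      have "norm (c n * (- ((q ^ n) ^ m) / of_nat m)) = norm (c n) * (norm (q ^ n) ^ m / real m)"
        by (simp add: norm_mult norm_divide norm_power)
      also have "norm (q ^ n) ^ m / real m \<le> norm (q ^ n) ^ m / 1"
        using \<open>m \<ge> 1\<close> by (intro divide_left_mono) auto
      also have "\<dots> = norm (q ^ n) ^ m" by simp
      also have "\<dots> \<le> (1/2) ^ m" using w by (intro power_mono) auto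
      finally show "norm (norm (c n * (- ((q ^ n) ^ m) / of_nat m))) \<le> norm (c n) * (1/2) ^ m"
        by (simp add: mult_left_mono)
    qed
    from norm_summable_imp_has_sum[OF this *]
    have "((\<lambda>m. c n * (- ((q ^ n) ^ m) / of_nat m)) has_sum (c n * Ln (1 - q ^ n))) {1..}"
      by (subst (asm) has_sum_cong_neutral[where T = "{1..}"
           and g = "\<lambda>m. c n * (- ((q ^ n) ^ m) / of_nat m)"]) auto
    thus "((\<lambda>m. u (n, m)) has_sum (c n * Ln (1 - q ^ n))) {1..}"
      by (simp add: u_def power_mult)
  qed
  have 2: "((\<lambda>k. log_coeff c k * q ^ k) has_sum S) {1..}"
  proof -
    define D where "D = Sigma {1::nat..} (\<lambda>k. {n. n dvd k})"
    have bij: "bij_betw (\<lambda>(k,n). (n, k div n)) D A"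
      by (rule bij_betwI[where g = "\<lambda>(n,m). (n * m, n)"])
        (auto simp: D_def A_def dvd_div_eq_0_iff Suc_le_eq intro!: Nat.gr0I)
    have "((\<lambda>x. u (case x of (k,n) \<Rightarrow> (n, k div n))) has_sum S) D"
      using S has_sum_reindex_bij_betw[OF bij] by blast
    from this[unfolded D_def] show ?thesis
    proof (rule has_sum_SigmaD)
      fix k :: nat assume k: "k \<in> {1..}"
      show "((\<lambda>n. u (case (k, n) of (k, n) \<Rightarrow> (n, k div n))) has_sum log_coeff c k * q ^ k) {n. n dvd k}"
      proof (rule has_sum_finiteI)
        show "finite {n. n dvd k}" using k by (intro finite_divisors_nat) auto
        have "u (n, k div n) = - (of_nat n * c n / of_nat k) * q ^ k" if "n dvd k" for n
          using that k by (auto simp: u_def elim!: dvdE)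
        thus "log_coeff c k * q ^ k = (\<Sum>n | n dvd k. u (case (k, n) of (k, n) \<Rightarrow> (n, k div n)))"
          by (simp add: log_coeff_def sum_distrib_right sum_negf sum_divide_distrib)
      qed
    qed
  qed
  show ?thesis
    using that has_sum_atLeast_1_imp_sums[OF 1] has_sum_atLeast_1_imp_sums[OF 2] by blast
qed

lemma norm_qvar: "norm (qvar z) = exp (- 2 * pi * Im z)"
  by (simp add: qvar_def norm_exp_eq_Re)

lemma qvar_surj:
  assumes "q \<noteq> 0"
  obtains z where "qvar z = q" "Im z = - ln (norm q) / (2 * pi)"
proof
  show "qvar (Ln q / (2 * of_real pi * \<i>)) = q"
    using assms by (simp add: qvar_def)
  show "Im (Ln q / (2 * of_real pi * \<i>)) = - ln (norm q) / (2 * pi)"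
    using assms by (simp add: Im_divide power2_eq_square)
qed

text \<open>Here \<open>f = D * exp (\<Sum>n. b n / n * q ^ n)\<close> on the upper half plane, so both expansions of
  \<open>log f\<close> near \<open>q = 0\<close> can be compared coefficientwise once \<open>h = 0\<close> is known.\<close>

lemma q_exponents_imp_fourier_coeffs:
  fixes f :: "complex \<Rightarrow> complex"
  assumes holo: "f holomorphic_on uhp" and nz: "\<And>z. z \<in> uhp \<Longrightarrow> f z \<noteq> 0"
    and fourier: "fourier_coeffs (\<lambda>z. deriv f z / (2 * of_real pi * \<i> * f z)) b" and b0: "b 0 = 0"
    and exps: "q_exponents f c" and k: "k \<ge> 1"
  shows "b k = - (\<Sum>n | n dvd k. of_nat n * c n)"
proof -
  obtain C and h :: int and T where C: "C \<noteq> 0"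
    and prod: "\<And>z. Im z > T \<Longrightarrow> \<exists>P. (\<lambda>n. (1 - qvar z ^ (n+1)) powr c (n+1)) has_prod P \<and>
                              f z = C * qvar z powi h * P"
    using exps unfolding q_exponents_def by metis
  define T0 where "T0 = max T 0"
  have term_eq: "(1 - qvar z ^ (n+1)) powr c (n+1) = exp (c (n+1) * Ln (1 - qvar z ^ (n+1)))"
    if "z \<in> uhp" for z n
  proof -
    have "norm (qvar z ^ (n+1)) < 1"
      using that by (simp only: norm_power, intro power_less_one_iff[THEN iffD2])
        (auto simp: norm_qvar uhp_def)
    hence "1 - qvar z ^ (n+1) \<noteq> 0" by auto
    thus ?thesis by (simp add: powr_def)
  qed
  obtain K R where R: "R \<ge> 1" and K: "K > 0" and cKR: "\<And>n. norm (c n) \<le> K * R ^ n"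
  proof (rule infinite_product_exponents_growth[of "2 * pi * T0" c])
    fix y :: real assume y: "y > 2 * pi * T0"
    \<comment> \<open>On the imaginary axis \<open>q = exp (- y)\<close> is real, so the principal
      logarithm of each factor base is a real logarithm. The factors of a convergent product tend to
      \<open>1\<close>.\<close>
    define z where "z = \<i> * of_real (y / (2 * pi))"
    have T0z: "Im z > T0" using y by (simp add: z_def field_simps)
    hence z: "z \<in> uhp" "Im z > T" by (auto simp: uhp_def T0_def)
    have qz: "qvar z = of_real (exp (- y))"
      by (simp add: qvar_def z_def exp_of_real[symmetric])
    have y0: "y > 0" using z by (simp add: uhp_def z_def zero_less_divide_iff)
    obtain P where "(\<lambda>n. (1 - qvar z ^ (n+1)) powr c (n+1)) has_prod P"
      using prod[OF z(2)] by blast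
    hence "(\<lambda>n. (1 - qvar z ^ (n+1)) powr c (n+1)) \<longlonglongrightarrow> 1"
      by (intro convergent_prod_imp_LIMSEQ) (simp add: has_prod_iff)
    moreover have "(1 - qvar z ^ (n+1)) powr c (n+1) =
      exp (c (Suc n) * of_real (ln (1 - exp (- (real (Suc n) * y)))))" for n
    proof -
      have "1 - qvar z ^ (n+1) = of_real (1 - exp (- (real (Suc n) * y)))"
        by (simp only: qz of_real_power[symmetric] exp_of_nat_mult[symmetric]) simp
      moreover have "1 - exp (- (real (Suc n) * y)) > 0" using y0 by simp
      ultimately have "Ln (1 - qvar z ^ (n+1)) = of_real (ln (1 - exp (- (real (Suc n) * y))))"
        by (metis Ln_of_real)
      thus ?thesis using term_eq[OF z(1), of n] by simp
    qed
    ultimately have "(\<lambda>n. exp (c (Suc n) * of_real (ln (1 - exp (- (real (Suc n) * y)))))) \<longlonglongrightarrow> 1"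
      by simp
    thus "(\<lambda>n. exp (c n * of_real (ln (1 - exp (- (real n * y)))))) \<longlonglongrightarrow> 1"
      by (rule LIMSEQ_imp_Suc)
  qed (use pi_gt_zero in \<open>auto simp: T0_def\<close>)
  \<comment> \<open>The first bound makes the double series converge absolutely; the second places
    \<open>q\<close> in the region where the product formula holds.\<close>
  define r where "r = min (1 / (2 * R)) (exp (- 2 * pi * T0))"
  have r: "r > 0" "r < 1" using R by (auto simp: r_def min_less_iff_disj field_simps)
  define \<beta> where "\<beta> n = b n / of_nat n" for n
  define W where "W q = (\<Sum>n. \<beta> n * q ^ n)" for q
  have sumb: "summable (\<lambda>n. b n * q ^ n)" if "norm q < 1" for q
  proof (cases "q = 0")
    case False
    obtain z where z: "qvar z = q" "Im z = - ln (norm q) / (2 * pi)" using qvar_surj[OF False] by metis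
    have "ln (norm q) < 0" using that False by simp
    hence "Im z > 0" unfolding z(2) by (intro divide_pos_pos) auto
    hence "z \<in> uhp" by (simp add: uhp_def)
    hence "summable (\<lambda>n. b n * qvar z ^ n)" using fourier unfolding fourier_coeffs_def sums_iff by blast
    thus ?thesis by (simp only: z(1))
  qed simp
  have sumbeta: "summable (\<lambda>n. \<beta> n * q ^ n)" if q: "norm q < 1" for q
  proof -
    define x where "x = complex_of_real ((1 + norm q) / 2)"
    have nx: "norm x = (1 + norm q) / 2" unfolding x_def norm_of_real by (smt (verit) norm_ge_zero divide_nonneg_pos)
    have "summable (\<lambda>n. norm (b n * q ^ n))"
      by (rule powser_insidea[OF sumb[of x]]) (use q nx in auto)
    thus ?thesis
    proof (rule summable_comparison_test'[where N = 1])
      fix n :: nat assume "n \<ge> 1"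
      hence "norm (\<beta> n) \<le> norm (b n) / 1"
        unfolding \<beta>_def norm_divide by (intro divide_left_mono) auto
      thus "norm (\<beta> n * q ^ n) \<le> norm (b n * q ^ n)"
        by (simp add: norm_mult mult_right_mono)
    qed
  qed
  have derW: "((\<lambda>z. W (qvar z)) has_field_derivative deriv f z / f z) (at z)" if z: "z \<in> uhp" for z
  proof -
    have q: "norm (qvar z) < 1" using z by (simp add: norm_qvar uhp_def)
    have "(W has_field_derivative (\<Sum>n. diffs \<beta> n * qvar z ^ n)) (at (qvar z))"
      unfolding W_def by (rule termdiffs_strong'[where K = 1]) (use sumbeta q in auto)
    moreover have "(qvar has_field_derivative qvar z * (2 * of_real pi * \<i>)) (at z)"
      unfolding qvar_def[abs_def] by (auto intro!: derivative_eq_intros)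
    ultimately have D: "((\<lambda>z. W (qvar z)) has_field_derivative
        (\<Sum>n. diffs \<beta> n * qvar z ^ n) * (qvar z * (2 * of_real pi * \<i>))) (at z)"
      by (rule DERIV_chain2)
    have "(\<lambda>n. b n * qvar z ^ n) sums (deriv f z / (2 * of_real pi * \<i> * f z))"
      using fourier z unfolding fourier_coeffs_def by blast
    \<comment> \<open>\<open>b 0 = 0\<close> permits division by \<open>q\<close>; the factor
      \<open>2 * pi * \<i>\<close> in \<open>g\<close> is the one that differentiating
      \<open>qvar\<close> produces.\<close>
    hence "(\<lambda>n. b (Suc n) * qvar z ^ Suc n) sums (deriv f z / (2 * of_real pi * \<i> * f z))"
      using sums_Suc_iff[of "\<lambda>n. b n * qvar z ^ n"] b0 by simp
    hence "(\<lambda>n. (b (Suc n) * qvar z ^ Suc n) / qvar z) sums (deriv f z / (2 * of_real pi * \<i> * f z) / qvar z)"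
      by (rule sums_divide)
    moreover have "(b (Suc n) * qvar z ^ Suc n) / qvar z = diffs \<beta> n * qvar z ^ n" for n
      by (simp add: diffs_def \<beta>_def qvar_def del: of_nat_Suc)
    ultimately have "(\<Sum>n. diffs \<beta> n * qvar z ^ n) = deriv f z / (2 * of_real pi * \<i> * f z) / qvar z"
      by (simp add: sums_iff)
    hence "(\<Sum>n. diffs \<beta> n * qvar z ^ n) * (qvar z * (2 * of_real pi * \<i>)) = deriv f z / f z"
      using nz[OF z] by (simp add: qvar_def)
    thus ?thesis using D by simp
  qed
  have "\<exists>D. \<forall>z\<in>uhp. f z * exp (- W (qvar z)) = D"
  proof (rule has_field_derivative_zero_constant[OF convex_uhp])
    fix z assume z: "z \<in> uhp"
    have "(f has_field_derivative deriv f z) (at z)"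
      using holo z open_uhp by (simp add: holomorphic_derivI)
    hence "((\<lambda>z. f z * exp (- W (qvar z))) has_field_derivative 0) (at z)"
      using nz[OF z] by (auto intro!: derivative_eq_intros derW[OF z])
    thus "((\<lambda>z. f z * exp (- W (qvar z))) has_field_derivative 0) (at z within uhp)"
      by (rule has_field_derivative_at_within)
  qed
  then obtain D where D: "\<And>z. z \<in> uhp \<Longrightarrow> f z * exp (- W (qvar z)) = D" by blast
  have fD: "f z = D * exp (W (qvar z))" if "z \<in> uhp" for z
    using D[OF that, symmetric] by (simp add: exp_minus)
  have D0: "D \<noteq> 0" using fD[of \<i>] nz[of \<i>] by (auto simp: uhp_def)
  \<comment> \<open>\<open>U\<close> is the difference of the two candidates for
    \<open>log f\<close> up to constants; the aim is \<open>U = 0\<close> near \<open>0\<close>,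
    hence \<open>a = 0\<close>.\<close>
  define a where "a n = (if n = 0 then 0 else \<beta> n - log_coeff c n)" for n
  define U where "U q = (\<Sum>n. a n * q ^ n)" for q
  have small: "norm q * R \<le> 1/2" if "norm q < r" for q
    using that R by (simp add: r_def field_simps)
  have asums: "(\<lambda>n. a n * q ^ n) sums U q" and
    expU: "q \<noteq> 0 \<Longrightarrow> exp (U q) = C / D * q powi h" if q: "norm q < r" for q
  proof -
    obtain S where S: "(\<lambda>n. c (Suc n) * Ln (1 - q ^ Suc n)) sums S"
      "(\<lambda>k. log_coeff c (Suc k) * q ^ Suc k) sums S"
      using sum_Ln_power_series[OF R K cKR small[OF q]] by metis
    have "(\<lambda>n. \<beta> n * q ^ n) sums W q"
      unfolding W_def using sumbeta[of q] q r by (simp add: summable_sums)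
    hence "(\<lambda>n. \<beta> (Suc n) * q ^ Suc n) sums W q"
      using sums_Suc_iff[of "\<lambda>n. \<beta> n * q ^ n"] by (simp add: \<beta>_def)
    from sums_diff[OF this S(2)] have "(\<lambda>n. a (Suc n) * q ^ Suc n) sums (W q - S)"
      by (simp add: a_def algebra_simps)
    hence as: "(\<lambda>n. a n * q ^ n) sums (W q - S)"
      using sums_Suc_iff[of "\<lambda>n. a n * q ^ n"] by (simp add: a_def)
    hence US: "U q = W q - S" by (simp add: U_def sums_iff)
    show "(\<lambda>n. a n * q ^ n) sums U q" using as US by simp
    assume q0: "q \<noteq> 0"
    obtain z where z: "qvar z = q" "Im z = - ln (norm q) / (2 * pi)" using qvar_surj[OF q0] by metis
    have "norm q < exp (- 2 * pi * T0)" using q by (simp add: r_def)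
    hence "ln (norm q) < - 2 * pi * T0" using q0 by (metis exp_less_cancel_iff exp_ln zero_less_norm_iff)
    hence "T0 * (2 * pi) < - ln (norm q)" by (simp add: mult_ac)
    hence "Im z > T0" unfolding z(2) by (subst pos_less_divide_eq) auto
    hence zz: "z \<in> uhp" "Im z > T" by (auto simp: uhp_def T0_def)
    obtain P where P: "(\<lambda>n. (1 - qvar z ^ (n+1)) powr c (n+1)) has_prod P" "f z = C * qvar z powi h * P"
      using prod[OF zz(2)] by blast
    have "(\<lambda>N. \<Prod>n<N. (1 - qvar z ^ (n+1)) powr c (n+1)) \<longlonglongrightarrow> P"
      by (rule has_prod_imp_tendsto'[OF P(1)])
    moreover have "(\<Prod>n<N. (1 - qvar z ^ (n+1)) powr c (n+1)) =
        exp (\<Sum>n<N. c (Suc n) * Ln (1 - q ^ Suc n))" for N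
    proof -
      have "(1 - q ^ (n+1)) powr c (n+1) = exp (c (Suc n) * Ln (1 - q ^ Suc n))" for n
        using term_eq[OF zz(1), of n] z(1) by simp
      thus ?thesis by (simp only: z(1) exp_sum finite_lessThan)
    qed
    ultimately have "(\<lambda>N. exp (\<Sum>n<N. c (Suc n) * Ln (1 - q ^ Suc n))) \<longlonglongrightarrow> P" by simp
    moreover have "(\<lambda>N. exp (\<Sum>n<N. c (Suc n) * Ln (1 - q ^ Suc n))) \<longlonglongrightarrow> exp S"
      using S(1) unfolding sums_def by (rule tendsto_exp)
    ultimately have "P = exp S" by (rule LIMSEQ_unique)
    hence "D * exp (W q) = C * q powi h * exp S" using P(2) fD[OF zz(1)] z(1) by simp
    thus "exp (U q) = C / D * q powi h" using D0 by (simp add: US exp_diff field_simps)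
  qed
  have U0: "U 0 = 0" by (simp add: U_def a_def)
  have contU: "isCont U q" if "norm q < r" for q
  proof -
    define x where "x = complex_of_real ((r + norm q) / 2)"
    have nx: "norm x = (r + norm q) / 2" unfolding x_def norm_of_real using r by (smt (verit) norm_ge_zero divide_nonneg_pos)
    show ?thesis unfolding U_def
      by (rule isCont_powser[of a x]) (use asums[of x] nx that in \<open>auto simp: sums_iff\<close>)
  qed
  have h0: "h = 0"
  proof -
    \<comment> \<open>Replacing \<open>q\<close> by \<open>q / 2\<close> isolates
      \<open>2 powi h\<close>, while the left side tends to \<open>1\<close> as \<open>q\<close>
      tends to \<open>0\<close>.\<close>
    have half: "exp (U q - U (q/2)) = 2 powi h" if "norm q < r" "q \<noteq> 0" for q
    proof -
      have "norm (q / 2) < r" using that(1) r(1) by (simp add: norm_divide)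
      from expU[OF this] have "exp (U (q/2)) = C / D * q powi h / 2 powi h"
        using that by (simp add: power_int_divide_distrib)
      thus ?thesis using expU[of q] that C D0 by (simp add: exp_diff)
    qed
    have cont0: "isCont U 0" by (rule contU) (use r in simp)
    have "isCont (\<lambda>q. U (q/2)) 0"
      by (rule isCont_o2[where f = "\<lambda>q. q/2" and g = U]) (use cont0 in auto)
    hence "((\<lambda>q. exp (U q - U (q/2))) \<longlongrightarrow> exp (U 0 - U (0/2))) (at 0)"
      using cont0 unfolding isCont_def by (intro tendsto_exp tendsto_diff)
    moreover have "eventually (\<lambda>q. exp (U q - U (q/2)) = 2 powi h) (at 0)"
      unfolding eventually_at by (intro exI[of _ r]) (use r half in \<open>auto simp: dist_norm\<close>)
    ultimately have "((\<lambda>q::complex. 2 powi h) \<longlongrightarrow> exp (U 0 - U (0/2))) (at 0)"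
      by (rule Lim_transform_eventually)
    hence "(2::complex) powi h = 1" using U0 by (simp add: tendsto_const_iff)
    hence "norm ((2::complex) powi h) = 1" by simp
    hence "(2::real) powi h = 1" by (simp add: norm_power_int)
    hence "(2::real) powr real_of_int h = 1" by (simp add: powr_real_of_int')
    thus ?thesis by (simp add: powr_eq_one_iff)
  qed
  have Uz: "U q = 0" if q: "norm q < r" for q
  proof -
    have "U q = U 0"
    proof (rule exp_constant_imp_constant[where Z = U and S = "ball 0 r" and w = 1])
      show "continuous_on (ball 0 r) U"
        by (intro continuous_at_imp_continuous_on) (use contU in auto)
      \<comment> \<open>Continuity at \<open>0\<close>, where \<open>U\<close> vanishes, forces
        \<open>C / D = 1\<close>; then \<open>U\<close> takes values in a discrete set on the whole
        disc.\<close>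
      have CD: "exp (U x) = C / D" if "norm x < r" "x \<noteq> 0" for x using expU[OF that] h0 by simp
      have "((\<lambda>q. exp (U q)) \<longlongrightarrow> exp (U 0)) (at 0)"
        by (intro tendsto_exp isContD contU) (use r in simp)
      moreover have "eventually (\<lambda>q. exp (U q) = C / D) (at 0)"
        unfolding eventually_at by (intro exI[of _ r]) (use r CD in \<open>auto simp: dist_norm\<close>)
      ultimately have "((\<lambda>q::complex. C / D) \<longlongrightarrow> exp (U 0)) (at 0)"
        by (rule Lim_transform_eventually)
      hence "C / D = 1" using U0 by (simp add: tendsto_const_iff)
      thus "exp (U x) = 1" if "x \<in> ball 0 r" for x
        using CD[of x] U0 that by (cases "x = 0") auto
    qed (use q r in auto)
    thus ?thesis using U0 by simp
  qed
  have "a k = 0"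
  proof (rule ccontr)
    assume "a k \<noteq> 0"
    obtain s where s: "s > 0" "\<And>z. z \<in> cball 0 s - {0} \<Longrightarrow> U z \<noteq> 0"
      by (rule powser_0_nonzero[of r 0 a U k]) (use asums U0 r \<open>a k \<noteq> 0\<close> k in auto)
    define x where "x = complex_of_real (min s (r/2))"
    have "norm x = min s (r/2)" using s r by (simp add: x_def)
    moreover from this have "x \<noteq> 0" using s(1) r by force
    moreover have "min s (r/2) < r" using r by simp
    ultimately show False using s(2)[of x] Uz[of x] by simp
  qed
  hence "b k / of_nat k = log_coeff c k" using k by (simp add: a_def \<beta>_def)
  thus ?thesis using k by (simp add: log_coeff_def field_simps)
qed

section \<open>The modular group\<close>

lemma Gamma0_subset_SL2Z: "\<gamma> \<in> Gamma0 N \<Longrightarrow> \<gamma> \<in> SL2Z"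
  by (auto simp: Gamma0_def SL2Z_def)

lemma in_uhp_iff: "z \<in> uhp \<longleftrightarrow> Im z > 0"
  by (simp add: uhp_def)

lemma i_in_uhp: "\<i> \<in> uhp"
  by (simp add: uhp_def)

lemma jfac_nonzero:
  assumes "\<sigma> \<in> SL2Z" "z \<in> uhp"
  shows "jfac \<sigma> z \<noteq> 0"
proof -
  obtain a b c d where s: "\<sigma> = (a,b,c,d)" by (cases \<sigma>)
  show ?thesis
  proof
    assume "jfac \<sigma> z = 0"
    hence 0: "of_int c * z + of_int d = 0" by (simp add: s)
    have "Im (of_int c * z + of_int d) = 0" by (simp only: 0 zero_complex.sel)
    hence "of_int c * Im z = 0" by simp
    hence "c = 0" using assms(2) by (simp add: in_uhp_iff)
    hence "d = 0" using 0 by simp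
    thus False using \<open>c = 0\<close> assms(1) by (simp add: s SL2Z_def)
  qed
qed

lemma Im_mob:
  assumes "\<sigma> \<in> SL2Z"
  shows "Im (mob \<sigma> z) = Im z / norm (jfac \<sigma> z) ^ 2"
proof -
  obtain a b c d where s: "\<sigma> = (a,b,c,d)" by (cases \<sigma>)
  have det: "real_of_int a * real_of_int d - real_of_int b * real_of_int c = 1"
    using assms unfolding s SL2Z_def by (simp flip: of_int_mult of_int_diff)
  have "Im (mob \<sigma> z) = ((of_int a * of_int d - of_int b * of_int c) * Im z) / norm (jfac \<sigma> z) ^ 2"
    unfolding s cmod_power2 by (simp add: Im_divide algebra_simps)
  thus ?thesis using det by simp
qed

lemma mob_in_uhp: "\<sigma> \<in> SL2Z \<Longrightarrow> z \<in> uhp \<Longrightarrow> mob \<sigma> z \<in> uhp"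
  using Im_mob jfac_nonzero by (simp add: in_uhp_iff)

lemma mob_mmul:
  assumes "\<sigma> \<in> SL2Z" "\<tau> \<in> SL2Z" "z \<in> uhp"
  shows "mob (mmul \<sigma> \<tau>) z = mob \<sigma> (mob \<tau> z)"
proof -
  obtain a b c d where s: "\<sigma> = (a,b,c,d)" by (cases \<sigma>)
  obtain a' b' c' d' where t: "\<tau> = (a',b',c',d')" by (cases \<tau>)
  have j: "of_int c' * z + of_int d' \<noteq> 0" using jfac_nonzero[OF assms(2,3)] by (simp add: t)
  define w where "w = of_int c' * z + of_int d'"
  have w: "w \<noteq> 0" using j by (simp add: w_def)
  have cancel: "(A * (X / w) + B) * w = A * X + B * w" for A B X :: complex
    using w by (simp add: distrib_right)
  define X where "X = of_int a' * z + (of_int b' :: complex)"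
  have "mob \<sigma> (mob \<tau> z) = (of_int a * (X / w) + of_int b) / (of_int c * (X / w) + of_int d)"
    by (simp add: s t w_def X_def)
  also have "\<dots> = ((of_int a * (X / w) + of_int b) * w) / ((of_int c * (X / w) + of_int d) * w)"
    using w by simp
  also have "\<dots> = (of_int a * X + of_int b * w) / (of_int c * X + of_int d * w)"
    by (simp only: cancel)
  finally show ?thesis by (simp add: s t w_def X_def algebra_simps)
qed

lemma mmul_SL2Z: 
  assumes "\<sigma> \<in> SL2Z" "\<tau> \<in> SL2Z"
  shows "mmul \<sigma> \<tau> \<in> SL2Z"
proof -
  obtain a b c d where s: "\<sigma> = (a,b,c,d)" by (cases \<sigma>)
  obtain a' b' c' d' where t: "\<tau> = (a',b',c',d')" by (cases \<tau>)
  have "(a * a' + b * c') * (c * b' + d * d') - (a * b' + b * d') * (c * a' + d * c')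
      = (a * d - b * c) * (a' * d' - b' * c')" by (simp add: algebra_simps)
  thus ?thesis using assms by (simp add: s t SL2Z_def)
qed

fun minv :: "mat2 \<Rightarrow> mat2" where
  "minv (a,b,c,d) = (d,-b,-c,a)"

lemma minv_SL2Z: "\<sigma> \<in> SL2Z \<Longrightarrow> minv \<sigma> \<in> SL2Z"
  by (cases \<sigma>) (auto simp: SL2Z_def mult.commute)

lemma mob_minv:
  assumes "\<sigma> \<in> SL2Z" "z \<in> uhp"
  shows "mob (minv \<sigma>) (mob \<sigma> z) = z" "mob \<sigma> (mob (minv \<sigma>) z) = z"
proof -
  have "mob (1,0,0,1) z = z" by simp
  moreover have "mmul (minv \<sigma>) \<sigma> = (1,0,0,1)" "mmul \<sigma> (minv \<sigma>) = (1,0,0,1)"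
    using assms(1) by (cases \<sigma>; force simp: SL2Z_def algebra_simps)+
  ultimately show "mob (minv \<sigma>) (mob \<sigma> z) = z" "mob \<sigma> (mob (minv \<sigma>) z) = z"
    using mob_mmul minv_SL2Z assms by metis+
qed

lemma has_field_derivative_mob:
  assumes "\<sigma> \<in> SL2Z" "z \<in> uhp"
  shows "(mob \<sigma> has_field_derivative 1 / jfac \<sigma> z ^ 2) (at z)"
proof -
  obtain a b c d where s: "\<sigma> = (a,b,c,d)" by (cases \<sigma>)
  have j: "of_int c * z + of_int d \<noteq> 0" using jfac_nonzero[OF assms] by (simp add: s)
  have "complex_of_int a * of_int d - of_int b * of_int c = 1"
    using assms unfolding s SL2Z_def by (simp flip: of_int_mult of_int_diff)
  hence num: "of_int a * (of_int c * z + of_int d) - (of_int a * z + of_int b) * of_int c = 1"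
    by (simp add: algebra_simps)
  have "((\<lambda>z. (of_int a * z + of_int b) / (of_int c * z + of_int d)) has_field_derivative
     (of_int a * (of_int c * z + of_int d) - (of_int a * z + of_int b) * of_int c) /
       ((of_int c * z + of_int d) * (of_int c * z + of_int d))) (at z)"
    using j by (auto intro!: derivative_eq_intros)
  hence "((\<lambda>z. (of_int a * z + of_int b) / (of_int c * z + of_int d)) has_field_derivative
     1 / (of_int c * z + of_int d) ^ 2) (at z)"
    unfolding num power2_eq_square .
  moreover have "mob \<sigma> = (\<lambda>z. (of_int a * z + of_int b) / (of_int c * z + of_int d))"
    by (auto simp: s)
  ultimately show ?thesis by (simp add: s)
qed

lemma mob_holomorphic: "\<sigma> \<in> SL2Z \<Longrightarrow> mob \<sigma> holomorphic_on uhp"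
  by (meson has_field_derivative_mob holomorphic_onI field_differentiable_def
      field_differentiable_at_within)

lemma eventually_at_i_infty:
  "eventually P at_i_infty \<longleftrightarrow> (\<exists>Y. \<forall>z. Im z > Y \<longrightarrow> P z)"
  by (simp add: at_i_infty_def eventually_filtercomap_at_top_dense)

lemma at_i_infty_neq_bot: "at_i_infty \<noteq> bot"
proof
  assume "at_i_infty = bot"
  hence "eventually (\<lambda>z. False) at_i_infty" by simp
  then obtain Y where "\<And>z. \<not> Im z > Y" by (auto simp: eventually_at_i_infty)
  from this[of "\<i> * of_real (Y + 1)"] show False by simp
qed

text \<open>Bottom rows modulo \<open>N\<close>, without identifying unit multiples: the classes are
  the cosets of the subgroup of \<open>Gamma0 N\<close> with lower right entry congruent to
  \<open>1\<close>. A coset of \<open>Gamma0 N\<close> may thus be listed several times, which costs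
  nothing as only finiteness matters.\<close>

fun bottom_row_mod :: "nat \<Rightarrow> mat2 \<Rightarrow> int \<times> int" where
  "bottom_row_mod N (a,b,c,d) = (c mod int N, d mod int N)"

lemma same_bottom_row_imp_same_coset:
  assumes "\<sigma> \<in> SL2Z" "\<tau> \<in> SL2Z" "bottom_row_mod N \<sigma> = bottom_row_mod N \<tau>"
  shows "\<exists>\<gamma>\<in>Gamma0 N. \<sigma> = mmul \<gamma> \<tau>"
proof (rule bexI[of _ "mmul \<sigma> (minv \<tau>)"])
  obtain a b c d where s: "\<sigma> = (a,b,c,d)" by (cases \<sigma>)
  obtain a' b' c' d' where t: "\<tau> = (a',b',c',d')" by (cases \<tau>)
  have det: "a' * d' - b' * c' = 1" using assms(2) by (simp add: t SL2Z_def)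
  have 1: "(x * d' - y * c') * a' + (y * a' - x * b') * c' = x * (a' * d' - b' * c')"
    "(x * d' - y * c') * b' + (y * a' - x * b') * d' = y * (a' * d' - b' * c')" for x y
    by (simp_all add: algebra_simps)
  show "\<sigma> = mmul (mmul \<sigma> (minv \<tau>)) \<tau>"
    using 1[of a b] 1[of c d] det by (simp add: s t algebra_simps)
  have m: "c mod int N = c' mod int N" "d mod int N = d' mod int N"
    using assms(3) by (simp_all add: s t)
  have "(c * d') mod int N = (c' * d') mod int N" "(d * c') mod int N = (d' * c') mod int N"
    using m by (metis mod_mult_left_eq)+
  hence "(c * d' - d * c') mod int N = (c' * d' - d' * c') mod int N"
    by (metis mod_diff_eq)
  hence "int N dvd c * d' - d * c'" by (simp add: mod_eq_0_iff_dvd mult.commute)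
  moreover have "mmul \<sigma> (minv \<tau>) \<in> SL2Z" using assms mmul_SL2Z minv_SL2Z by blast
  ultimately show "mmul \<sigma> (minv \<tau>) \<in> Gamma0 N"
    by (simp add: s t Gamma0_def SL2Z_def algebra_simps)
qed

lemma finite_coset_representatives:
  assumes "N \<ge> 1"
  obtains Rep where "finite Rep" "Rep \<subseteq> SL2Z"
    "\<And>\<sigma>. \<sigma> \<in> SL2Z \<Longrightarrow> \<exists>\<gamma>\<in>Gamma0 N. \<exists>\<tau>\<in>Rep. \<sigma> = mmul \<gamma> \<tau>"
proof
  define r where "r \<rho> = (SOME \<sigma>. \<sigma> \<in> SL2Z \<and> bottom_row_mod N \<sigma> = \<rho>)" for \<rho>
  have r: "r (bottom_row_mod N \<sigma>) \<in> SL2Z"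
    "bottom_row_mod N (r (bottom_row_mod N \<sigma>)) = bottom_row_mod N \<sigma>" if "\<sigma> \<in> SL2Z" for \<sigma>
    using someI[of "\<lambda>x. x \<in> SL2Z \<and> bottom_row_mod N x = bottom_row_mod N \<sigma>" \<sigma>] that
    unfolding r_def by blast+
  have "bottom_row_mod N ` SL2Z \<subseteq> {0..<int N} \<times> {0..<int N}"
    using assms by auto
  hence "finite (bottom_row_mod N ` SL2Z)" by (rule finite_subset) simp
  thus "finite (r ` bottom_row_mod N ` SL2Z)" by (rule finite_imageI)
  show "r ` bottom_row_mod N ` SL2Z \<subseteq> SL2Z" using r by auto
  show "\<exists>\<gamma>\<in>Gamma0 N. \<exists>\<tau>\<in>r ` bottom_row_mod N ` SL2Z. \<sigma> = mmul \<gamma> \<tau>" if "\<sigma> \<in> SL2Z" for \<sigma>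
    using same_bottom_row_imp_same_coset[of \<sigma> "r (bottom_row_mod N \<sigma>)" N] r[OF that] that by auto
qed

section \<open>Reduction theory and invariant functions on the upper half plane\<close>

lemma SL2Z_with_bottom_row:
  assumes "coprime c d"
  obtains a b where "(a,b,c,d) \<in> SL2Z"
proof -
  obtain u v where "u * c + v * d = gcd c d" using bezout_int by blast
  hence "(v,-u,c,d) \<in> SL2Z" using assms by (simp add: SL2Z_def)
  thus ?thesis by (rule that)
qed

text \<open>Dirichlet approximation of \<open>Re z\<close> supplies a bottom row
  \<open>(k, -h)\<close> with \<open>norm (k * z - h) ^ 2 \<le> 5 * Im z\<close>, which gives height
  \<open>1/5\<close>. The optimal height is larger, but any fixed positive one does.\<close>

lemma fundamental_strip:
  assumes z: "z \<in> uhp"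
  obtains \<sigma> w where "\<sigma> \<in> SL2Z" "z = mob \<sigma> w" "Im w \<ge> 1/5" "0 \<le> Re w" "Re w \<le> 1"
proof -
  define y where "y = Im z"
  have y: "y > 0" using z by (simp add: y_def in_uhp_iff)
  have "\<exists>\<sigma>\<in>SL2Z. Im (mob \<sigma> z) \<ge> 1/5"
  proof (cases "y < 1")
    case False
    thus ?thesis by (intro bexI[of _ "(1,0,0,1)"]) (auto simp: y_def SL2Z_def)
  next
    case True
    \<comment> \<open>This choice balances the two parts of \<open>norm (k * z - h) ^ 2\<close>: the
      real part contributes at most \<open>y\<close>, the imaginary part at most
      \<open>4 * y\<close>.\<close>
    define t where "t = 1 / sqrt y"
    have t: "t > 1" "t ^ 2 = 1 / y" using True y by (simp_all add: t_def power_divide)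
    define Q where "Q = nat \<lceil>t\<rceil>"
    have Q: "t \<le> real Q" "real Q \<le> 2 * t" "Q > 0" using t unfolding Q_def by linarith+
    obtain h k where hk: "coprime h k" "0 < k" "k \<le> int Q" "\<bar>of_int k * Re z - of_int h\<bar> < 1 / real Q"
      using Dirichlet_approx_coprime[OF Q(3)] by metis
    obtain a b where s: "(a,b,k,-h) \<in> SL2Z"
      using SL2Z_with_bottom_row[of k "-h"] hk(1) by (metis coprime_commute coprime_minus_left_iff)
    have "norm (jfac (a,b,k,-h) z) ^ 2 = (of_int k * Re z - of_int h) ^ 2 + (of_int k * y) ^ 2"
      by (simp add: cmod_power2 y_def)
    also have "(of_int k * Re z - of_int h) ^ 2 \<le> (1 / real Q) ^ 2"
      unfolding abs_le_square_iff[symmetric] using hk(4) by simp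
    also have "\<dots> \<le> (1 / t) ^ 2" using Q t by (intro power_mono divide_left_mono) auto
    also have "\<dots> = y" using t y by (simp add: power_divide)
    also have "(of_int k * y) ^ 2 \<le> (2 * t * y) ^ 2"
    proof (intro power_mono mult_right_mono)
      have "real_of_int k \<le> real Q" using hk(3) by linarith
      thus "real_of_int k \<le> 2 * t" using Q by linarith
    qed (use hk y in auto)
    also have "(2 * t * y) ^ 2 = 4 * y"
      unfolding power_mult_distrib t(2) using y by (simp add: power2_eq_square)
    finally have j: "norm (jfac (a,b,k,-h) z) ^ 2 \<le> 5 * y" by simp
    moreover have "norm (jfac (a,b,k,-h) z) ^ 2 > 0" using jfac_nonzero[OF s z] by simp
    ultimately have "y / (5 * y) \<le> y / norm (jfac (a,b,k,-h) z) ^ 2"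
      using y by (intro divide_left_mono) auto
    thus ?thesis using s y Im_mob[OF s, of z] unfolding y_def[symmetric] by (intro bexI[OF _ s]) simp
  qed
  then obtain \<sigma> where s: "\<sigma> \<in> SL2Z" "Im (mob \<sigma> z) \<ge> 1/5" by blast
  define n where "n = \<lfloor>Re (mob \<sigma> z)\<rfloor>"
  define T where "T = (1::int,-n,0::int,1::int)"
  have T: "T \<in> SL2Z" by (simp add: T_def SL2Z_def)
  define w where "w = mob T (mob \<sigma> z)"
  have w: "w = mob \<sigma> z - of_int n" by (simp add: w_def T_def)
  have mw: "w = mob (mmul T \<sigma>) z" unfolding w_def using mob_mmul[OF T s(1) z] by simp
  have TS: "mmul T \<sigma> \<in> SL2Z" using mmul_SL2Z[OF T s(1)] .
  show ?thesis
  proof (rule that)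
    show "minv (mmul T \<sigma>) \<in> SL2Z" using minv_SL2Z[OF TS] .
    show "z = mob (minv (mmul T \<sigma>)) w" using mob_minv(1)[OF TS z] mw by simp
    show "Im w \<ge> 1/5" using s(2) by (simp add: w)
    show "0 \<le> Re w" "Re w \<le> 1" unfolding w n_def minus_complex.sel complex_Re_of_int by linarith+
  qed
qed

text \<open>By invariance only the finitely many coset representatives matter, so one height
  \<open>Y\<close> serves all of \<open>SL2Z\<close>.\<close>

lemma Gamma0_invariant_small_near_cusps:
  fixes \<phi> :: "complex \<Rightarrow> real"
  assumes N: "N \<ge> 1"
    and inv: "\<And>\<gamma> z. \<gamma> \<in> Gamma0 N \<Longrightarrow> z \<in> uhp \<Longrightarrow> \<phi> (mob \<gamma> z) = \<phi> z"
    and cusp: "\<And>\<sigma>. \<sigma> \<in> SL2Z \<Longrightarrow> ((\<lambda>z. \<phi> (mob \<sigma> z)) \<longlongrightarrow> 0) at_i_infty"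
    and eps: "\<epsilon> > 0"
  obtains Y where "Y > 0" "\<And>\<sigma> w. \<sigma> \<in> SL2Z \<Longrightarrow> Im w > Y \<Longrightarrow> \<phi> (mob \<sigma> w) < \<epsilon>"
proof -
  obtain Rep where Rep: "finite Rep" "Rep \<subseteq> SL2Z"
    "\<And>\<sigma>. \<sigma> \<in> SL2Z \<Longrightarrow> \<exists>\<gamma>\<in>Gamma0 N. \<exists>\<tau>\<in>Rep. \<sigma> = mmul \<gamma> \<tau>"
    using finite_coset_representatives[OF N] by metis
  have "eventually (\<lambda>w. \<forall>\<tau>\<in>Rep. \<phi> (mob \<tau> w) < \<epsilon>) at_i_infty"
    using Rep(1,2) by (intro eventually_ball_finite ballI order_tendstoD(2)[OF cusp eps]) auto
  then obtain Y where Y: "\<And>w \<tau>. Im w > Y \<Longrightarrow> \<tau> \<in> Rep \<Longrightarrow> \<phi> (mob \<tau> w) < \<epsilon>"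
    by (auto simp: eventually_at_i_infty)
  show ?thesis
  proof (rule that[of "max Y 1"])
    fix \<sigma> w assume s: "\<sigma> \<in> SL2Z" and w: "Im w > max Y 1"
    obtain \<gamma> \<tau> where gt: "\<gamma> \<in> Gamma0 N" "\<tau> \<in> Rep" "\<sigma> = mmul \<gamma> \<tau>" using Rep(3)[OF s] by blast
    have wu: "w \<in> uhp" using w by (simp add: in_uhp_iff)
    have "\<phi> (mob \<sigma> w) = \<phi> (mob \<tau> w)"
      using mob_mmul inv gt Rep(2) wu Gamma0_subset_SL2Z mob_in_uhp by (metis subsetD)
    thus "\<phi> (mob \<sigma> w) < \<epsilon>" using Y[of w \<tau>] gt w by simp
  qed simp
qed

text \<open>The quotient by \<open>Gamma0 N\<close> is not compact, but near the cusps
  \<open>\<phi>\<close> falls below any given positive value \<open>\<phi> z1\<close>. What is left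
  is covered by finitely many translates of a compact box.\<close>

lemma Gamma0_invariant_attains_max:
  fixes \<phi> :: "complex \<Rightarrow> real"
  assumes N: "N \<ge> 1" and cont: "continuous_on uhp \<phi>" and nonneg: "\<And>z. \<phi> z \<ge> 0"
    and inv: "\<And>\<gamma> z. \<gamma> \<in> Gamma0 N \<Longrightarrow> z \<in> uhp \<Longrightarrow> \<phi> (mob \<gamma> z) = \<phi> z"
    and cusp: "\<And>\<sigma>. \<sigma> \<in> SL2Z \<Longrightarrow> ((\<lambda>z. \<phi> (mob \<sigma> z)) \<longlongrightarrow> 0) at_i_infty"
  obtains z0 where "z0 \<in> uhp" "\<And>z. z \<in> uhp \<Longrightarrow> \<phi> z \<le> \<phi> z0"
proof (cases "\<exists>z1\<in>uhp. \<phi> z1 > 0")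
  case False
  thus ?thesis using that[of \<i>] nonneg i_in_uhp by (metis not_less order_trans)
next
  case True
  then obtain z1 where z1: "z1 \<in> uhp" "\<phi> z1 > 0" by blast
  obtain Y where Y: "Y > 0" "\<And>\<sigma> w. \<sigma> \<in> SL2Z \<Longrightarrow> Im w > Y \<Longrightarrow> \<phi> (mob \<sigma> w) < \<phi> z1"
    using Gamma0_invariant_small_near_cusps[OF N inv cusp z1(2)] by metis
  obtain Rep where Rep: "finite Rep" "Rep \<subseteq> SL2Z"
    "\<And>\<sigma>. \<sigma> \<in> SL2Z \<Longrightarrow> \<exists>\<gamma>\<in>Gamma0 N. \<exists>\<tau>\<in>Rep. \<sigma> = mmul \<gamma> \<tau>"
    using finite_coset_representatives[OF N] by metis
  define B where "B = cbox (Complex 0 (1/5)) (Complex 1 Y)"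
  have Bu: "B \<subseteq> uhp" by (auto simp: B_def in_cbox_complex_iff in_uhp_iff)
  define K where "K = (\<Union>\<tau>\<in>Rep. mob \<tau> ` B)"
  have K: "compact K" unfolding K_def
  proof (intro compact_UN compact_continuous_image)
    fix \<tau> assume "\<tau> \<in> Rep"
    thus "continuous_on B (mob \<tau>)"
      using mob_holomorphic Rep(2) Bu by (meson continuous_on_subset holomorphic_on_imp_continuous_on subsetD)
  qed (auto simp: Rep B_def)
  have Ku: "K \<subseteq> uhp" using Bu Rep(2) mob_in_uhp unfolding K_def by blast
  have alt: "\<phi> z < \<phi> z1 \<or> (\<exists>x\<in>K. \<phi> z = \<phi> x)" if z: "z \<in> uhp" for z
  proof -
    obtain \<sigma> w where s: "\<sigma> \<in> SL2Z" "z = mob \<sigma> w" "Im w \<ge> 1/5" "0 \<le> Re w" "Re w \<le> 1"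
      using fundamental_strip[OF z] by metis
    show ?thesis
    proof (cases "Im w > Y")
      case True thus ?thesis using Y(2) s by auto
    next
      case False
      obtain \<gamma> \<tau> where gt: "\<gamma> \<in> Gamma0 N" "\<tau> \<in> Rep" "\<sigma> = mmul \<gamma> \<tau>" using Rep(3)[OF s(1)] by blast
      have wu: "w \<in> uhp" using s by (simp add: in_uhp_iff)
      have "\<phi> (mob \<sigma> w) = \<phi> (mob \<tau> w)"
        using mob_mmul inv gt Rep(2) wu Gamma0_subset_SL2Z mob_in_uhp by (metis subsetD)
      moreover have "w \<in> B" using s False by (auto simp: B_def in_cbox_complex_iff)
      ultimately show ?thesis using gt(2) s(2) by (auto simp: K_def)
    qed
  qed
  then obtain x1 where "x1 \<in> K" "\<phi> z1 = \<phi> x1" using z1 by blast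
  moreover obtain z0 where z0: "z0 \<in> K" "\<And>x. x \<in> K \<Longrightarrow> \<phi> x \<le> \<phi> z0"
    using continuous_attains_sup[OF K _ continuous_on_subset[OF cont Ku]] \<open>x1 \<in> K\<close> by blast
  ultimately have "\<phi> z \<le> \<phi> z0" if "z \<in> uhp" for z
    using alt[OF that] by fastforce
  thus ?thesis using that z0(1) Ku by blast
qed

section \<open>Modular symbols\<close>

lemma filterlim_at_i_infty_iff:
  "filterlim f at_i_infty G \<longleftrightarrow> filterlim (\<lambda>x. Im (f x)) at_top G"
  by (simp add: at_i_infty_def filterlim_filtercomap_iff o_def)

lemma filterlim_Im_at_i_infty: "filterlim Im at_top at_i_infty"
  by (simp add: at_i_infty_def filterlim_filtercomap)

text \<open>The size of a combination is the sum of the absolute values of its coefficients, because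
  this becomes a row sum of the Hecke matrix.\<close>

definition int_comb :: "nat \<Rightarrow> (nat \<Rightarrow> complex) \<Rightarrow> real \<Rightarrow> complex \<Rightarrow> bool" where
  "int_comb M v n w \<longleftrightarrow>
     (\<exists>a :: nat \<Rightarrow> int. w = (\<Sum>i<M. of_int (a i) * v i) \<and> (\<Sum>i<M. \<bar>real_of_int (a i)\<bar>) \<le> n)"

lemma int_comb_0: "int_comb M v 0 0"
  unfolding int_comb_def by (intro exI[of _ "\<lambda>_. 0"]) simp

lemma int_comb_mono: "int_comb M v n w \<Longrightarrow> n \<le> m \<Longrightarrow> int_comb M v m w"
  unfolding int_comb_def by force

lemma int_comb_generator: "i < M \<Longrightarrow> int_comb M v 1 (v i)"
  unfolding int_comb_def
  by (intro exI[of _ "\<lambda>j. if j = i then 1 else 0"]) (simp add: if_distrib if_distribR cong: if_cong)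

lemma int_comb_uminus: 
  assumes "int_comb M v n w"
  shows "int_comb M v n (- w)"
proof -
  obtain a :: "nat \<Rightarrow> int" where "w = (\<Sum>i<M. of_int (a i) * v i)" "(\<Sum>i<M. \<bar>real_of_int (a i)\<bar>) \<le> n"
    using assms unfolding int_comb_def by blast
  thus ?thesis unfolding int_comb_def
    by (intro exI[of _ "\<lambda>i. - a i"]) (simp add: sum_negf)
qed

lemma int_comb_add:
  assumes "int_comb M v n w" "int_comb M v n' w'"
  shows "int_comb M v (n + n') (w + w')"
proof -
  obtain a a' :: "nat \<Rightarrow> int" where a: "w = (\<Sum>i<M. of_int (a i) * v i)" "(\<Sum>i<M. \<bar>real_of_int (a i)\<bar>) \<le> n"
    and a': "w' = (\<Sum>i<M. of_int (a' i) * v i)" "(\<Sum>i<M. \<bar>real_of_int (a' i)\<bar>) \<le> n'"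
    using assms unfolding int_comb_def by blast
  have "(\<Sum>i<M. \<bar>real_of_int (a i + a' i)\<bar>) \<le> (\<Sum>i<M. \<bar>real_of_int (a i)\<bar> + \<bar>real_of_int (a' i)\<bar>)"
    by (intro sum_mono) simp
  thus ?thesis unfolding int_comb_def using a a'
    by (intro exI[of _ "\<lambda>i. a i + a' i"]) (simp add: sum.distrib algebra_simps)
qed

lemma int_comb_diff:
  "int_comb M v n w \<Longrightarrow> int_comb M v n' w' \<Longrightarrow> int_comb M v (n + n') (w - w')"
  using int_comb_add[OF _ int_comb_uminus] by fastforce

lemma int_comb_sum:
  assumes "finite A" "\<And>x. x \<in> A \<Longrightarrow> int_comb M v n (w x)"
  shows "int_comb M v (real (card A) * n) (\<Sum>x\<in>A. w x)"
  using assms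
proof (induction A rule: finite_induct)
  case (insert x A)
  have "int_comb M v (n + real (card A) * n) (w x + (\<Sum>x\<in>A. w x))"
    by (intro int_comb_add insert) (use insert in auto)
  thus ?case using insert by (simp add: algebra_simps)
qed (simp add: int_comb_0)

text \<open>The properties of \<open>F = log f\<close>: the character of \<open>f\<close> becomes
  the additive constant \<open>\<kappa>\<close>, and order zero at a cusp becomes a finite limit
  there.\<close>

locale cusp_log =
  fixes N :: nat and F :: "complex \<Rightarrow> complex" and \<kappa> :: "mat2 \<Rightarrow> complex"
  assumes N: "N \<ge> 1"
    and holo: "F holomorphic_on uhp"
    and equivariant: "\<And>\<gamma> z. \<gamma> \<in> Gamma0 N \<Longrightarrow> z \<in> uhp \<Longrightarrow> F (mob \<gamma> z) = F z + \<kappa> \<gamma>"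
    and has_limit: "\<And>\<sigma>. \<sigma> \<in> SL2Z \<Longrightarrow> \<exists>L. ((\<lambda>z. F (mob \<sigma> z)) \<longlongrightarrow> L) at_i_infty"
begin

definition cusp_val :: "mat2 \<Rightarrow> complex" where
  "cusp_val \<sigma> = (THE L. ((\<lambda>z. F (mob \<sigma> z)) \<longlongrightarrow> L) at_i_infty)"

lemma cusp_val_eqI: "((\<lambda>z. F (mob \<sigma> z)) \<longlongrightarrow> L) at_i_infty \<Longrightarrow> cusp_val \<sigma> = L"
  unfolding cusp_val_def using tendsto_unique[OF at_i_infty_neq_bot] by blast

lemma cusp_val: "\<sigma> \<in> SL2Z \<Longrightarrow> ((\<lambda>z. F (mob \<sigma> z)) \<longlongrightarrow> cusp_val \<sigma>) at_i_infty"
  using has_limit cusp_val_eqI by blast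

lemma eventually_uhp_at_i_infty: "eventually (\<lambda>z. z \<in> uhp) at_i_infty"
  by (auto simp: eventually_at_i_infty in_uhp_iff)

lemma cusp_val_mmul_Gamma0:
  assumes "\<gamma> \<in> Gamma0 N" "\<sigma> \<in> SL2Z"
  shows "cusp_val (mmul \<gamma> \<sigma>) = cusp_val \<sigma> + \<kappa> \<gamma>"
proof (rule cusp_val_eqI)
  have "((\<lambda>z. F (mob \<sigma> z) + \<kappa> \<gamma>) \<longlongrightarrow> cusp_val \<sigma> + \<kappa> \<gamma>) at_i_infty"
    by (intro tendsto_intros cusp_val assms)
  moreover have "eventually (\<lambda>z. F (mob \<sigma> z) + \<kappa> \<gamma> = F (mob (mmul \<gamma> \<sigma>) z)) at_i_infty"
    using eventually_uhp_at_i_infty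
  proof eventually_elim
    case (elim z)
    thus ?case using assms Gamma0_subset_SL2Z mob_mmul equivariant mob_in_uhp by metis
  qed
  ultimately show "((\<lambda>z. F (mob (mmul \<gamma> \<sigma>) z)) \<longlongrightarrow> cusp_val \<sigma> + \<kappa> \<gamma>) at_i_infty"
    by (rule Lim_transform_eventually)
qed

section \<open>The invariant size of the derivative of \<open>F\<close>\<close>

lemma has_deriv_F: "z \<in> uhp \<Longrightarrow> (F has_field_derivative deriv F z) (at z)"
  using holo open_uhp by (simp add: holomorphic_derivI)

lemma has_deriv_F_mob:
  assumes "\<sigma> \<in> SL2Z" "z \<in> uhp"
  shows "((\<lambda>z. F (mob \<sigma> z)) has_field_derivative deriv F (mob \<sigma> z) / jfac \<sigma> z ^ 2) (at z)"
  using DERIV_chain2[OF has_deriv_F[OF mob_in_uhp[OF assms]] has_field_derivative_mob[OF assms]]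
  by simp

text \<open>The invariant norm of a weight two form. The absolute value keeps \<open>\<phi>\<close>
  nonnegative off the upper half plane too, as the lemma on maxima asks for.\<close>

definition \<phi> :: "complex \<Rightarrow> real" where
  "\<phi> z = \<bar>Im z\<bar> * norm (deriv F z)"

lemma \<phi>_mob:
  assumes "\<sigma> \<in> SL2Z" "z \<in> uhp"
  shows "\<phi> (mob \<sigma> z) = Im z * norm (deriv (\<lambda>z. F (mob \<sigma> z)) z)"
proof -
  have "deriv (\<lambda>z. F (mob \<sigma> z)) z = deriv F (mob \<sigma> z) / jfac \<sigma> z ^ 2"
    using has_deriv_F_mob[OF assms] by (rule DERIV_imp_deriv)
  thus ?thesis using Im_mob[OF assms(1), of z] assms(2)
    by (simp add: \<phi>_def norm_divide norm_power in_uhp_iff)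
qed

lemma \<phi>_Gamma0:
  assumes "\<gamma> \<in> Gamma0 N" "z \<in> uhp"
  shows "\<phi> (mob \<gamma> z) = \<phi> z"
proof -
  have "((\<lambda>z. F z + \<kappa> \<gamma>) has_field_derivative deriv F z) (at z)"
    using has_deriv_F[OF assms(2)] by (auto intro!: derivative_eq_intros)
  hence "((\<lambda>z. F (mob \<gamma> z)) has_field_derivative deriv F z) (at z)"
    by (rule has_field_derivative_transform_within_open[OF _ open_uhp assms(2)])
      (simp add: equivariant[OF assms(1)])
  hence "deriv (\<lambda>z. F (mob \<gamma> z)) z = deriv F z" by (rule DERIV_imp_deriv)
  thus ?thesis using \<phi>_mob[OF Gamma0_subset_SL2Z[OF assms(1)] assms(2)] assms(2)
    by (simp add: \<phi>_def in_uhp_iff)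
qed

lemma continuous_on_\<phi>: "continuous_on uhp \<phi>"
  unfolding \<phi>_def[abs_def]
  by (intro continuous_intros holomorphic_on_imp_continuous_on holomorphic_deriv holo open_uhp)

text \<open>Cauchy's estimate on the disc of radius \<open>Im z / 2\<close>, where \<open>F\<close> is close to its limit.\<close>

lemma \<phi>_tendsto_0:
  assumes s: "\<sigma> \<in> SL2Z"
  shows "((\<lambda>z. \<phi> (mob \<sigma> z)) \<longlongrightarrow> 0) at_i_infty"
proof (rule tendstoI)
  fix e :: real assume e: "e > 0"
  define G where "G z = F (mob \<sigma> z) - cusp_val \<sigma>" for z
  have "eventually (\<lambda>z. dist (F (mob \<sigma> z)) (cusp_val \<sigma>) < e / 4) at_i_infty"
    using cusp_val[OF s] e by (intro tendstoD) auto
  then obtain Y where Y: "\<And>z. Im z > Y \<Longrightarrow> norm (G z) < e / 4"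
    by (auto simp: eventually_at_i_infty G_def dist_norm)
  have "dist (\<phi> (mob \<sigma> z)) 0 < e" if z: "Im z > max (2 * Y) 0" for z
  proof -
    have zu: "z \<in> uhp" using z by (simp add: in_uhp_iff)
    define r where "r = Im z / 2"
    have r: "r > 0" "r > Y" using z by (auto simp: r_def)
    have cb: "Im w \<ge> r" if "w \<in> cball z r" for w
      using abs_Im_le_cmod[of "z - w"] that by (simp add: dist_norm r_def)
    have sub: "cball z r \<subseteq> uhp" using cb r by (force simp: in_uhp_iff)
    have dG: "(G has_field_derivative deriv F (mob \<sigma> w) / jfac \<sigma> w ^ 2) (at w)" if "w \<in> uhp" for w
      unfolding G_def using has_deriv_F_mob[OF s that] by (auto intro!: derivative_eq_intros)
    have hG: "G holomorphic_on uhp"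
      using dG by (meson field_differentiable_at_within field_differentiable_def holomorphic_onI)
    have "norm ((deriv ^^ 1) G z) \<le> fact 1 * (e / 4) / r ^ 1"
    proof (rule Cauchy_inequality[OF _ _ r(1)])
      show "G holomorphic_on ball z r" using hG sub by (meson ball_subset_cball holomorphic_on_subset)
      show "continuous_on (cball z r) G"
        using hG sub by (meson holomorphic_on_imp_continuous_on holomorphic_on_subset)
      show "norm (G x) \<le> e / 4" if "norm (z - x) = r" for x
      proof -
        have "x \<in> cball z r" using that by (simp add: dist_norm)
        hence "Im x > Y" using cb[of x] r by simp
        thus ?thesis using Y[of x] by simp
      qed
    qed
    hence "r * norm (deriv G z) \<le> e / 4" using r by (simp add: field_simps)
    moreover have "deriv G z = deriv (\<lambda>z. F (mob \<sigma> z)) z"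
      using DERIV_imp_deriv[OF dG[OF zu]] DERIV_imp_deriv[OF has_deriv_F_mob[OF s zu]] by simp
    ultimately have "\<phi> (mob \<sigma> z) \<le> e / 2" unfolding \<phi>_mob[OF s zu] by (simp add: r_def)
    moreover have "\<phi> (mob \<sigma> z) \<ge> 0" by (simp add: \<phi>_def)
    ultimately show ?thesis using e by simp
  qed
  thus "eventually (\<lambda>z. dist (\<phi> (mob \<sigma> z)) 0 < e) at_i_infty"
    unfolding eventually_at_i_infty by blast
qed

section \<open>Boundary values at rational points\<close>

definition F_inf :: complex where "F_inf = cusp_val (1,0,0,1)"

lemma F_inf: "(F \<longlongrightarrow> F_inf) at_i_infty"
  using cusp_val[of "(1,0,0,1)"] by (simp add: F_inf_def SL2Z_def)

text \<open>Limits along vertical lines suit the Hecke operator: the maps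
  \<open>z \<mapsto> p * z\<close> and \<open>z \<mapsto> (z + j) / p\<close> carry vertical lines
  to vertical lines, so no matrices for the image cusps have to be found.\<close>

definition F_vert :: "real \<Rightarrow> complex" where
  "F_vert x = (THE L. ((\<lambda>t. F (Complex x t)) \<longlongrightarrow> L) (at_right 0))"

lemma F_vert_eqI: "((\<lambda>t. F (Complex x t)) \<longlongrightarrow> L) (at_right 0) \<Longrightarrow> F_vert x = L"
  unfolding F_vert_def using tendsto_unique[OF trivial_limit_at_right_real] by blast

text \<open>The inverse of the matrix carries the point at height \<open>t\<close> above
  \<open>a / c\<close> to height \<open>1 / (c ^ 2 * t)\<close>, which tends to infinity.\<close>

lemma cusp_val_vertical:
  assumes s: "(a,b,c,d) \<in> SL2Z" and c: "c \<noteq> 0"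
  shows "((\<lambda>t. F (Complex (of_int a / of_int c) t)) \<longlongrightarrow> cusp_val (a,b,c,d)) (at_right 0)"
proof -
  define \<sigma> where "\<sigma> = (a,b,c,d)"
  define x where "x = real_of_int a / of_int c"
  have s: "\<sigma> \<in> SL2Z" using s by (simp add: \<sigma>_def)
  have "Im (mob (minv \<sigma>) (Complex x t)) = inverse t * inverse (of_int c ^ 2)" if "t > 0" for t
  proof -
    have "jfac (minv \<sigma>) (Complex x t) = Complex 0 (- of_int c * t)"
      using c by (simp add: \<sigma>_def x_def complex_eq_iff)
    hence "norm (jfac (minv \<sigma>) (Complex x t)) ^ 2 = (of_int c * t) ^ 2"
      by (simp add: cmod_power2)
    thus ?thesis using that c by (simp add: Im_mob[OF minv_SL2Z[OF s]] field_simps power2_eq_square)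
  qed
  hence ev: "eventually (\<lambda>t. inverse t * inverse (of_int c ^ 2) = Im (mob (minv \<sigma>) (Complex x t))) (at_right 0)"
    by (auto simp: eventually_at_filter)
  have "filterlim (\<lambda>t. inverse t * inverse (of_int c ^ 2)) at_top (at_right (0::real))"
    using c by (intro filterlim_at_top_mult_tendsto_pos[where c = "inverse (of_int c ^ 2)"]
        filterlim_inverse_at_top_right tendsto_const) auto
  hence "filterlim (\<lambda>t. mob (minv \<sigma>) (Complex x t)) at_i_infty (at_right 0)"
    unfolding filterlim_at_i_infty_iff
    by (rule filterlim_cong[THEN iffD1, rotated 3]) (use ev in auto)
  hence "((\<lambda>t. F (mob \<sigma> (mob (minv \<sigma>) (Complex x t)))) \<longlongrightarrow> cusp_val \<sigma>) (at_right 0)"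
    by (rule filterlim_compose[OF cusp_val[OF s]])
  moreover have "eventually (\<lambda>t. F (mob \<sigma> (mob (minv \<sigma>) (Complex x t))) = F (Complex x t)) (at_right 0)"
    using mob_minv(2)[OF s] by (auto simp: eventually_at_filter in_uhp_iff)
  ultimately show ?thesis unfolding x_def \<sigma>_def by (rule Lim_transform_eventually)
qed

lemma cusp_val_conv_F_vert: "(a,b,c,d) \<in> SL2Z \<Longrightarrow> c \<noteq> 0 \<Longrightarrow> cusp_val (a,b,c,d) = F_vert (of_int a / of_int c)"
  using F_vert_eqI[OF cusp_val_vertical] by simp

lemma cusp_val_conv_F_inf:
  assumes "(a,b,0,d) \<in> SL2Z"
  shows "cusp_val (a,b,0,d) = F_inf"
proof (rule cusp_val_eqI)
  have ad: "a * d = 1" using assms by (simp add: SL2Z_def)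
  hence "a = 1 \<and> d = 1 \<or> a = -1 \<and> d = -1" by (simp add: zmult_eq_1_iff)
  hence m: "mob (a,b,0,d) z = z + of_int (b * d)" for z by auto
  have "filterlim (\<lambda>z. mob (a,b,0,d) z) at_i_infty at_i_infty"
    unfolding filterlim_at_i_infty_iff m using filterlim_Im_at_i_infty by simp
  thus "((\<lambda>z. F (mob (a,b,0,d) z)) \<longlongrightarrow> F_inf) at_i_infty"
    by (rule filterlim_compose[OF F_inf])
qed

text \<open>Hecke images of a fraction need not be in lowest terms, so the common factor is
  cancelled here.\<close>

lemma F_vert_rational:
  fixes u d :: int
  assumes "d \<noteq> 0"
  shows "((\<lambda>t. F (Complex (of_int u / of_int d) t)) \<longlongrightarrow> F_vert (of_int u / of_int d)) (at_right 0)"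
proof -
  define g where "g = gcd u d"
  have g: "g \<noteq> 0" using assms by (simp add: g_def)
  define u' d' where "u' = u div g" and "d' = d div g"
  have ud: "u = u' * g" "d = d' * g" by (simp_all add: u'_def d'_def g_def)
  have cop: "coprime u' d'" unfolding u'_def d'_def g_def using assms by (intro div_gcd_coprime) auto
  obtain a b where "(a,b,-u',d') \<in> SL2Z"
    using SL2Z_with_bottom_row[of "-u'" d'] cop by auto
  hence "(u',-a,d',b) \<in> SL2Z" by (simp add: SL2Z_def algebra_simps)
  moreover have "d' \<noteq> 0" using assms ud by auto
  moreover have "real_of_int u / of_int d = of_int u' / of_int d'" using g by (simp add: ud)
  ultimately show ?thesis using cusp_val_vertical F_vert_eqI by metis
qed

text \<open>The value of the modular symbol \<open>{x, \<infinity>}\<close>.\<close>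

definition E :: "real \<Rightarrow> complex" where "E x = F_inf - F_vert x"

text \<open>The modular symbol \<open>{\<sigma> 0, \<sigma> \<infinity>}\<close>.\<close>

fun msym :: "mat2 \<Rightarrow> complex" where
  "msym (a,b,c,d) = cusp_val (a,b,c,d) - cusp_val (b,-a,d,-c)"

text \<open>Translation by an element of \<open>Gamma0 N\<close> adds the same constant
  \<open>\<kappa>\<close> to both cusp values, and it cancels in their difference.\<close>

lemma msym_eq_if_same_row:
  assumes "\<sigma> \<in> SL2Z" "\<tau> \<in> SL2Z" "bottom_row_mod N \<sigma> = bottom_row_mod N \<tau>"
  shows "msym \<sigma> = msym \<tau>"
proof -
  define S where "S = (0::int,-1::int,1::int,0::int)"
  have S: "S \<in> SL2Z" by (simp add: S_def SL2Z_def)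
  have ms: "msym \<rho> = cusp_val \<rho> - cusp_val (mmul \<rho> S)" for \<rho>
    by (cases \<rho>) (simp add: S_def)
  have assoc: "mmul (mmul x y) w = mmul x (mmul y w)" for x y w
    by (cases x; cases y; cases w) (simp add: algebra_simps)
  obtain \<gamma> where "\<gamma> \<in> Gamma0 N" "\<sigma> = mmul \<gamma> \<tau>"
    using same_bottom_row_imp_same_coset[OF assms] by blast
  thus ?thesis using assms(2) S by (simp add: ms assoc cusp_val_mmul_Gamma0 mmul_SL2Z)
qed

definition M :: nat where "M = card (bottom_row_mod N ` SL2Z)"

definition rep :: "nat \<Rightarrow> mat2" where
  "rep = (SOME h. (\<forall>i<M. h i \<in> SL2Z) \<and> (\<forall>\<sigma>\<in>SL2Z. \<exists>i<M. bottom_row_mod N \<sigma> = bottom_row_mod N (h i)))"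

lemma rep: "i < M \<Longrightarrow> rep i \<in> SL2Z"
  and rep_surj: "\<sigma> \<in> SL2Z \<Longrightarrow> \<exists>i<M. bottom_row_mod N \<sigma> = bottom_row_mod N (rep i)"
proof -
  let ?P = "\<lambda>h. (\<forall>i<M. h i \<in> SL2Z) \<and> (\<forall>\<sigma>\<in>SL2Z. \<exists>i<M. bottom_row_mod N \<sigma> = bottom_row_mod N (h i))"
  have "bottom_row_mod N ` SL2Z \<subseteq> {0..<int N} \<times> {0..<int N}" using N by auto
  hence "finite (bottom_row_mod N ` SL2Z)" by (rule finite_subset) simp
  then obtain h where h: "bij_betw h {0..<M} (bottom_row_mod N ` SL2Z)"
    unfolding M_def using ex_bij_betw_nat_finite by blast
  hence him: "h ` {0..<M} = bottom_row_mod N ` SL2Z" by (simp add: bij_betw_def)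
  have "\<forall>i. \<exists>\<sigma>. i < M \<longrightarrow> \<sigma> \<in> SL2Z \<and> bottom_row_mod N \<sigma> = h i"
    using him by (metis atLeastLessThan_iff imageE imageI zero_le)
  then obtain k where k: "\<And>i. i < M \<Longrightarrow> k i \<in> SL2Z \<and> bottom_row_mod N (k i) = h i" by metis
  have "?P k"
  proof (intro conjI ballI allI impI)
    fix \<sigma> assume "\<sigma> \<in> SL2Z"
    hence "bottom_row_mod N \<sigma> \<in> h ` {0..<M}" unfolding him by blast
    then obtain i where "i < M" "bottom_row_mod N \<sigma> = h i" by auto
    thus "\<exists>i<M. bottom_row_mod N \<sigma> = bottom_row_mod N (k i)" using k by metis
  qed (use k in auto)
  hence "?P rep" unfolding rep_def by (rule someI[where P = ?P])
  thus "i < M \<Longrightarrow> rep i \<in> SL2Z"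
    "\<sigma> \<in> SL2Z \<Longrightarrow> \<exists>i<M. bottom_row_mod N \<sigma> = bottom_row_mod N (rep i)" by blast+
qed

definition v :: "nat \<Rightarrow> complex" where "v i = msym (rep i)"

lemma int_comb_msym: "\<sigma> \<in> SL2Z \<Longrightarrow> int_comb M v 1 (msym \<sigma>)"
  using rep_surj[of \<sigma>] rep msym_eq_if_same_row int_comb_generator[of _ M v] unfolding v_def by metis

text \<open>Manin's continued fraction trick, choosing neighbours so that denominators are halved.\<close>

lemma int_comb_E:
  fixes u :: int and d :: nat
  assumes "d \<ge> 1"
  shows "int_comb M v (1 + log 2 (real d)) (E (of_int u / of_nat d))"
  using assms
proof (induction d arbitrary: u rule: less_induct)
  case (less d u)
  consider "d = 1" | "d > 1" "\<not> coprime u (int d)" | "d > 1" "coprime u (int d)" using less.prems by linarith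
  thus ?case
  proof cases
    case 1
    have s: "(1,u,0,1) \<in> SL2Z" "(u,-1,1,0) \<in> SL2Z" by (simp_all add: SL2Z_def)
    have "msym (1,u,0,1) = E u"
      using cusp_val_conv_F_inf[OF s(1)] cusp_val_conv_F_vert[OF s(2)] by (simp add: E_def)
    thus ?thesis using int_comb_msym[OF s(1)] 1 by simp
  next
    case 2
    define g where "g = gcd u (int d)"
    have "g \<noteq> 1" using 2 by (simp add: g_def coprime_iff_gcd_eq_1)
    moreover have "g > 0" using 2 by (simp add: g_def gcd_pos_int)
    ultimately have g: "g > 1" by linarith
    define u' d' where "u' = u div g" and "d' = nat (int d div g)"
    have dpos: "int d div g > 0" using 2 g by (simp add: g_def pos_imp_zdiv_pos_iff zdvd_imp_le)
    have ud: "u = u' * g" "int d = int d' * g" using dpos by (simp_all add: u'_def d'_def g_def)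
    have d': "d' \<ge> 1" using dpos by (simp add: d'_def)
    have "int d' < int d" unfolding ud(2) using g d' by simp
    hence lt: "d' < d" by simp
    have "real d = real_of_int (int d)" by simp
    hence eq: "real_of_int u / real d = of_int u' / of_nat d'" using g by (simp only: ud) simp
    have "int_comb M v (1 + log 2 (real d')) (E (of_int u' / of_nat d'))"
      by (rule less.IH[OF lt d'])
    thus ?thesis unfolding eq by (rule int_comb_mono) (use lt d' in simp)
  next
    case 3
    obtain s0 where s0: "[u * s0 = 1] (mod int d)" using cong_solve_coprime_int[OF 3(2)] by auto
    define s where "s = s0 mod int d"
    have s: "0 \<le> s" "s < int d" using 3 by (simp_all add: s_def)
    have us: "[u * s = 1] (mod int d)" using s0 unfolding s_def by (simp add: cong_def mod_mult_right_eq)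
    have "s \<noteq> 0" using us 3 by (auto simp: cong_def)
    \<comment> \<open>Both \<open>s\<close> and \<open>d - s\<close> are denominators of fractions
      adjacent to \<open>u / d\<close>, with determinants of opposite sign. The smaller of them is
      at most \<open>d / 2\<close>.\<close>
    have "\<exists>u' d'. 0 < d' \<and> 2 * d' \<le> int d \<and> (u * d' - u' * int d = 1 \<or> u' * int d - u * d' = 1)"
    proof (cases "2 * s \<le> int d")
      case True
      obtain k where "u * s - 1 = int d * k" using us by (auto simp: cong_iff_dvd_diff elim: dvdE)
      thus ?thesis using True s \<open>s \<noteq> 0\<close> by (intro exI[of _ k] exI[of _ s]) (auto simp: algebra_simps)
    next
      case False
      obtain k where "u * s - 1 = int d * k" using us by (auto simp: cong_iff_dvd_diff elim: dvdE)
      thus ?thesis using False s by (intro exI[of _ "u - k"] exI[of _ "int d - s"]) (auto simp: algebra_simps)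
    qed
    then obtain u' d'' where d'': "0 < d''" "2 * d'' \<le> int d"
      and det: "u * d'' - u' * int d = 1 \<or> u' * int d - u * d'' = 1" by blast
    define d' where "d' = nat d''"
    have d': "d' \<ge> 1" "2 * d' \<le> d" "d'' = int d'" using d'' by (auto simp: d'_def)
    have d'0: "d' \<noteq> 0" "d \<noteq> 0" using d' 3 by auto
    have IH: "int_comb M v (1 + log 2 (real d')) (E (of_int u' / of_nat d'))"
      by (rule less.IH) (use d' in auto)
    \<comment> \<open>Halving the denominator lowers \<open>log 2\<close> by \<open>1\<close>, which
      pays for the one symbol spent.\<close>
    have "1 + (1 + log 2 (real d')) = 1 + log 2 (2 * real d')" using d' by (simp add: log_mult)
    also have "\<dots> \<le> 1 + log 2 (real d)" using d' by simp
    finally have le: "1 + (1 + log 2 (real d')) \<le> 1 + log 2 (real d)" .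
    from det show ?thesis
    proof
      assume "u * d'' - u' * int d = 1"
      hence sl: "(u,u',int d,int d') \<in> SL2Z" "(u',-u,int d',-int d) \<in> SL2Z"
        by (simp_all add: SL2Z_def d'(3) algebra_simps)
      have "msym (u,u',int d,int d') = E (of_int u' / of_nat d') - E (of_int u / of_nat d)"
        using cusp_val_conv_F_vert[OF sl(1)] cusp_val_conv_F_vert[OF sl(2)] d'0 by (simp add: E_def)
      hence "E (of_int u / of_nat d) = - msym (u,u',int d,int d') + E (of_int u' / of_nat d')" by simp
      also have "int_comb M v (1 + (1 + log 2 (real d'))) \<dots>"
        by (intro int_comb_add int_comb_uminus int_comb_msym sl IH)
      finally show ?thesis by (rule int_comb_mono[OF _ le])
    next
      assume "u' * int d - u * d'' = 1"
      hence sl: "(u',u,int d',int d) \<in> SL2Z" "(u,-u',int d,-int d') \<in> SL2Z"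
        by (simp_all add: SL2Z_def d'(3) algebra_simps)
      have "msym (u',u,int d',int d) = E (of_int u / of_nat d) - E (of_int u' / of_nat d')"
        using cusp_val_conv_F_vert[OF sl(1)] cusp_val_conv_F_vert[OF sl(2)] d'0 by (simp add: E_def)
      hence "E (of_int u / of_nat d) = msym (u',u,int d',int d) + E (of_int u' / of_nat d')" by simp
      also have "int_comb M v (1 + (1 + log 2 (real d'))) \<dots>"
        by (intro int_comb_add int_comb_msym sl IH)
      finally show ?thesis by (rule int_comb_mono[OF _ le])
    qed
  qed
qed

end

section \<open>The Hecke action on modular symbols\<close>

context cusp_log
begin

text \<open>The integrated form of the relation for \<open>g\<close>; the constant of integration
  \<open>K\<close> cancels in differences of boundary values.\<close>

definition hecke_eigen :: "nat \<Rightarrow> complex \<Rightarrow> bool" where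
  "hecke_eigen p b \<longleftrightarrow> (\<exists>K. \<forall>z\<in>uhp. F (of_nat p * z) + (\<Sum>j<p. F ((z + of_nat j) / of_nat p)) = b * F z + K)"

text \<open>The functional equation is taken to the limit at \<open>\<infinity>\<close> and along
  the vertical line to \<open>x\<close>; subtracting removes \<open>K\<close>.\<close>

lemma hecke_eigen_E:
  fixes u d :: int
  assumes h: "hecke_eigen p b" and p: "p \<ge> 1" and d: "d \<noteq> 0"
  defines "x \<equiv> real_of_int u / of_int d"
  shows "b * E x = E (real p * x) + (\<Sum>j<p. E ((x + real j) / real p))"
proof -
  obtain K where K: "\<And>z. z \<in> uhp \<Longrightarrow> F (of_nat p * z) + (\<Sum>j<p. F ((z + of_nat j) / of_nat p)) = b * F z + K"
    using h unfolding hecke_eigen_def by blast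
  have t1: "((\<lambda>z. F (of_nat p * z) + (\<Sum>j<p. F ((z + of_nat j) / of_nat p))) \<longlongrightarrow> F_inf + (\<Sum>j<p. F_inf)) at_i_infty"
  proof (intro tendsto_add tendsto_sum)
    have "filterlim (\<lambda>z. real p * Im z) at_top at_i_infty" 
      using p by (intro filterlim_tendsto_pos_mult_at_top[OF tendsto_const _ filterlim_Im_at_i_infty]) auto
    hence "filterlim (\<lambda>z. of_nat p * z) at_i_infty at_i_infty"
      unfolding filterlim_at_i_infty_iff by simp
    thus "((\<lambda>z. F (of_nat p * z)) \<longlongrightarrow> F_inf) at_i_infty" by (rule filterlim_compose[OF F_inf])
  next
    fix j
    have "filterlim (\<lambda>z. inverse (real p) * Im z) at_top at_i_infty" 
      using p by (intro filterlim_tendsto_pos_mult_at_top[OF tendsto_const _ filterlim_Im_at_i_infty]) auto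
    hence "filterlim (\<lambda>z. (z + of_nat j) / of_nat p) at_i_infty at_i_infty"
      unfolding filterlim_at_i_infty_iff by (simp add: Im_divide_of_nat field_simps)
    thus "((\<lambda>z. F ((z + of_nat j) / of_nat p)) \<longlongrightarrow> F_inf) at_i_infty" by (rule filterlim_compose[OF F_inf])
  qed
  have t2: "((\<lambda>z. b * F z + K) \<longlongrightarrow> b * F_inf + K) at_i_infty"
    by (intro tendsto_intros F_inf)
  have t3: "eventually (\<lambda>z. F (of_nat p * z) + (\<Sum>j<p. F ((z + of_nat j) / of_nat p)) = b * F z + K) at_i_infty"
    using eventually_uhp_at_i_infty by eventually_elim (rule K)
  have inf: "F_inf + (\<Sum>j<p. F_inf) = b * F_inf + K"
    by (rule tendsto_unique[OF at_i_infty_neq_bot Lim_transform_eventually[OF t1 t3] t2])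
  have scale: "((\<lambda>t. F (Complex y (r * t))) \<longlongrightarrow> F_vert y) (at_right 0)"
    if "r > 0" "y = of_int u' / of_int d'" "d' \<noteq> 0" for r y and u' d' :: int
  proof -
    have "filterlim (\<lambda>t. r * t) (at_right 0) (at_right 0)"
      unfolding filterlim_at using that(1)
      by (auto simp: eventually_at_filter intro!: tendsto_eq_intros)
    thus ?thesis unfolding that(2) by (rule filterlim_compose[OF F_vert_rational[OF that(3)]])
  qed
  have u1: "((\<lambda>t. F (of_nat p * Complex x t) + (\<Sum>j<p. F ((Complex x t + of_nat j) / of_nat p)))
      \<longlongrightarrow> F_vert (real p * x) + (\<Sum>j<p. F_vert ((x + real j) / real p))) (at_right 0)"
  proof (intro tendsto_add tendsto_sum)
    have "((\<lambda>t. F (Complex (real p * x) (real p * t))) \<longlongrightarrow> F_vert (real p * x)) (at_right 0)"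
      by (rule scale[where u' = "int p * u" and d' = d]) (use p d in \<open>auto simp: x_def\<close>)
    moreover have "of_nat p * Complex x t = Complex (real p * x) (real p * t)" for t
      by (simp add: complex_eq_iff)
    ultimately show "((\<lambda>t. F (of_nat p * Complex x t)) \<longlongrightarrow> F_vert (real p * x)) (at_right 0)" by simp
  next
    fix j
    have "((\<lambda>t. F (Complex ((x + real j) / real p) (inverse (real p) * t))) \<longlongrightarrow> F_vert ((x + real j) / real p)) (at_right 0)"
      by (rule scale[where u' = "u + int j * d" and d' = "d * int p"])
        (use p d in \<open>auto simp: x_def field_simps\<close>)
    moreover have "(Complex x t + of_nat j) / of_nat p = Complex ((x + real j) / real p) (inverse (real p) * t)" for t
      by (simp add: complex_eq_iff Re_divide_of_nat Im_divide_of_nat field_simps)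
    ultimately show "((\<lambda>t. F ((Complex x t + of_nat j) / of_nat p)) \<longlongrightarrow> F_vert ((x + real j) / real p)) (at_right 0)" by simp
  qed
  have u2: "((\<lambda>t. b * F (Complex x t) + K) \<longlongrightarrow> b * F_vert x + K) (at_right 0)"
    unfolding x_def by (intro tendsto_intros F_vert_rational d)
  have u3: "eventually (\<lambda>t. F (of_nat p * Complex x t) + (\<Sum>j<p. F ((Complex x t + of_nat j) / of_nat p))
      = b * F (Complex x t) + K) (at_right 0)"
    using K by (auto simp: eventually_at_filter in_uhp_iff)
  have "F_vert (real p * x) + (\<Sum>j<p. F_vert ((x + real j) / real p)) = b * F_vert x + K"
    by (rule tendsto_unique[OF trivial_limit_at_right_real Lim_transform_eventually[OF u1 u3] u2])
  with inf show ?thesis by (simp add: E_def sum_subtractf algebra_simps)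
qed

text \<open>Each step turns one symbol into \<open>p + 1\<close> symbols and multiplies the
  denominator by at most \<open>p\<close>. The continued fraction bound is applied only to the final
  \<open>(p + 1) ^ k\<close> symbols, so the logarithm enters once and grows linearly in
  \<open>k\<close>.\<close>

lemma int_comb_power_E:
  fixes u :: int and d :: nat
  assumes h: "hecke_eigen p b" and p: "p \<ge> 1" and d: "d \<ge> 1"
  shows "int_comb M v ((real p + 1) ^ k * (1 + log 2 (real d * real p ^ k))) (b ^ k * E (of_int u / of_nat d))"
  using d
proof (induction k arbitrary: u d)
  case 0
  thus ?case using int_comb_E by simp
next
  case (Suc k u d)
  define B where "B = (real p + 1) ^ k * (1 + log 2 (real (d * p) * real p ^ k))"
  have dp: "d * p \<ge> 1" using Suc.prems p by simp
  define x where "x = real_of_int u / real d"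
  have 1: "int_comb M v B (b ^ k * E (real p * x))"
  proof -
    \<comment> \<open>This fraction is deliberately left unreduced, so that all \<open>p + 1\<close>
      images share the denominator \<open>d * p\<close>.\<close>
    have "real p * x = of_int (int p * int p * u) / of_nat (d * p)"
      using p Suc.prems by (simp add: x_def field_simps)
    thus ?thesis unfolding B_def using Suc.IH[OF dp] by metis
  qed
  have 2: "int_comb M v B (b ^ k * E ((x + real j) / real p))" for j
  proof -
    have "(x + real j) / real p = of_int (u + int j * int d) / of_nat (d * p)"
      using p Suc.prems by (simp add: x_def field_simps)
    thus ?thesis unfolding B_def using Suc.IH[OF dp] by metis
  qed
  have "b ^ Suc k * E x = b ^ k * (b * E x)" by simp
  also have "b * E x = E (real p * x) + (\<Sum>j<p. E ((x + real j) / real p))"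
    using hecke_eigen_E[OF h p, of "int d" u] Suc.prems by (simp add: x_def)
  also have "b ^ k * \<dots> = b ^ k * E (real p * x) + (\<Sum>j<p. b ^ k * E ((x + real j) / real p))"
    by (simp add: distrib_left sum_distrib_left)
  also have "int_comb M v (B + real (card {..<p}) * B) \<dots>"
    by (intro int_comb_add int_comb_sum 1 2) auto
  finally have "int_comb M v (B + real (card {..<p}) * B) (b ^ Suc k * E x)" .
  moreover have "B + real (card {..<p}) * B = (real p + 1) ^ Suc k * (1 + log 2 (real d * real p ^ Suc k))"
    by (simp add: B_def algebra_simps)
  ultimately show ?case by (simp add: x_def)
qed

lemma int_comb_power_cusp_val:
  assumes h: "hecke_eigen p b" and p: "p \<ge> 1" and s: "\<sigma> \<in> SL2Z"
  obtains \<alpha> where "\<alpha> \<ge> 0"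
    "\<And>k. int_comb M v ((real p + 1) ^ k * (\<alpha> + log 2 (real p) * real k)) (b ^ k * (F_inf - cusp_val \<sigma>))"
proof -
  obtain a b' c d where \<sigma>: "\<sigma> = (a,b',c,d)" by (cases \<sigma>)
  have lp: "log 2 (real p) \<ge> 0" using p by simp
  show ?thesis
  proof (cases "c = 0")
    case True
    show ?thesis
    proof (rule that[of 0])
      fix k
      have "F_inf - cusp_val \<sigma> = 0" using cusp_val_conv_F_inf s True by (simp add: \<sigma>)
      moreover have "0 \<le> (real p + 1) ^ k * (0 + log 2 (real p) * real k)" using lp by simp
      ultimately show "int_comb M v ((real p + 1) ^ k * (0 + log 2 (real p) * real k)) (b ^ k * (F_inf - cusp_val \<sigma>))"
        using int_comb_mono[OF int_comb_0] by simp
    qed simp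
  next
    case False
    define e where "e = nat \<bar>c\<bar>"
    have e: "e \<ge> 1" "real e = \<bar>of_int c\<bar>" using False by (simp_all add: e_def)
    have q: "real_of_int a / of_int c = of_int (sgn c * a) / of_nat e"
      using False by (simp add: e abs_if sgn_if)
    have E: "F_inf - cusp_val \<sigma> = E (of_int (sgn c * a) / of_nat e)"
      using cusp_val_conv_F_vert s False unfolding E_def q[symmetric] by (simp add: \<sigma>)
    show ?thesis
    proof (rule that[of "1 + log 2 (real e)"])
      fix k
      have "1 + log 2 (real e * real p ^ k) = 1 + log 2 (real e) + log 2 (real p) * real k"
        using e p by (simp add: log_mult log_nat_power)
      thus "int_comb M v ((real p + 1) ^ k * (1 + log 2 (real e) + log 2 (real p) * real k)) (b ^ k * (F_inf - cusp_val \<sigma>))"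
        unfolding E using int_comb_power_E[OF h p e(1), of k "sgn c * a"] by (simp add: add.assoc)
    qed (use e in simp)
  qed
qed

lemma int_comb_power_v:
  assumes h: "hecke_eigen p b" and p: "p \<ge> 1"
  obtains \<alpha> \<beta> where
    "\<And>k i. i < M \<Longrightarrow> int_comb M v ((real p + 1) ^ k * (\<alpha> + \<beta> * real k)) (b ^ k * v i)"
proof -
  have "\<exists>\<alpha>\<ge>0. \<forall>k. int_comb M v ((real p + 1) ^ k * (\<alpha> + 2 * log 2 (real p) * real k)) (b ^ k * v i)"
    if i: "i < M" for i
  proof -
    obtain a b' c d where \<sigma>: "rep i = (a,b',c,d)" by (cases "rep i")
    have s: "(a,b',c,d) \<in> SL2Z" "(b',-a,d,-c) \<in> SL2Z"
      using rep[OF i] unfolding \<sigma> by (simp_all add: SL2Z_def algebra_simps)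
    obtain \<alpha>1 where 1: "\<alpha>1 \<ge> 0" "\<And>k. int_comb M v ((real p + 1) ^ k * (\<alpha>1 + log 2 (real p) * real k))
        (b ^ k * (F_inf - cusp_val (a,b',c,d)))"
      using int_comb_power_cusp_val[OF h p s(1)] by metis
    obtain \<alpha>2 where 2: "\<alpha>2 \<ge> 0" "\<And>k. int_comb M v ((real p + 1) ^ k * (\<alpha>2 + log 2 (real p) * real k))
        (b ^ k * (F_inf - cusp_val (b',-a,d,-c)))"
      using int_comb_power_cusp_val[OF h p s(2)] by metis
    have "int_comb M v ((real p + 1) ^ k * (\<alpha>2 + \<alpha>1 + 2 * log 2 (real p) * real k)) (b ^ k * v i)" for k
      using int_comb_diff[OF 2(2)[of k] 1(2)[of k]] by (simp add: v_def \<sigma> algebra_simps)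
    thus ?thesis using 1(1) 2(1) by (intro exI[of _ "\<alpha>2 + \<alpha>1"]) auto
  qed
  then obtain \<alpha> where \<alpha>: "\<And>i. i < M \<Longrightarrow> \<alpha> i \<ge> 0"
    "\<And>i k. i < M \<Longrightarrow> int_comb M v ((real p + 1) ^ k * (\<alpha> i + 2 * log 2 (real p) * real k)) (b ^ k * v i)"
    by metis
  show ?thesis
  proof (rule that[of "\<Sum>i<M. \<alpha> i" "2 * log 2 (real p)"])
    fix k i assume i: "i < M"
    have "\<alpha> i \<le> (\<Sum>i<M. \<alpha> i)" using i \<alpha>(1) by (intro member_le_sum) auto
    thus "int_comb M v ((real p + 1) ^ k * ((\<Sum>i<M. \<alpha> i) + 2 * log 2 (real p) * real k)) (b ^ k * v i)"
      by (intro int_comb_mono[OF \<alpha>(2)[OF i]] mult_left_mono) auto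
  qed
qed

text \<open>Chosen coefficients of the generators form the integer matrices. The constants
  \<open>\<alpha>\<close> and \<open>\<beta>\<close> may depend on \<open>p\<close>, since
  \<open>k\<close> grows with \<open>p\<close> fixed; the exponent \<open>M\<close> does
  not.\<close>

lemma hecke_eigen_norm_bound:
  assumes h: "hecke_eigen p (1 - of_nat p * c)" and p: "p \<ge> 1"
    and c: "algebraic_int c" "c \<noteq> 0" and nz: "j0 < M" "v j0 \<noteq> 0"
  shows "1 \<le> norm c * ((real p + 2) / real p) ^ M"
proof -
  obtain \<alpha> \<beta> where ab: "\<And>k i. i < M \<Longrightarrow>
      int_comb M v ((real p + 1) ^ k * (\<alpha> + \<beta> * real k)) ((1 - of_nat p * c) ^ k * v i)"
    using int_comb_power_v[OF h p] by metis
  define P where "P k j a \<longleftrightarrow> (1 - of_nat p * c) ^ k * v j = (\<Sum>i<M. of_int (a i) * v i) \<and>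
      (\<Sum>i<M. \<bar>real_of_int (a i)\<bar>) \<le> (real p + 1) ^ k * (\<alpha> + \<beta> * real k)" for k j a
  define a where "a k j = (SOME a. P k j a)" for k j
  have a: "P k j (a k j)" if "j < M" for k j
    unfolding a_def using ab[OF that, of k] unfolding int_comb_def P_def[symmetric] by (rule someI_ex)
  show ?thesis
    by (rule algebraic_int_norm_bound[where a = a and v = v and \<alpha> = \<alpha> and \<beta> = \<beta>, OF c _ _ nz])
      (use p a in \<open>simp_all add: P_def\<close>)
qed

text \<open>If all symbols vanish, \<open>F\<close> has the same limit at every cusp and
  \<open>\<kappa> = 0\<close>. Then \<open>norm (F z - F_inf)\<close> is invariant, decays at the
  cusps and attains its maximum, so the maximum principle applies.\<close>

lemma constant_if_modular_symbols_vanish: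
  assumes zero: "\<And>i. i < M \<Longrightarrow> v i = 0"
  shows "F constant_on uhp"
proof -
  have E0: "E (of_int u / of_int d) = 0" if "d \<noteq> 0" for u d :: int
  proof -
    have *: "E (of_int u' / of_nat d') = 0" if "d' \<ge> 1" for u' :: int and d' :: nat
      using int_comb_E[OF that, of u'] zero unfolding int_comb_def by auto
    have "real_of_int u / of_int d = of_int (sgn d * u) / of_nat (nat \<bar>d\<bar>)"
      using that by (simp add: abs_if sgn_if)
    thus ?thesis using *[of "nat \<bar>d\<bar>" "sgn d * u"] that by simp
  qed
  have cv: "cusp_val \<sigma> = F_inf" if "\<sigma> \<in> SL2Z" for \<sigma>
  proof -
    obtain a b c d where \<sigma>: "\<sigma> = (a,b,c,d)" by (cases \<sigma>)
    show ?thesis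
      using that cusp_val_conv_F_inf cusp_val_conv_F_vert E0[of c a] unfolding \<sigma> E_def
      by (cases "c = 0") auto
  qed
  have \<kappa>0: "\<kappa> \<gamma> = 0" if g: "\<gamma> \<in> Gamma0 N" for \<gamma>
  proof -
    have I: "(1,0,0,1) \<in> SL2Z" by (simp add: SL2Z_def)
    have "mmul \<gamma> (1,0,0,1) = \<gamma>" by (cases \<gamma>) simp
    thus ?thesis using cusp_val_mmul_Gamma0[OF g I] cv[OF Gamma0_subset_SL2Z[OF g]] cv[OF I] by simp
  qed
  obtain z0 where z0: "z0 \<in> uhp" "\<And>z. z \<in> uhp \<Longrightarrow> norm (F z - F_inf) \<le> norm (F z0 - F_inf)"
  proof (rule Gamma0_invariant_attains_max[OF N, of "\<lambda>z. norm (F z - F_inf)"])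
    show "continuous_on uhp (\<lambda>z. norm (F z - F_inf))"
      by (intro continuous_intros holomorphic_on_imp_continuous_on holo)
    show "((\<lambda>z. norm (F (mob \<sigma> z) - F_inf)) \<longlongrightarrow> 0) at_i_infty" if "\<sigma> \<in> SL2Z" for \<sigma>
      using cusp_val[OF that] unfolding cv[OF that]
      by (intro tendsto_norm_zero) (simp add: LIM_zero_iff)
  qed (auto simp: equivariant \<kappa>0)
  have "(\<lambda>z. F z - F_inf) constant_on uhp"
    by (rule maximum_modulus_principle[OF _ open_uhp _ open_uhp _ z0(1)])
      (use z0 convex_uhp holo in \<open>auto intro!: holomorphic_intros convex_connected\<close>)
  then obtain k where "\<And>z. z \<in> uhp \<Longrightarrow> F z - F_inf = k" by (auto simp: constant_on_def)
  hence "\<And>z. z \<in> uhp \<Longrightarrow> F z = k + F_inf" by (metis diff_add_cancel)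
  thus ?thesis by (auto simp: constant_on_def)
qed

end

section \<open>Hecke points near cusps\<close>

text \<open>Telescoping after the exact first term \<open>1/4\<close>. Telescoping from
  \<open>g = 2\<close> on would only give \<open>1\<close>, too weak for a positive density of
  coprime pairs.\<close>

lemma sum_inverse_squares_le:
  assumes "Q \<ge> 2"
  shows "(\<Sum>g=2..Q. 1 / real g ^ 2) \<le> 3/4 - 1 / real Q"
  using assms
proof (induction Q rule: dec_induct)
  case (step Q)
  have "1 / real (Suc Q) ^ 2 \<le> 1 / (real Q * real (Suc Q))"
    using step by (intro divide_left_mono) (auto simp: power2_eq_square intro!: mult_right_mono)
  also have "\<dots> = 1 / real Q - 1 / real (Suc Q)" using step by (simp add: field_simps)
  finally show ?case using step by (simp add: sum.atLeast_Suc_atMost)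
qed simp

text \<open>A pair is not coprime only if both entries are divisible by some \<open>g \<ge> 2\<close>, and these pairs
  have density at most \<open>3/4\<close>.\<close>

lemma card_coprime_pairs_ge:
  "real Q ^ 2 / 8 \<le> real (card {(a::nat, c). 1 \<le> a \<and> a \<le> c \<and> c \<le> Q \<and> coprime a c})"
proof -
  define A where "A = {(a, c). 1 \<le> a \<and> a \<le> c \<and> c \<le> Q \<and> coprime a (c::nat)}"
  define B where "B g = {a\<in>{1..Q}. g dvd a}" for g :: nat
  have cardB: "card (B g) \<le> Q div g" if "g \<ge> 2" for g
  proof -
    have "B g \<subseteq> (\<lambda>k. g * k) ` {1..Q div g}"
    proof
      fix a assume "a \<in> B g"
      then obtain k where "a = g * k" "1 \<le> a" "a \<le> Q" by (auto simp: B_def)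
      thus "a \<in> (\<lambda>k. g * k) ` {1..Q div g}"
        using that by (intro image_eqI[of _ _ k]) (auto simp: less_eq_div_iff_mult_less_eq mult.commute intro: Suc_leI Nat.gr0I)
    qed
    hence "card (B g) \<le> card ((\<lambda>k. g * k) ` {1..Q div g})" by (intro card_mono) auto
    also have "\<dots> \<le> Q div g" using card_image_le[of "{1..Q div g}" "\<lambda>k. g * k"] by simp
    finally show ?thesis .
  qed
  have finA: "finite A" by (rule finite_subset[of _ "{1..Q} \<times> {1..Q}"]) (auto simp: A_def)
  \<comment> \<open>\<open>A\<close> holds only pairs with \<open>a \<le> c\<close>, so it is
    counted twice: \<open>Q ^ 2\<close> is at most \<open>2 * card A + 3/4 * Q ^ 2\<close>.\<close>
  have cover: "{1..Q} \<times> {1..Q} \<subseteq> A \<union> prod.swap ` A \<union> (\<Union>g\<in>{2..Q}. B g \<times> B g)"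
  proof clarify
    fix a c assume ac: "a \<in> {1..Q}" "c \<in> {1..Q}" "(a, c) \<notin> (\<Union>g\<in>{2..Q}. B g \<times> B g)"
      and n: "(a, c) \<notin> prod.swap ` A"
    have "coprime a c"
    proof (rule ccontr)
      assume "\<not> coprime a c"
      hence "gcd a c \<noteq> 1" by (simp add: coprime_iff_gcd_eq_1)
      moreover have "gcd a c \<noteq> 0" "gcd a c \<le> Q"
        using ac by (auto intro: order_trans[OF gcd_le1_nat])
      ultimately have "gcd a c \<in> {2..Q}" unfolding atLeastAtMost_iff by linarith
      moreover have "(a, c) \<in> B (gcd a c) \<times> B (gcd a c)" using ac by (auto simp: B_def)
      ultimately show False using ac(3) by blast
    qed
    moreover have "(c, a) \<notin> A" using n by force
    ultimately show "(a, c) \<in> A" using ac(1,2) by (auto simp: A_def coprime_commute)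
  qed
  have "real Q ^ 2 = real (card ({1..Q} \<times> {1..Q}))" by (simp add: power2_eq_square)
  also have "\<dots> \<le> real (card (A \<union> prod.swap ` A \<union> (\<Union>g\<in>{2..Q}. B g \<times> B g)))"
    using finA by (intro of_nat_mono card_mono cover) (auto simp: B_def)
  also have "\<dots> \<le> real (card A + card (prod.swap ` A) + card (\<Union>g\<in>{2..Q}. B g \<times> B g))"
    by (intro of_nat_mono order_trans[OF card_Un_le] add_mono) auto
  also have "\<dots> \<le> real (card A + card A + (\<Sum>g\<in>{2..Q}. card (B g \<times> B g)))"
    by (intro of_nat_mono add_mono card_image_le finA card_UN_le) auto
  also have "\<dots> = 2 * real (card A) + (\<Sum>g=2..Q. real (card (B g)) ^ 2)"
    by (simp add: power2_eq_square card_cartesian_product)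
  also have "(\<Sum>g=2..Q. real (card (B g)) ^ 2) \<le> (\<Sum>g=2..Q. real Q ^ 2 * (1 / real g ^ 2))"
  proof (intro sum_mono)
    fix g assume g: "g \<in> {2..Q}"
    have "real (card (B g)) \<le> real (Q div g)" using cardB g by simp
    also have "\<dots> \<le> real Q / real g" by (rule of_nat_div_le_of_nat)
    finally have "real (card (B g)) ^ 2 \<le> (real Q / real g) ^ 2" by (intro power_mono) auto
    thus "real (card (B g)) ^ 2 \<le> real Q ^ 2 * (1 / real g ^ 2)" by (simp add: power_divide)
  qed
  also have "\<dots> = real Q ^ 2 * (\<Sum>g=2..Q. 1 / real g ^ 2)" by (simp add: sum_distrib_left)
  also have "\<dots> \<le> real Q ^ 2 * (3/4)"
  proof (intro mult_left_mono)
    have "0 \<le> 1 / real Q" by simp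
    thus "(\<Sum>g=2..Q. 1 / real g ^ 2) \<le> 3/4"
      using sum_inverse_squares_le[of Q] by (cases "Q \<ge> 2") (linarith, simp)
  qed simp
  finally show ?thesis by (simp add: A_def)
qed

text \<open>The points \<open>(x + i y + j) / p\<close>, \<open>j < p\<close>, lie on a horocycle of height \<open>y / p\<close>. Those next
  to a fraction \<open>a / c\<close> with \<open>c \<le> \<epsilon> * sqrt p\<close> are in the horoball of height \<open>Y\<close> at \<open>a / c\<close>, and
  distinct fractions give distinct points.\<close>

lemma many_hecke_points_near_cusps:
  fixes x y Y :: real
  assumes y: "y > 0" and Y: "Y > 0"
  obtains \<epsilon> p0 where "\<epsilon> > 0"
    "\<And>p. p \<ge> p0 \<Longrightarrow> \<epsilon> * real p \<le>
      real (card {j. j < p \<and> (\<exists>\<sigma>\<in>SL2Z. Im (mob \<sigma> ((Complex x y + of_nat j) / of_nat p)) > Y)})"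
proof -
  \<comment> \<open>Chosen so that real and imaginary parts of \<open>c * w + d\<close> bounded by
    \<open>h / sqrt p\<close> lift \<open>w\<close>, of height \<open>y / p\<close>, to height at
    least \<open>2 * Y\<close>.\<close>
  define h where "h = sqrt (y / (4 * Y))"
  have h: "h > 0" "h ^ 2 = y / (4 * Y)" using y Y by (simp_all add: h_def)
  \<comment> \<open>The bounds \<open>h\<close> and \<open>h / y\<close> control the real and
    imaginary parts of \<open>c * w + d\<close>; the bound \<open>1\<close> gives
    \<open>c * c' \<le> p\<close>, which separates distinct fractions.\<close>
  define \<epsilon> where "\<epsilon> = Min {1, h, h / y}"
  have e: "\<epsilon> > 0" "\<epsilon> \<le> 1" "\<epsilon> \<le> h" "\<epsilon> * y \<le> h" 
  proof -
    have "\<epsilon> \<le> h / y" by (simp add: \<epsilon>_def)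
    thus "\<epsilon> * y \<le> h" using y by (simp add: pos_le_divide_eq)
  qed (use h y in \<open>auto simp: \<epsilon>_def\<close>)
  show ?thesis
  proof (rule that[of "\<epsilon> ^ 2 / 32" "nat \<lceil>(2 / \<epsilon>) ^ 2\<rceil> + 1"])
    show "\<epsilon> ^ 2 / 32 > 0" using e by simp
    fix p :: nat assume p: "p \<ge> nat \<lceil>(2 / \<epsilon>) ^ 2\<rceil> + 1"
    have p1: "p \<ge> 1" using p by simp
    define q where "q = sqrt (real p)"
    have q: "q > 0" "q ^ 2 = real p" using p1 by (simp_all add: q_def)
    have "(2 / \<epsilon>) ^ 2 \<le> real p" using p by linarith
    hence "2 / \<epsilon> \<le> q" unfolding q_def using e by (intro real_le_rsqrt)
    hence eq2: "2 \<le> \<epsilon> * q" using e by (simp add: pos_divide_le_eq mult.commute)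
    define Q where "Q = nat \<lfloor>\<epsilon> * q\<rfloor>"
    have Q: "real Q \<le> \<epsilon> * q" "\<epsilon> * q / 2 \<le> real Q" using eq2 unfolding Q_def by linarith+
    define A where "A = {(a::nat, c). 1 \<le> a \<and> a \<le> c \<and> c \<le> Q \<and> coprime a c}"
    \<comment> \<open>The point with index \<open>j\<close> lies above \<open>a / c\<close> exactly
      when \<open>j = t\<close>; rounding down and reducing modulo \<open>p\<close> gives an
      admissible index.\<close>
    define t where "t = (\<lambda>(a::nat,c::nat). real p * real a / real c - x)"
    define J where "J = (\<lambda>ac. nat (\<lfloor>t ac\<rfloor> mod int p))"
    let ?G = "{j. j < p \<and> (\<exists>\<sigma>\<in>SL2Z. Im (mob \<sigma> ((Complex x y + of_nat j) / of_nat p)) > Y)}"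
    have J: "\<exists>m::int. \<lfloor>t ac\<rfloor> = int (J ac) + int p * m" for ac
      using p1 by (intro exI[of _ "\<lfloor>t ac\<rfloor> div int p"]) (simp add: J_def)
    have sub: "J ` A \<subseteq> ?G"
    proof clarify
      fix a c assume "(a, c) \<in> A"
      hence ac: "1 \<le> a" "a \<le> c" "c \<le> Q" "coprime a c" by (auto simp: A_def)
      obtain m where m: "\<lfloor>t (a,c)\<rfloor> = int (J (a,c)) + int p * m" using J by blast
      define j where "j = J (a,c)"
      \<comment> \<open>Reduction modulo \<open>p\<close> shifts the target by the integer
        \<open>m\<close>; \<open>(c, d)\<close> is the bottom row that sends
        \<open>a / c - m\<close> to \<open>\<infinity>\<close>.\<close>
      define d where "d = int c * m - int a"
      have cop: "coprime (int c) d"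
      proof -
        have "coprime (int c) (int a)" using ac(4) by (simp add: coprime_commute)
        hence "coprime (int c) (- int a + m * int c)"
          by (metis coprime_commute coprime_iff_gcd_eq_1 gcd_add_mult coprime_minus_left_iff mult.commute add.commute gcd.commute)
        thus ?thesis by (simp add: d_def algebra_simps)
      qed
      obtain \<alpha> \<beta> where \<sigma>: "(\<alpha>,\<beta>,int c,d) \<in> SL2Z" using SL2Z_with_bottom_row[OF cop] by metis
      define w where "w = (Complex x y + of_nat j) / of_nat p"
      have w: "Re w = (x + real j) / real p" "Im w = y / real p"
        by (simp_all add: w_def Re_divide_of_nat Im_divide_of_nat)
      have wu: "w \<in> uhp" using y p1 by (simp add: in_uhp_iff w)
      have "\<bar>t (a,c) - of_int \<lfloor>t (a,c)\<rfloor>\<bar> \<le> 1" by linarith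
      hence t1: "\<bar>t (a,c) - (real j + real p * of_int m)\<bar> \<le> 1" unfolding m j_def by simp
      have "real c * Re w + real_of_int d = - (real c / real p) * (t (a,c) - (real j + real p * of_int m))"
        using p1 ac by (simp add: w d_def t_def field_simps)
      hence "\<bar>real c * Re w + of_int d\<bar> = (real c / real p) * \<bar>t (a,c) - (real j + real p * of_int m)\<bar>"
        by (simp add: abs_mult)
      also have "\<dots> \<le> (real c / real p) * 1" by (intro mult_left_mono t1) simp
      finally have r1: "\<bar>real c * Re w + of_int d\<bar> \<le> real c / real p" by simp
      have cq: "real c \<le> \<epsilon> * q" using ac Q by linarith
      have "real c / real p \<le> \<epsilon> * q / real p" using cq by (intro divide_right_mono) auto
      also have "\<dots> \<le> h * q / real p" using e q by (intro divide_right_mono mult_right_mono) auto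
      also have "\<dots> = h / q" using q by (simp add: q(2)[symmetric] power2_eq_square)
      finally have r2: "\<bar>real c * Re w + of_int d\<bar> \<le> h / q" using r1 by linarith
      have "real c * Im w \<le> \<epsilon> * q * (y / real p)" unfolding w(2)
        using cq y by (intro mult_right_mono) auto
      also have "\<dots> = (\<epsilon> * y) * q / real p" by simp
      also have "\<dots> \<le> h * q / real p" using e q by (intro divide_right_mono mult_right_mono) auto
      also have "\<dots> = h / q" using q by (simp add: q(2)[symmetric] power2_eq_square)
      finally have i2: "\<bar>real c * Im w\<bar> \<le> h / q" using w y by simp
      have "norm (jfac (\<alpha>,\<beta>,int c,d) w) ^ 2 = (real c * Re w + of_int d) ^ 2 + (real c * Im w) ^ 2"
        by (simp add: cmod_power2)
      also have "\<dots> \<le> (h / q) ^ 2 + (h / q) ^ 2"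
        using r2 i2 by (intro add_mono; metis abs_ge_zero power2_abs power_mono)
      also have "\<dots> = y / (2 * Y) / real p" by (simp add: power_divide h(2) q(2))
      finally have n: "norm (jfac (\<alpha>,\<beta>,int c,d) w) ^ 2 \<le> y / (2 * Y) / real p" .
      have n0: "norm (jfac (\<alpha>,\<beta>,int c,d) w) ^ 2 > 0" using jfac_nonzero[OF \<sigma> wu] by simp
      have "Y < 2 * Y" using Y by simp
      also have "2 * Y = (y / real p) / (y / (2 * Y) / real p)" using y Y p1 by simp
      also have "\<dots> \<le> (y / real p) / norm (jfac (\<alpha>,\<beta>,int c,d) w) ^ 2"
        using y p1 n n0 Y by (intro divide_left_mono) auto
      also have "\<dots> = Im (mob (\<alpha>,\<beta>,int c,d) w)" using Im_mob[OF \<sigma>, of w] w by simp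
      finally have "Y < Im (mob (\<alpha>,\<beta>,int c,d) w)" .
      moreover have "J (a,c) < p" using p1 by (simp add: J_def nat_less_iff)
      ultimately show "J (a,c) < p \<and> (\<exists>\<sigma>\<in>SL2Z. Im (mob \<sigma> ((Complex x y + of_nat (J (a,c))) / of_nat p)) > Y)"
        using \<sigma> unfolding w_def j_def by blast
    qed
    have inj: "inj_on J A"
    proof (rule inj_onI, clarify)
      fix a c a' c' assume A: "(a, c) \<in> A" "(a', c') \<in> A" and eq: "J (a, c) = J (a', c')"
      have ac: "1 \<le> a" "a \<le> c" "c \<le> Q" "coprime a c" "1 \<le> a'" "a' \<le> c'" "c' \<le> Q" "coprime a' c'"
        using A by (auto simp: A_def)
      obtain m where m: "\<lfloor>t (a,c)\<rfloor> = int (J (a,c)) + int p * m" using J by blast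
      obtain m' where m': "\<lfloor>t (a',c')\<rfloor> = int (J (a',c')) + int p * m'" using J by blast
      define k where "k = m - m'"
      have "\<lfloor>t (a,c)\<rfloor> - \<lfloor>t (a',c')\<rfloor> = int p * k" using eq m m' by (simp add: k_def algebra_simps)
      hence "\<bar>t (a,c) - t (a',c') - of_int (int p * k)\<bar> < 1" by linarith
      moreover have "t (a,c) - t (a',c') - of_int (int p * k) = real p * (real a / real c - real a' / real c' - of_int k)"
        by (simp add: t_def algebra_simps)
      ultimately have d1: "real p * \<bar>real a / real c - real a' / real c' - of_int k\<bar> < 1"
        by (simp add: abs_mult)
      \<comment> \<open>The numerator of a difference of fractions with denominator
        \<open>c * c' \<le> p\<close>: if nonzero, the difference would be at least
        \<open>1 / p\<close>, against \<open>d1\<close>.\<close>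
      define X where "X = int a * int c' - int a' * int c - k * int c * int c'"
      have X: "real a / real c - real a' / real c' - of_int k = of_int X / (real c * real c')"
        using ac by (simp add: X_def field_simps)
      have "X = 0"
      proof (rule ccontr)
        assume "X \<noteq> 0"
        hence "1 \<le> \<bar>real_of_int X\<bar>" by linarith
        have "real c * real c' \<le> (\<epsilon> * q) * (\<epsilon> * q)" using ac Q by (intro mult_mono) linarith+
        also have "\<dots> = \<epsilon> ^ 2 * real p" by (simp add: q(2)[symmetric] power2_eq_square)
        also have "\<dots> \<le> 1 * real p" using e by (intro mult_right_mono power_le_one) auto
        finally have "real c * real c' \<le> real p" by simp
        moreover have cc: "real c * real c' > 0" using ac by simp
        ultimately have "1 \<le> real p / (real c * real c')" by simp
        also have "\<dots> \<le> real p * (\<bar>real_of_int X\<bar> / (real c * real c'))"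
          using \<open>1 \<le> \<bar>real_of_int X\<bar>\<close> cc by (simp add: divide_right_mono mult_le_cancel_left1)
        finally show False using d1 unfolding X by (simp add: abs_mult)
      qed
      hence fr: "real a / real c - real a' / real c' = of_int k" using X by simp
      \<comment> \<open>Both fractions lie in the half-open interval from \<open>0\<close> to
        \<open>1\<close>, so they cannot differ by a nonzero integer.\<close>
      have "0 < real a / real c" "real a / real c \<le> 1" "0 < real a' / real c'" "real a' / real c' \<le> 1"
        using ac by auto
      hence "\<bar>real_of_int k\<bar> < 1" using fr by linarith
      hence "k = 0" by linarith
      hence "int a * int c' = int a' * int c" using \<open>X = 0\<close> by (simp add: X_def)
      hence cross: "a * c' = a' * c" by (metis of_nat_eq_iff of_nat_mult)
      have "a dvd a'" using cross ac(4) by (metis coprime_dvd_mult_left_iff dvd_triv_left)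
      moreover have "a' dvd a" using cross ac(8) by (metis coprime_dvd_mult_left_iff dvd_triv_left)
      ultimately have "a = a'" by (rule dvd_antisym)
      thus "a = a' \<and> c = c'" using cross ac by simp
    qed
    have "\<epsilon> ^ 2 / 32 * real p = (\<epsilon> * q / 2) ^ 2 / 8" by (simp add: q(2)[symmetric] power_mult_distrib power_divide)
    also have "\<dots> \<le> real Q ^ 2 / 8" using Q eq2 by (intro divide_right_mono power_mono) auto
    also have "\<dots> \<le> real (card A)" unfolding A_def by (rule card_coprime_pairs_ge)
    also have "card A = card (J ` A)" using inj by (simp add: card_image)
    also have "real \<dots> \<le> real (card ?G)" using sub by (intro of_nat_mono card_mono) auto
    finally show "\<epsilon> ^ 2 / 32 * real p \<le> real (card ?G)" .
  qed
qed

section \<open>Bounding the eigenvalue at a maximum point\<close>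

context cusp_log
begin

lemma has_deriv_hecke_sum:
  assumes p: "p \<ge> 1" and z: "z \<in> uhp"
  shows "((\<lambda>z. F (of_nat p * z) + (\<Sum>j<p. F ((z + of_nat j) / of_nat p))) has_field_derivative
    of_nat p * deriv F (of_nat p * z) + (\<Sum>j<p. deriv F ((z + of_nat j) / of_nat p)) / of_nat p) (at z)"
proof -
  have u: "of_nat p * z \<in> uhp" "(z + of_nat j) / of_nat p \<in> uhp" for j
    using z p by (auto simp: in_uhp_iff Im_divide_of_nat)
  have "((\<lambda>z. of_nat p * z) has_field_derivative of_nat p) (at z)"
    by (auto intro!: derivative_eq_intros)
  from DERIV_chain2[OF has_deriv_F[OF u(1)] this]
  have d1: "((\<lambda>z. F (of_nat p * z)) has_field_derivative deriv F (of_nat p * z) * of_nat p) (at z)" .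
  have d2: "((\<lambda>z. F ((z + of_nat j) / of_nat p)) has_field_derivative
      deriv F ((z + of_nat j) / of_nat p) * (1 / of_nat p)) (at z)" for j
  proof -
    have "((\<lambda>z. (z + of_nat j) / of_nat p) has_field_derivative (1 / of_nat p)) (at z)"
      using p by (auto intro!: derivative_eq_intros)
    from DERIV_chain2[OF has_deriv_F[OF u(2)] this] show ?thesis .
  qed
  have "((\<lambda>z. F (of_nat p * z) + (\<Sum>j<p. F ((z + of_nat j) / of_nat p))) has_field_derivative
      deriv F (of_nat p * z) * of_nat p + (\<Sum>j<p. deriv F ((z + of_nat j) / of_nat p) * (1 / of_nat p))) (at z)"
    by (intro DERIV_add DERIV_sum d1 d2)
  thus ?thesis by (simp add: sum_divide_distrib mult.commute)
qed

text \<open>After differentiation the factors \<open>p\<close> and \<open>1 / p\<close> are exactly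
  the changes of height at \<open>p * z\<close> and \<open>(z + j) / p\<close>, so all
  \<open>p + 1\<close> values of \<open>\<phi>\<close> enter with weight \<open>1\<close>.\<close>

lemma hecke_eigen_\<phi>_le:
  assumes h: "hecke_eigen p b" and p: "p \<ge> 1" and z: "z \<in> uhp"
  shows "norm b * \<phi> z \<le> \<phi> (of_nat p * z) + (\<Sum>j<p. \<phi> ((z + of_nat j) / of_nat p))"
proof -
  obtain K where K: "\<And>z. z \<in> uhp \<Longrightarrow> F (of_nat p * z) + (\<Sum>j<p. F ((z + of_nat j) / of_nat p)) = b * F z + K"
    using h unfolding hecke_eigen_def by blast
  have "((\<lambda>z. b * F z + K) has_field_derivative
      of_nat p * deriv F (of_nat p * z) + (\<Sum>j<p. deriv F ((z + of_nat j) / of_nat p)) / of_nat p) (at z)"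
    by (rule has_field_derivative_transform_within_open[OF has_deriv_hecke_sum[OF p z] open_uhp z]) (rule K)
  moreover have "((\<lambda>z. b * F z + K) has_field_derivative b * deriv F z) (at z)"
    using has_deriv_F[OF z] by (auto intro!: derivative_eq_intros)
  ultimately have eq: "b * deriv F z =
      of_nat p * deriv F (of_nat p * z) + (\<Sum>j<p. deriv F ((z + of_nat j) / of_nat p)) / of_nat p"
    by (rule DERIV_unique[symmetric])
  have Im: "Im z > 0" using z by (simp add: in_uhp_iff)
  have "norm b * \<phi> z = Im z * norm (b * deriv F z)" using Im by (simp add: \<phi>_def norm_mult)
  also have "norm (b * deriv F z) \<le> norm (of_nat p * deriv F (of_nat p * z)) +
      (\<Sum>j<p. norm (deriv F ((z + of_nat j) / of_nat p) / of_nat p))"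
    unfolding eq sum_divide_distrib by (intro order_trans[OF norm_triangle_ineq] add_left_mono norm_sum)
  also have "Im z * \<dots> = \<phi> (of_nat p * z) + (\<Sum>j<p. \<phi> ((z + of_nat j) / of_nat p))"
    using Im by (simp add: \<phi>_def distrib_left sum_distrib_left norm_mult norm_divide Im_divide_of_nat
        sum_divide_distrib mult_ac)
  finally show ?thesis using Im by simp
qed

text \<open>At a maximum of \<open>\<phi>\<close> \<open>norm b * \<phi>\<close> is at most the sum of \<open>\<phi>\<close> over the \<open>p + 1\<close> Hecke points,
  a positive proportion of which lies close to the cusps, where \<open>\<phi>\<close> is at most half its maximum.\<close>

lemma hecke_eigenvalue_bound:
  assumes nc: "\<not> F constant_on uhp"
  obtains \<delta> p0 where "\<delta> > 0"
    "\<And>p b. p \<ge> p0 \<Longrightarrow> hecke_eigen p b \<Longrightarrow> norm b \<le> (1 - \<delta>) * real p + 1"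
proof -
  obtain z0 where z0: "z0 \<in> uhp" "\<And>z. z \<in> uhp \<Longrightarrow> \<phi> z \<le> \<phi> z0"
    using Gamma0_invariant_attains_max[OF N continuous_on_\<phi> _ \<phi>_Gamma0 \<phi>_tendsto_0]
    by (metis \<phi>_def abs_ge_zero mult_nonneg_nonneg norm_ge_zero)
  define P where "P = \<phi> z0"
  have "P > 0"
  proof (rule ccontr)
    assume "\<not> P > 0"
    hence "deriv F z = 0" if "z \<in> uhp" for z
      using z0(2)[OF that] that unfolding P_def \<phi>_def in_uhp_iff
      by (smt (verit) mult_pos_pos norm_ge_zero norm_eq_zero)
    hence "\<exists>k. \<forall>z\<in>uhp. F z = k"
      by (intro has_field_derivative_zero_constant[OF convex_uhp])
        (metis has_deriv_F has_field_derivative_at_within)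
    thus False using nc by (auto simp: constant_on_def)
  qed
  obtain Y where Y: "Y > 0" "\<And>\<sigma> w. \<sigma> \<in> SL2Z \<Longrightarrow> Im w > Y \<Longrightarrow> \<phi> (mob \<sigma> w) < P / 2"
    using Gamma0_invariant_small_near_cusps[OF N \<phi>_Gamma0 \<phi>_tendsto_0, of "P / 2"] \<open>P > 0\<close>
    by (metis half_gt_zero)
  have Im0: "Im z0 > 0" using z0 by (simp add: in_uhp_iff)
  obtain \<epsilon> p0 where e: "\<epsilon> > 0" and many: "\<And>p. p \<ge> p0 \<Longrightarrow> \<epsilon> * real p \<le>
      real (card {j. j < p \<and> (\<exists>\<sigma>\<in>SL2Z. Im (mob \<sigma> ((Complex (Re z0) (Im z0) + of_nat j) / of_nat p)) > Y)})"
    by (rule many_hecke_points_near_cusps[OF Im0 Y(1), of "Re z0"]) (rule that)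
  show ?thesis
  proof (rule that[of "\<epsilon> / 2" "max p0 1"])
    fix p b assume p: "p \<ge> max p0 1" and h: "hecke_eigen p b"
    define w where "w j = (z0 + of_nat j) / of_nat p" for j :: nat
    define G where "G = {j. j < p \<and> (\<exists>\<sigma>\<in>SL2Z. Im (mob \<sigma> (w j)) > Y)}"
    have Gc: "\<epsilon> * real p \<le> real (card G)" using many[of p] p by (simp add: G_def w_def)
    have wu: "w j \<in> uhp" for j using Im0 p by (simp add: w_def in_uhp_iff Im_divide_of_nat)
    have wG: "\<phi> (w j) \<le> P / 2" if jG: "j \<in> G" for j
    proof -
      \<comment> \<open>\<open>w j\<close> is the image under \<open>minv \<sigma>\<close> of a
        point higher than \<open>Y\<close>.\<close>
      obtain \<sigma> where s: "\<sigma> \<in> SL2Z" "Im (mob \<sigma> (w j)) > Y" using jG unfolding G_def by blast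
      thus ?thesis using Y(2)[OF minv_SL2Z[OF s(1)] s(2)] mob_minv(1)[OF s(1) wu] by simp
    qed
    have Gp: "G \<subseteq> {..<p}" by (auto simp: G_def)
    have "norm b * P \<le> \<phi> (of_nat p * z0) + (\<Sum>j<p. \<phi> (w j))"
      using hecke_eigen_\<phi>_le[OF h _ z0(1)] p by (simp add: P_def w_def)
    \<comment> \<open>This single point accounts for the summand \<open>1\<close> in the
      bound.\<close>
    also have "\<phi> (of_nat p * z0) \<le> P" unfolding P_def using Im0 p by (intro z0) (simp add: in_uhp_iff)
    also have "(\<Sum>j<p. \<phi> (w j)) \<le> (\<Sum>j<p. P - (if j \<in> G then P / 2 else 0))"
      using wG z0(2)[OF wu] by (intro sum_mono) (auto simp: P_def)
    also have "\<dots> = real p * P - real (card G) * (P / 2)"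
      using Gp by (simp add: sum_subtractf sum.If_cases Int_absorb1)
    also have "\<dots> \<le> real p * P - \<epsilon> * real p * (P / 2)"
      using Gc \<open>P > 0\<close> by (simp add: mult_right_mono)
    finally have "norm b * P \<le> ((1 - \<epsilon> / 2) * real p + 1) * P" by (simp add: algebra_simps)
    thus "norm b \<le> (1 - \<epsilon> / 2) * real p + 1" using \<open>P > 0\<close> by simp
  qed (use e in simp)
qed

end

section \<open>The theorem\<close>

lemma sum_roots_of_unity:
  fixes p n :: nat
  assumes "p \<ge> 1"
  shows "(\<Sum>j<p. qvar (of_nat j / of_nat p) ^ n) = (if p dvd n then of_nat p else 0)"
proof -
  define w where "w = exp (2 * of_real pi * \<i> * of_nat n / of_nat p)"
  have w1: "w = 1 \<longleftrightarrow> p dvd n" unfolding w_def using complex_root_unity_eq_1[OF assms, of n] by simp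
  have "qvar (of_nat j / of_nat p) ^ n = w ^ j" for j
    by (simp add: qvar_def w_def exp_of_nat_mult[symmetric] algebra_simps)
  hence eq: "(\<Sum>j<p. qvar (of_nat j / of_nat p) ^ n) = (\<Sum>j<p. w ^ j)" by simp
  have "w ^ p = exp (2 * of_real pi * \<i> * of_nat n)"
    using assms by (simp add: w_def exp_of_nat_mult[symmetric])
  also have "\<dots> = 1" using exp_integer_2pi[of "of_nat n"] by (simp add: mult_ac)
  finally have "w ^ p = 1" .
  show ?thesis
  proof (cases "p dvd n")
    case True
    thus ?thesis using w1 eq by simp
  next
    case False
    hence "w \<noteq> 1" using w1 by simp
    hence "(\<Sum>j<p. w ^ j) = (w ^ p - 1) / (w - 1)" by (rule geometric_sum)
    thus ?thesis using False eq \<open>w ^ p = 1\<close> by simp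
  qed
qed

text \<open>Orthogonality of roots of unity makes the average over \<open>j\<close> the series with
  coefficients \<open>b (p * m)\<close>, while \<open>p * g (p * z)\<close> contributes
  \<open>p * b (m / p)\<close>. Normalization identifies the eigenvalue with
  \<open>b p\<close>.\<close>

lemma hecke_eigen_coeffs_imp_functional_equation:
  assumes g: "fourier_coeffs g b" and b: "b 0 = 0" "b 1 = 1" and e: "hecke_eigen_coeffs N b"
    and p: "prime p" "\<not> p dvd N" and z: "z \<in> uhp"
  shows "of_nat p * g (of_nat p * z) + (\<Sum>j<p. g ((z + of_nat j) / of_nat p)) / of_nat p = b p * g z"
proof -
  have p1: "p \<ge> 1" "p > 1" using p(1) prime_gt_1_nat[of p] by auto
  define r where "r = qvar (z / of_nat p)"
  have rp: "r ^ p = qvar z" using p1 by (simp add: r_def qvar_def exp_of_nat_mult[symmetric])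
  \<comment> \<open>The eigenvector condition starts at \<open>n = 1\<close>; \<open>b 0 = 0\<close>
    extends it to the constant term.\<close>
  have rec: "b (p * n) + (if p dvd n then of_nat p * b (n div p) else 0) = b p * b n" for n
  proof (cases "n = 0")
    case False
    obtain ev where ev: "\<And>n. n \<ge> 1 \<Longrightarrow>
        b (p * n) + (if \<not> p dvd N \<and> p dvd n then of_nat p * b (n div p) else 0) = ev * b n"
      using e p(1) unfolding hecke_eigen_coeffs_def by blast
    have "b p = ev" using ev[of 1] p1 b by simp
    thus ?thesis using ev[of n] p(2) False by simp
  qed (simp add: b)
  have sm: "strict_mono (\<lambda>n. p * n)" using p1 by (simp add: strict_mono_def)
  have "(\<lambda>n. \<Sum>j<p. b n * qvar ((z + of_nat j) / of_nat p) ^ n) sums (\<Sum>j<p. g ((z + of_nat j) / of_nat p))"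
  proof (rule sums_sum)
    fix j
    have "(z + of_nat j) / of_nat p \<in> uhp" using z p1 by (simp add: in_uhp_iff Im_divide_of_nat)
    thus "(\<lambda>n. b n * qvar ((z + of_nat j) / of_nat p) ^ n) sums g ((z + of_nat j) / of_nat p)"
      using g unfolding fourier_coeffs_def by blast
  qed
  moreover have "(\<Sum>j<p. b n * qvar ((z + of_nat j) / of_nat p) ^ n) = (if p dvd n then of_nat p * b n * r ^ n else 0)" for n
  proof -
    have "qvar ((z + of_nat j) / of_nat p) = r * qvar (of_nat j / of_nat p)" for j
      by (simp add: qvar_def r_def exp_add[symmetric] add_divide_distrib distrib_left)
    hence "(\<Sum>j<p. b n * qvar ((z + of_nat j) / of_nat p) ^ n) = b n * r ^ n * (\<Sum>j<p. qvar (of_nat j / of_nat p) ^ n)"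
      by (simp add: power_mult_distrib sum_distrib_left mult_ac)
    thus ?thesis using sum_roots_of_unity[OF p1(1), of n] by simp
  qed
  ultimately have "(\<lambda>n. if p dvd n then of_nat p * b n * r ^ n else 0) sums (\<Sum>j<p. g ((z + of_nat j) / of_nat p))"
    by simp
  hence "(\<lambda>m. if p dvd p * m then of_nat p * b (p * m) * r ^ (p * m) else 0) sums (\<Sum>j<p. g ((z + of_nat j) / of_nat p))"
    by (subst sums_mono_reindex[OF sm]) (auto elim!: dvdE)
  moreover have "r ^ (p * m) = qvar z ^ m" for m by (simp only: power_mult rp)
  ultimately have "(\<lambda>m. of_nat p * (b (p * m) * qvar z ^ m)) sums (\<Sum>j<p. g ((z + of_nat j) / of_nat p))"
    by (simp add: mult.assoc)
  from sums_divide[OF this, of "of_nat p"]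
  have U: "(\<lambda>m. b (p * m) * qvar z ^ m) sums ((\<Sum>j<p. g ((z + of_nat j) / of_nat p)) / of_nat p)"
    using p1 by simp
  have "of_nat p * z \<in> uhp" using z p1 by (simp add: in_uhp_iff)
  hence "(\<lambda>n. b n * qvar (of_nat p * z) ^ n) sums g (of_nat p * z)"
    using g unfolding fourier_coeffs_def by blast
  hence "(\<lambda>n. of_nat p * (b n * qvar (of_nat p * z) ^ n)) sums (of_nat p * g (of_nat p * z))"
    by (rule sums_mult)
  moreover have "qvar (of_nat p * z) = qvar z ^ p"
    by (simp add: qvar_def exp_of_nat_mult[symmetric] mult_ac)
  ultimately have "(\<lambda>n. (\<lambda>m. if p dvd m then of_nat p * b (m div p) * qvar z ^ m else 0) (p * n)) sums (of_nat p * g (of_nat p * z))"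
    using p1 by (simp add: power_mult[symmetric] mult_ac)
  hence V: "(\<lambda>m. if p dvd m then of_nat p * b (m div p) * qvar z ^ m else 0) sums (of_nat p * g (of_nat p * z))"
    by (subst (asm) sums_mono_reindex[OF sm]) (auto elim!: dvdE)
  have "(\<lambda>m. b p * (b m * qvar z ^ m)) sums
      (of_nat p * g (of_nat p * z) + (\<Sum>j<p. g ((z + of_nat j) / of_nat p)) / of_nat p)"
  proof -
    have "(if p dvd m then of_nat p * b (m div p) * qvar z ^ m else 0) + b (p * m) * qvar z ^ m
        = b p * (b m * qvar z ^ m)" for m
    proof -
      have "(if p dvd m then of_nat p * b (m div p) * qvar z ^ m else 0) + b (p * m) * qvar z ^ m
          = (b (p * m) + (if p dvd m then of_nat p * b (m div p) else 0)) * qvar z ^ m"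
        by (simp add: algebra_simps)
      thus ?thesis by (simp only: rec mult.assoc)
    qed
    thus ?thesis using sums_add[OF V U] by simp
  qed
  moreover have "(\<lambda>m. b p * (b m * qvar z ^ m)) sums (b p * g z)"
    using g z unfolding fourier_coeffs_def by (intro sums_mult) blast
  ultimately show ?thesis by (rule sums_unique2)
qed

text \<open>The series in \<open>q\<close> is continuous at \<open>q = 0\<close>, so its constant
  term is the limit of \<open>g\<close> at \<open>\<infinity>\<close>, which vanishes for a cusp
  form.\<close>

lemma fourier_coeff_0_eq_0:
  assumes g: "fourier_coeffs g b" and cf: "cusp_form2 N g"
  shows "b 0 = 0"
proof -
  define W where "W q = (\<Sum>n. b n * q ^ n)" for q
  have gW: "g z = W (qvar z)" if "z \<in> uhp" for z
    using g that unfolding fourier_coeffs_def W_def by (simp add: sums_iff)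
  have "summable (\<lambda>n. b n * qvar \<i> ^ n)"
    using g i_in_uhp unfolding fourier_coeffs_def by (blast intro: sums_summable)
  hence "isCont W 0" unfolding W_def by (rule isCont_powser) (simp add: qvar_def)
  moreover have "W 0 = b 0" by (simp add: W_def)
  ultimately have W: "(W \<longlongrightarrow> b 0) (nhds 0)" by (metis continuous_within tendsto_at_iff_tendsto_nhds)
  have "(qvar \<longlongrightarrow> 0) at_i_infty"
  proof (rule tendsto_norm_zero_cancel)
    have "filterlim (\<lambda>z. (- 2 * pi) * Im z) at_bot at_i_infty"
      by (rule filterlim_tendsto_neg_mult_at_bot[OF tendsto_const _ filterlim_Im_at_i_infty]) simp
    hence "((\<lambda>z. exp ((- 2 * pi) * Im z)) \<longlongrightarrow> 0) at_i_infty"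
      by (rule filterlim_compose[OF exp_at_bot])
    thus "((\<lambda>z. norm (qvar z)) \<longlongrightarrow> 0) at_i_infty" by (simp add: norm_qvar)
  qed
  hence t1: "((\<lambda>z. W (qvar z)) \<longlongrightarrow> b 0) at_i_infty" by (rule filterlim_compose[OF W])
  have "(1,0,0,1) \<in> SL2Z" by (simp add: SL2Z_def)
  hence "((\<lambda>z. g (mob (1,0,0,1) z) / (jfac (1,0,0,1) z) ^ 2) \<longlongrightarrow> 0) at_i_infty"
    using cf unfolding cusp_form2_def by blast
  hence t2: "(g \<longlongrightarrow> 0) at_i_infty" by simp
  have "eventually (\<lambda>z. g z = W (qvar z)) at_i_infty"
    using gW by (auto simp: eventually_at_i_infty in_uhp_iff)
  from tendsto_unique[OF at_i_infty_neq_bot Lim_transform_eventually[OF t2 this] t1]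
  show ?thesis by simp
qed

lemma (in cusp_log) hecke_eigenI:
  assumes p: "p \<ge> 1"
    and eq: "\<And>z. z \<in> uhp \<Longrightarrow> of_nat p * deriv F (of_nat p * z) +
      (\<Sum>j<p. deriv F ((z + of_nat j) / of_nat p)) / of_nat p = b * deriv F z"
  shows "hecke_eigen p b"
proof -
  have "\<exists>K. \<forall>z\<in>uhp. F (of_nat p * z) + (\<Sum>j<p. F ((z + of_nat j) / of_nat p)) - b * F z = K"
  proof (rule has_field_derivative_zero_constant[OF convex_uhp])
    fix z assume z: "z \<in> uhp"
    have "((\<lambda>z. F (of_nat p * z) + (\<Sum>j<p. F ((z + of_nat j) / of_nat p)) - b * F z)
        has_field_derivative b * deriv F z - b * deriv F z) (at z)"
      using has_deriv_hecke_sum[OF p z] unfolding eq[OF z]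
      by (intro DERIV_diff DERIV_cmult has_deriv_F z)
    thus "((\<lambda>z. F (of_nat p * z) + (\<Sum>j<p. F ((z + of_nat j) / of_nat p)) - b * F z)
        has_field_derivative 0) (at z within uhp)"
      by (simp add: has_field_derivative_at_within)
  qed
  then obtain K where K: "\<And>z. z \<in> uhp \<Longrightarrow>
      F (of_nat p * z) + (\<Sum>j<p. F ((z + of_nat j) / of_nat p)) - b * F z = K" by blast
  show ?thesis unfolding hecke_eigen_def
    by (intro exI[of _ K] ballI) (simp add: K[symmetric])
qed

text \<open>Multiplicative relations of \<open>f\<close> lift to additive ones for a holomorphic
  logarithm, since the ambiguity in \<open>2 * pi * \<i>\<close> is constant on connected
  sets.\<close>

lemma cusp_log_exists:
  assumes N: "N \<ge> 1" and f: "gmf N 0 f" "div_zero0 f"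
  obtains F \<kappa> where "cusp_log N F \<kappa>" "\<And>z. z \<in> uhp \<Longrightarrow> exp (F z) = f z"
proof -
  have holo: "f holomorphic_on uhp" using f(1) by (simp add: gmf_def)
  have nz: "\<And>z. z \<in> uhp \<Longrightarrow> f z \<noteq> 0" using f(2) by (auto simp: div_zero0_def)
  obtain F where F: "F holomorphic_on uhp" "\<And>z. z \<in> uhp \<Longrightarrow> exp (F z) = f z"
    using holomorphic_logarithm_exists[OF convex_uhp open_uhp holo nz i_in_uhp] by metis
  obtain chi where "\<And>\<gamma> z. \<gamma> \<in> Gamma0 N \<Longrightarrow> z \<in> uhp \<Longrightarrow>
      f (mob \<gamma> z) = chi \<gamma> * jfac \<gamma> z powi 0 * f z"
    using f(1) unfolding gmf_def by blast
  hence chi: "f (mob \<gamma> z) = chi \<gamma> * f z" if "\<gamma> \<in> Gamma0 N" "z \<in> uhp" for \<gamma> z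
    using that by (simp only: power_int_0_right mult_1_right)
  have cont: "continuous_on uhp (\<lambda>z. F (mob \<sigma> z))" if "\<sigma> \<in> SL2Z" for \<sigma>
    by (rule continuous_on_compose2[OF holomorphic_on_imp_continuous_on[OF F(1)]
          holomorphic_on_imp_continuous_on[OF mob_holomorphic[OF that]]])
      (use mob_in_uhp[OF that] in auto)
  define \<kappa> where "\<kappa> \<gamma> = F (mob \<gamma> \<i>) - F \<i>" for \<gamma>
  have "cusp_log N F \<kappa>"
  proof
    show "N \<ge> 1" "F holomorphic_on uhp" by fact+
  next
    fix \<gamma> z assume g: "\<gamma> \<in> Gamma0 N" and z: "z \<in> uhp"
    have s: "\<gamma> \<in> SL2Z" using Gamma0_subset_SL2Z[OF g] .
    define Z where "Z z = F (mob \<gamma> z) - F z" for z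
    have "Z z = Z \<i>"
    proof (rule exp_constant_imp_constant[where Z = Z and S = uhp and w = "chi \<gamma>"])
      show "continuous_on uhp Z" unfolding Z_def
        by (intro continuous_intros cont s holomorphic_on_imp_continuous_on F)
      show "exp (Z x) = chi \<gamma>" if "x \<in> uhp" for x
        using F(2)[OF that] F(2)[OF mob_in_uhp[OF s that]] chi[OF g that] nz[OF that]
        by (simp add: Z_def exp_diff)
    qed (use z i_in_uhp convex_uhp in \<open>auto intro: convex_connected\<close>)
    thus "F (mob \<gamma> z) = F z + \<kappa> \<gamma>" by (simp add: Z_def \<kappa>_def algebra_simps)
  next
    fix \<sigma> assume s: "\<sigma> \<in> SL2Z"
    obtain L where L: "L \<noteq> 0" "((\<lambda>z. f (mob \<sigma> z)) \<longlongrightarrow> L) at_i_infty"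
      using f(2) s unfolding div_zero0_def by blast
    \<comment> \<open>Near the cusp \<open>h\<close> stays within distance \<open>1\<close> of
      \<open>1\<close>, where \<open>Ln\<close> is continuous. There \<open>Ln (h z)\<close> and
      \<open>F (mob \<sigma> z)\<close> differ by a constant, so \<open>F\<close> has a limit
      too.\<close>
    define h where "h z = f (mob \<sigma> z) / L" for z
    have h1: "(h \<longlongrightarrow> 1) at_i_infty"
      using tendsto_divide[OF L(2) tendsto_const, of L] L(1) by (simp add: h_def[abs_def])
    hence "eventually (\<lambda>z. dist (h z) 1 < 1) at_i_infty" by (rule tendstoD) simp
    then obtain Y where Y: "\<And>z. Im z > Y \<Longrightarrow> dist (h z) 1 < 1" by (auto simp: eventually_at_i_infty)
    define S where "S = {z. Im z > max Y 0}"
    have Su: "S \<subseteq> uhp" by (auto simp: S_def in_uhp_iff)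
    have slit: "h z \<notin> \<real>\<^sub>\<le>\<^sub>0" if "z \<in> S" for z
    proof
      assume "h z \<in> \<real>\<^sub>\<le>\<^sub>0"
      hence "Re (h z) \<le> 0" by (auto simp: complex_nonpos_Reals_iff)
      moreover have "\<bar>Re (h z - 1)\<bar> < 1"
        using Y[of z] that abs_Re_le_cmod[of "h z - 1"] by (simp add: S_def dist_norm)
      ultimately show False by simp
    qed
    define Z where "Z z = F (mob \<sigma> z) - Ln (h z)" for z
    define z1 where "z1 = \<i> * of_real (max Y 0 + 1)"
    have ch: "continuous_on S h" 
    proof -
      have "continuous_on S (\<lambda>z. exp (F (mob \<sigma> z)) / L)"
        using L(1) by (intro continuous_intros continuous_on_subset[OF cont[OF s] Su]) auto
      moreover have "exp (F (mob \<sigma> z)) / L = h z" if "z \<in> S" for z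
        using F(2)[OF mob_in_uhp[OF s]] that Su by (auto simp: h_def)
      ultimately show ?thesis by (rule continuous_on_eq)
    qed
    have const: "Z z = Z z1" if "z \<in> S" for z
    proof (rule exp_constant_imp_constant[where Z = Z and S = S and w = L])
      show "connected S" unfolding S_def by (intro convex_connected convex_halfspace_Im_gt)
      show "continuous_on S Z" unfolding Z_def
        by (intro continuous_intros continuous_on_subset[OF cont[OF s] Su] ch) (use slit in auto)
      show "exp (Z x) = L" if "x \<in> S" for x
      proof -
        have "mob \<sigma> x \<in> uhp" using mob_in_uhp[OF s] that Su by blast
        moreover have "h x \<noteq> 0" using slit[OF that] by auto
        ultimately show ?thesis using F(2)[of "mob \<sigma> x"] nz[of "mob \<sigma> x"] L(1)
          by (simp add: Z_def exp_diff h_def)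
      qed
    qed (use that in \<open>auto simp: S_def z1_def\<close>)
    have "((\<lambda>z. Z z1 + Ln (h z)) \<longlongrightarrow> Z z1 + Ln 1) at_i_infty"
      by (intro tendsto_add tendsto_const tendsto_Ln h1) simp
    moreover have "eventually (\<lambda>z. Z z1 + Ln (h z) = F (mob \<sigma> z)) at_i_infty"
      unfolding eventually_at_i_infty
    proof (intro exI[of _ "max Y 0"] allI impI)
      fix z assume "Im z > max Y 0"
      hence "Z z = Z z1" by (intro const) (simp add: S_def)
      thus "Z z1 + Ln (h z) = F (mob \<sigma> z)" unfolding Z_def by (simp add: algebra_simps)
    qed
    ultimately have "((\<lambda>z. F (mob \<sigma> z)) \<longlongrightarrow> Z z1 + Ln 1) at_i_infty"
      by (rule Lim_transform_eventually)
    thus "\<exists>L. ((\<lambda>z. F (mob \<sigma> z)) \<longlongrightarrow> L) at_i_infty" ..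
  qed
  thus ?thesis using that F(2) by blast
qed

theorem mainTheorem10:
  fixes N :: nat and f :: "complex \<Rightarrow> complex" and c :: "nat \<Rightarrow> complex"
  assumes "N \<ge> 1"
    and "gmf N 0 f"
    and "div_zero0 f"
    and "\<not> (\<exists>C. \<forall>z\<in>uhp. f z = C)"
    and "q_exponents f c"
    and "normalized_hecke_eigenform N (\<lambda>z. deriv f z / (2 * of_real pi * \<i> * f z))"
  shows "finite {p::nat. prime p \<and> c p \<noteq> 0 \<and> c p \<in> ring_of_integers (gen_field (c ` {1..}))}"
proof -
  obtain F \<kappa> where cl: "cusp_log N F \<kappa>" and F: "\<And>z. z \<in> uhp \<Longrightarrow> exp (F z) = f z"
    using cusp_log_exists[OF assms(1-3)] by metis
  interpret cusp_log N F \<kappa> by (rule cl)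
  define g where "g z = deriv f z / (2 * of_real pi * \<i> * f z)" for z
  obtain b where cf: "cusp_form2 N g" and b: "fourier_coeffs g b" "b 1 = 1" "hecke_eigen_coeffs N b"
    using assms(6) unfolding normalized_hecke_eigenform_def g_def[abs_def] by blast
  have b0: "b 0 = 0" by (rule fourier_coeff_0_eq_0[OF b(1) cf])
  have f_holo: "f holomorphic_on uhp" using assms(2) by (simp add: gmf_def)
  have f_nz: "f z \<noteq> 0" if "z \<in> uhp" for z using F[OF that] by (metis exp_not_eq_zero)
  have dF: "deriv F z = 2 * of_real pi * \<i> * g z" if z: "z \<in> uhp" for z
  proof -
    have "((\<lambda>z. exp (F z)) has_field_derivative exp (F z) * deriv F z) (at z)"
      using has_deriv_F[OF z] by (auto intro!: derivative_eq_intros)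
    hence "(f has_field_derivative exp (F z) * deriv F z) (at z)"
      by (rule has_field_derivative_transform_within_open[OF _ open_uhp z]) (rule F)
    hence "deriv f z = f z * deriv F z" using F[OF z] by (simp add: DERIV_imp_deriv)
    thus ?thesis using f_nz[OF z] by (simp add: g_def)
  qed
  have nc: "\<not> F constant_on uhp"
  proof
    assume "F constant_on uhp"
    then obtain k where "\<And>z. z \<in> uhp \<Longrightarrow> F z = k" by (auto simp: constant_on_def)
    hence "\<forall>z\<in>uhp. f z = exp k" using F by metis
    thus False using assms(4) by blast
  qed
  have eigen: "hecke_eigen p (b p)" if p: "prime p" "\<not> p dvd N" for p
  proof (rule hecke_eigenI)
    show p1: "p \<ge> 1" using prime_gt_0_nat[OF p(1)] by simp
    fix z assume z: "z \<in> uhp"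
    have u: "of_nat p * z \<in> uhp" "(z + of_nat j) / of_nat p \<in> uhp" for j
      using z p1 by (auto simp: in_uhp_iff Im_divide_of_nat)
    have "of_nat p * deriv F (of_nat p * z) + (\<Sum>j<p. deriv F ((z + of_nat j) / of_nat p)) / of_nat p
      = 2 * of_real pi * \<i> * (of_nat p * g (of_nat p * z) + (\<Sum>j<p. g ((z + of_nat j) / of_nat p)) / of_nat p)"
      by (simp only: dF[OF u(1)] dF[OF u(2)] sum_distrib_left[symmetric]) (simp add: algebra_simps)
    also have "\<dots> = b p * deriv F z"
      unfolding hecke_eigen_coeffs_imp_functional_equation[OF b(1) b0 b(2,3) p z] dF[OF z] by simp
    finally show "of_nat p * deriv F (of_nat p * z) + (\<Sum>j<p. deriv F ((z + of_nat j) / of_nat p)) / of_nat p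
      = b p * deriv F z" .
  qed
  have exponents: "b k = - (\<Sum>n | n dvd k. of_nat n * c n)" if "k \<ge> 1" for k
    by (rule q_exponents_imp_fourier_coeffs[OF f_holo f_nz b(1)[unfolded g_def[abs_def]] b0 assms(5) that])
  have "b 1 = - c 1" using exponents[of 1] by simp
  hence c1: "c 1 = -1" using b(2) by (metis minus_minus)
  have bp: "b p = 1 - of_nat p * c p" if p: "prime p" for p
  proof -
    have "{n. n dvd p} = {1, p}" using p by (auto simp: prime_nat_iff)
    moreover have "p \<noteq> 1" "p \<ge> 1" using prime_gt_1_nat[OF p] by auto
    ultimately show ?thesis using exponents[of p] c1 by simp
  qed
  obtain j0 where j0: "j0 < M" "v j0 \<noteq> 0" using constant_if_modular_symbols_vanish nc by blast
  obtain \<delta> p0 where \<delta>: "\<delta> > 0"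
    "\<And>p b. p \<ge> p0 \<Longrightarrow> hecke_eigen p b \<Longrightarrow> norm b \<le> (1 - \<delta>) * real p + 1"
    using hecke_eigenvalue_bound[OF nc] by metis
  \<comment> \<open>The first factor bounds \<open>norm (c p)\<close>, the second its conjugates;
    the product tends to \<open>1 - \<delta>\<close>, below \<open>1\<close>.\<close>
  have "(\<lambda>p. ((1 - \<delta>) + 2 / real p) * (1 + 2 / real p) ^ M) \<longlonglongrightarrow> ((1 - \<delta>) + 0) * (1 + 0) ^ M"
    by (intro tendsto_intros lim_const_over_n)
  hence "eventually (\<lambda>p. ((1 - \<delta>) + 2 / real p) * (1 + 2 / real p) ^ M < 1) sequentially"
    by (rule order_tendstoD(2)) (use \<delta> in simp)
  then obtain p1 where p1: "\<And>p. p \<ge> p1 \<Longrightarrow> ((1 - \<delta>) + 2 / real p) * (1 + 2 / real p) ^ M < 1"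
    by (auto simp: eventually_sequentially)
  have "p < max (max p0 p1) (N + 1)" if p: "prime p" "c p \<noteq> 0" "algebraic_int (c p)" for p
  proof (rule ccontr)
    assume "\<not> ?thesis"
    hence large: "p \<ge> p0" "p \<ge> p1" "p > N" by auto
    have p_pos: "p \<ge> 1" using prime_gt_0_nat[OF p(1)] by simp
    have "\<not> p dvd N" using large(3) assms(1) by (auto dest: dvd_imp_le)
    hence h: "hecke_eigen p (1 - of_nat p * c p)" using eigen[OF p(1)] bp[OF p(1)] by simp
    have "real p * norm (c p) = norm (1 - (1 - of_nat p * c p))" by (simp add: norm_mult)
    also have "\<dots> \<le> norm (1::complex) + norm (1 - of_nat p * c p)" by (rule norm_triangle_ineq4)
    also have "\<dots> \<le> (1 - \<delta>) * real p + 2" using \<delta>(2)[OF large(1) h] by simp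
    finally have "norm (c p) \<le> (1 - \<delta>) + 2 / real p" using p_pos by (simp add: field_simps)
    hence "norm (c p) * (1 + 2 / real p) ^ M \<le> ((1 - \<delta>) + 2 / real p) * (1 + 2 / real p) ^ M"
      by (intro mult_right_mono) auto
    also have "\<dots> < 1" by (rule p1[OF large(2)])
    finally have "norm (c p) * (1 + 2 / real p) ^ M < 1" .
    moreover have "(real p + 2) / real p = 1 + 2 / real p" using p_pos by (simp add: field_simps)
    ultimately show False using hecke_eigen_norm_bound[OF h p_pos p(3,2) j0] by simp
  qed
  thus ?thesis
    by (intro finite_subset[OF _ finite_lessThan[of "max (max p0 p1) (N + 1)"]])
      (auto simp: ring_of_integers_def)
qed

end
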